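(* Let $\omega:\mathbb{R}^+\to\mathbb{R}^+$ be a function such that $\omega(t)/t$ is concave and $\sum_{n\ge1}\frac{1}{\omega(n)}=\infty$. Then there exist a compact set $K\subset\mathbb{T}$ of Lebesgue measure zero and a trigonometric series $\sum_{n\in\mathbb{Z}}c(n)e^{int}$ with not all $c(n)$ zero, whose symmetric partial sums converge to $0$ at every $t\in\mathbb{T}\setminus K$, and such that $c(n)=O\big(e^{-\omega(\log|n|)}\big)$ for $n<0$.
   Context: $\mathbb{T}=\mathbb{R}/2\pi\mathbb{Z}$; symmetric partial sums are $\sum_{|n|\le N}c(n)e^{int}$. *)

theory Defs
  imports "HOL-Analysis.Analysis"
begin

end

theory Submission
  imports Defs "HOL-Complex_Analysis.Complex_Analysis" "HOL-Real_Asymp.Real_Asymp"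
begin

text \<open>
  Write \<open>\<omega>(t) = t g(t)\<close>; the concave positive function \<open>g\<close> is increasing, \<open>g(t)/t\<close> is decreasing, and the
  hypothesis says that \<open>1/g(2^k)\<close> is not summable.

  One level. With \<open>q(z) = (1 - z)/(1 - (1 - \<eta>) z)\<close> the power \<open>q^M\<close> is analytic, equals 1 at 0, has
  coefficients summing to about \<open>e^(2 \<eta> M)/\<eta>\<close>, and is of size \<open>e^(-M)\<close> near \<open>z = 1\<close>. On an arc of length
  comparable to \<open>\<eta>\<close> it coincides with a smooth function \<open>Y\<close> of norm \<open>e^(-M)\<close> in a non-quasianalytic Beurling
  algebra, so \<open>S = q^M - Y\<close> vanishes on that arc and its antianalytic part is of size \<open>e^(-M)\<close>.
  Taking \<open>M\<close> of order \<open>\<omega>(log D)\<close> and \<open>\<eta>\<close> of order \<open>1/g(log D)\<close>, the coefficients of \<open>S\<close> sum to a small power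
  of \<open>D\<close>, while those of \<open>S(D t)\<close> with negative index obey the required bound.

  All levels. For \<open>D_k = 2^(2^k)\<close> the products \<open>R_n(t) = S_0(D_0 t) \<cdots> S_n(D_n t)\<close> vanish on an increasing sequence
  of open sets, whose union has null complement because \<open>1/g(log D_k)\<close> is not summable. The coefficients of
  \<open>R_n\<close> converge in the norm with weight \<open>n^(-1/3)\<close> for positive and \<open>e^(\<omega>(log |n|))\<close> for negative indices, but need
  not tend to 0.

  Smoothing. Composing with a Moebius transformation of the disc keeps the antianalytic part small and replaces
  \<open>e^(i n t)\<close> by a function whose coefficients are \<open>O(|n|^(-1/3))\<close> by van der Corput's lemma. Hence the
  coefficients of the limit tend to 0, and Riemann's localization principle gives convergence to 0 off the null set.
\<close>

section \<open>Fourier series with weighted coefficient norms\<close>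

text \<open>The scales come from a balance. Once dilated by D, the negative frequencies of the
  correction Y carry weight about e^(\<omega>(log D)), so q^M must be small enough on the arc to
  offset it: M ~ \<omega>(log D). The analytic part is affordable as a small power of D only while
  \<eta> M is at most a small multiple of log D. Together these fix \<eta>, hence the arc length.
  Every further factor may enlarge the coefficient sums, so convergence is not sought in the
  absolute norm. Squaring the dilation at each level keeps the norm of \<open>R n\<close>, the
  product of the factors before level n, below D_n^(1/8). The factor S_n - 1 costs another
  D_n^(1/12) and lives, up to a tiny error, on frequencies >= D_n, where the weight n^(-1/3) gains
  D_n^(-1/3). As 1/8 + 1/12 - 1/3 = -1/8, the increments are summable, and starting at a large level
  makes their total too small to cancel the coefficient 1 of the empty product.\<close>

text \<open>Absolute summability gives meaning to values, products and termwise integrals; the bound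
  \<open>B\<close> concerns only the weighted sum. Both are demanded because a weight may tend to 0,
  as (1 + n)^(-1/3) does, and then a finite weighted sum would not give pointwise
  convergence.\<close>

definition weighted_fourier :: "(int \<Rightarrow> real) \<Rightarrow> real \<Rightarrow> (real \<Rightarrow> complex) \<Rightarrow> bool" where
  "weighted_fourier w B f \<longleftrightarrow> (\<exists>a. (\<lambda>n. norm (a n)) summable_on UNIV \<and> (\<lambda>n. norm (a n) * w n) summable_on UNIV \<and>
     (\<Sum>\<^sub>\<infinity>n. norm (a n) * w n) \<le> B \<and>
     (\<forall>t. ((\<lambda>n. a n * cis (of_int n * t)) has_sum f t) UNIV))"

lemma weighted_fourier_mono:
  assumes "weighted_fourier w B f" and "\<And>n. 0 \<le> w' n" and "\<And>n. w' n \<le> K * w n" and "0 \<le> K" and "K * B \<le> B'"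
  shows "weighted_fourier w' B' f"
proof -
  obtain a where a: "(\<lambda>n. norm (a n)) summable_on UNIV" "(\<lambda>n. norm (a n) * w n) summable_on UNIV"
    "(\<Sum>\<^sub>\<infinity>n. norm (a n) * w n) \<le> B" "\<And>t. ((\<lambda>n. a n * cis (of_int n * t)) has_sum f t) UNIV"
    using assms(1) unfolding weighted_fourier_def by blast
  have s: "(\<lambda>n. K * (norm (a n) * w n)) summable_on UNIV"
    using a(2) by (rule summable_on_cmult_right)
  have le: "norm (a n) * w' n \<le> K * (norm (a n) * w n)" for n
    using mult_left_mono[OF assms(3)[of n], of "norm (a n)"] by (simp add: algebra_simps)
  have s': "(\<lambda>n. norm (a n) * w' n) summable_on UNIV"
    by (rule summable_on_comparison_test[OF s]) (use le assms(2) in auto)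
  have "(\<Sum>\<^sub>\<infinity>n. norm (a n) * w' n) \<le> (\<Sum>\<^sub>\<infinity>n. K * (norm (a n) * w n))"
    by (rule infsum_mono[OF s' s]) (use le in auto)
  also have "\<dots> = K * (\<Sum>\<^sub>\<infinity>n. norm (a n) * w n)"
    by (rule infsum_cmult_right) (use a in auto)
  also have "\<dots> \<le> K * B" using a(3) assms(4) by (rule mult_left_mono)
  finally show ?thesis unfolding weighted_fourier_def using a s' assms(5) by (intro exI[of _ a]) auto
qed

lemma weighted_fourier_monomial: "weighted_fourier w (norm c * w n) (\<lambda>t. c * cis (of_int n * t))"
proof -
  have *: "((\<lambda>k. f k (if k = n then c else 0)) has_sum f n c) UNIV"
    if "\<And>k. f k 0 = 0" for f :: "int \<Rightarrow> complex \<Rightarrow> 'b :: {topological_comm_monoid_add,t3_space}"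
    by (rule has_sum_finite_neutralI[of "{n}"]) (use that in auto)
  have 1: "((\<lambda>k. norm (if k = n then c else 0) * w k) has_sum norm c * w n) UNIV"
    using *[of "\<lambda>k z. norm z * w k"] by simp
  have 2: "((\<lambda>k. norm (if k = n then c else 0)) has_sum norm c) UNIV"
    using *[of "\<lambda>k z. norm z"] by simp
  have 3: "((\<lambda>k. (if k = n then c else 0) * cis (of_int k * t)) has_sum c * cis (of_int n * t)) UNIV" for t
    using *[of "\<lambda>k z. z * cis (of_int k * t)"] by simp
  show ?thesis unfolding weighted_fourier_def using 1 2 3
    by (intro exI[of _ "\<lambda>k. if k = n then c else 0"]) (auto simp: has_sum_iff)
qed

lemma weighted_fourier_add:
  assumes "weighted_fourier w B f" "weighted_fourier w C g" "\<And>n. 0 \<le> w n"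
  shows "weighted_fourier w (B + C) (\<lambda>t. f t + g t)"
proof -
  obtain a where a: "(\<lambda>n. norm (a n)) summable_on UNIV" "(\<lambda>n. norm (a n) * w n) summable_on UNIV"
    "(\<Sum>\<^sub>\<infinity>n. norm (a n) * w n) \<le> B" "\<And>t. ((\<lambda>n. a n * cis (of_int n * t)) has_sum f t) UNIV"
    using assms(1) unfolding weighted_fourier_def by blast
  obtain b where b: "(\<lambda>n. norm (b n)) summable_on UNIV" "(\<lambda>n. norm (b n) * w n) summable_on UNIV"
    "(\<Sum>\<^sub>\<infinity>n. norm (b n) * w n) \<le> C" "\<And>t. ((\<lambda>n. b n * cis (of_int n * t)) has_sum g t) UNIV"
    using assms(2) unfolding weighted_fourier_def by blast
  have s1: "(\<lambda>n. norm (a n) + norm (b n)) summable_on UNIV"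
    using a(1) b(1) by (rule summable_on_add)
  have s1': "(\<lambda>n. norm (a n + b n)) summable_on UNIV"
    by (rule summable_on_comparison_test[OF s1]) (auto intro: norm_triangle_ineq)
  have s2: "(\<lambda>n. norm (a n) * w n + norm (b n) * w n) summable_on UNIV"
    using a(2) b(2) by (rule summable_on_add)
  have le: "norm (a n + b n) * w n \<le> norm (a n) * w n + norm (b n) * w n" for n
    using mult_right_mono[OF norm_triangle_ineq[of "a n" "b n"] assms(3)[of n]] by (simp add: algebra_simps)
  have s2': "(\<lambda>n. norm (a n + b n) * w n) summable_on UNIV"
    by (rule summable_on_comparison_test[OF s2]) (use le assms(3) in auto)
  have "(\<Sum>\<^sub>\<infinity>n. norm (a n + b n) * w n) \<le> (\<Sum>\<^sub>\<infinity>n. norm (a n) * w n + norm (b n) * w n)"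
    by (rule infsum_mono[OF s2' s2]) (use le in auto)
  also have "\<dots> = (\<Sum>\<^sub>\<infinity>n. norm (a n) * w n) + (\<Sum>\<^sub>\<infinity>n. norm (b n) * w n)"
    using a(2) b(2) by (rule infsum_add)
  also have "\<dots> \<le> B + C" using a(3) b(3) by simp
  finally have le2: "(\<Sum>\<^sub>\<infinity>n. norm (a n + b n) * w n) \<le> B + C" .
  have "((\<lambda>n. (a n + b n) * cis (of_int n * t)) has_sum (f t + g t)) UNIV" for t
    using has_sum_add[OF a(4) b(4), of t t] by (simp add: algebra_simps)
  with s1' s2' le2 show ?thesis unfolding weighted_fourier_def by (intro exI[of _ "\<lambda>n. a n + b n"]) auto
qed

lemma weighted_fourier_uminus:
  assumes "weighted_fourier w B f"
  shows "weighted_fourier w B (\<lambda>t. - f t)"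
proof -
  obtain a where a: "(\<lambda>n. norm (a n)) summable_on UNIV" "(\<lambda>n. norm (a n) * w n) summable_on UNIV"
    "(\<Sum>\<^sub>\<infinity>n. norm (a n) * w n) \<le> B" "\<And>t. ((\<lambda>n. a n * cis (of_int n * t)) has_sum f t) UNIV"
    using assms unfolding weighted_fourier_def by blast
  have "((\<lambda>n. - a n * cis (of_int n * t)) has_sum - f t) UNIV" for t
    using has_sum_uminusI[OF a(4)[of t]] by simp
  then show ?thesis unfolding weighted_fourier_def using a(1-3) by (intro exI[of _ "\<lambda>n. - a n"]) simp
qed

lemma has_sum_product:
  fixes f :: "'a \<Rightarrow> 'c :: {real_normed_algebra, banach}" and g :: "'b \<Rightarrow> 'c"
  assumes "(f has_sum S) A" "(g has_sum T) B" "(\<lambda>x. norm (f x)) summable_on A" "(\<lambda>x. norm (g x)) summable_on B"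
  shows "((\<lambda>(x, y). f x * g y) has_sum S * T) (A \<times> B)"
proof -
  have "(\<lambda>(x, y). f x * g y) summable_on (A \<times> B)"
  proof (rule abs_summable_summable)
    have s1: "(\<lambda>(x, y). norm (f x) * norm (g y)) summable_on (A \<times> B)"
    proof (rule summable_on_SigmaI[where g = "\<lambda>x. norm (f x) * (\<Sum>\<^sub>\<infinity>y\<in>B. norm (g y))"])
      show "((\<lambda>y. case (x, y) of (x, y) \<Rightarrow> norm (f x) * norm (g y)) has_sum norm (f x) * (\<Sum>\<^sub>\<infinity>y\<in>B. norm (g y))) B" for x
        using assms(4) by (auto intro!: has_sum_cmult_right)
      show "(\<lambda>x. norm (f x) * (\<Sum>\<^sub>\<infinity>y\<in>B. norm (g y))) summable_on A"
        using assms(3) by (rule summable_on_cmult_left)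
    qed auto
    show "(\<lambda>p. norm (case p of (x, y) \<Rightarrow> f x * g y)) summable_on (A \<times> B)"
      by (rule summable_on_comparison_test[OF s1]) (auto intro: norm_mult_ineq)
  qed
  then obtain X where X: "((\<lambda>(x, y). f x * g y) has_sum X) (A \<times> B)"
    by (auto simp: summable_on_def)
  have "((\<lambda>x. f x * T) has_sum X) A"
    by (rule has_sum_SigmaD[OF X]) (auto intro!: has_sum_cmult_right assms)
  moreover have "((\<lambda>x. f x * T) has_sum S * T) A"
    using assms(1) by (rule has_sum_cmult_left)
  ultimately show ?thesis using X has_sum_unique by blast
qed

lemma has_sum_convolution:
  fixes f g :: "int \<Rightarrow> 'c :: {real_normed_algebra, banach}"
  assumes "(f has_sum S) UNIV" "(g has_sum T) UNIV" "(\<lambda>n. norm (f n)) summable_on UNIV" "(\<lambda>n. norm (g n)) summable_on UNIV"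
  shows "((\<lambda>(n, m). f (n - m) * g m) has_sum S * T) (UNIV \<times> UNIV)"
proof -
  have "((\<lambda>(n, m). f (n - m) * g m) has_sum S * T) (UNIV \<times> UNIV) \<longleftrightarrow>
        ((\<lambda>(x, y). f x * g y) has_sum S * T) (UNIV \<times> UNIV)"
    by (rule has_sum_reindex_bij_witness[where i = "\<lambda>(x, y). (x + y, y)" and j = "\<lambda>(n, m). (n - m, m)"]) auto
  with has_sum_product[OF assms] show ?thesis by blast
qed

text \<open>The coefficients of the product are convolutions, and the weight inequality is applied
  under the double sum. Three different weights are allowed because the increments of the products
  pair two growing weights with a decaying target weight, gaining the factor
  \<open>\<kappa>\<close>.\<close>

lemma weighted_fourier_mult:
  assumes "weighted_fourier w1 B f" "weighted_fourier w2 C g" and w: "\<And>n. 0 \<le> w1 n" "\<And>n. 0 \<le> w2 n" "\<And>n. 0 \<le> w3 n"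
    and le: "\<And>n m. w3 (n + m) \<le> \<kappa> * (w1 n * w2 m)" and \<kappa>: "0 \<le> \<kappa>"
  shows "weighted_fourier w3 (\<kappa> * (B * C)) (\<lambda>t. f t * g t)"
proof -
  obtain a where a: "(\<lambda>n. norm (a n)) summable_on UNIV" "(\<lambda>n. norm (a n) * w1 n) summable_on UNIV"
    "(\<Sum>\<^sub>\<infinity>n. norm (a n) * w1 n) \<le> B" "\<And>t. ((\<lambda>n. a n * cis (of_int n * t)) has_sum f t) UNIV"
    using assms(1) unfolding weighted_fourier_def by blast
  obtain b where b: "(\<lambda>n. norm (b n)) summable_on UNIV" "(\<lambda>n. norm (b n) * w2 n) summable_on UNIV"
    "(\<Sum>\<^sub>\<infinity>n. norm (b n) * w2 n) \<le> C" "\<And>t. ((\<lambda>n. b n * cis (of_int n * t)) has_sum g t) UNIV"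
    using assms(2) unfolding weighted_fourier_def by blast
  define c where "c n = (\<Sum>\<^sub>\<infinity>m. a (n - m) * b m)" for n
  have n1: "((\<lambda>(n, m). norm (a (n - m)) * norm (b m)) has_sum
      (\<Sum>\<^sub>\<infinity>n. norm (a n)) * (\<Sum>\<^sub>\<infinity>n. norm (b n))) (UNIV \<times> UNIV)"
    by (rule has_sum_convolution) (use a b in auto)
  have n2: "((\<lambda>(n, m). (norm (a (n - m)) * w1 (n - m)) * (norm (b m) * w2 m)) has_sum
      (\<Sum>\<^sub>\<infinity>n. norm (a n) * w1 n) * (\<Sum>\<^sub>\<infinity>n. norm (b n) * w2 n)) (UNIV \<times> UNIV)"
    by (rule has_sum_convolution) (use a b w in auto)
  have r1: "(\<lambda>m. norm (a (n - m)) * norm (b m)) summable_on UNIV" for n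
    using summable_on_SigmaD1[OF has_sum_imp_summable[OF n1], of n] by auto
  have r2: "(\<lambda>m. (norm (a (n - m)) * w1 (n - m)) * (norm (b m) * w2 m)) summable_on UNIV" for n
    using summable_on_SigmaD1[OF has_sum_imp_summable[OF n2], of n] w by auto
  have c1: "norm (c n) \<le> (\<Sum>\<^sub>\<infinity>m. norm (a (n - m)) * norm (b m))" for n
    unfolding c_def using norm_infsum_bound[of "\<lambda>m. a (n - m) * b m" UNIV] r1[of n] by (simp add: norm_mult)
  have t1: "(\<lambda>n. \<Sum>\<^sub>\<infinity>m. norm (a (n - m)) * norm (b m)) summable_on UNIV"
    using has_sum_imp_summable[OF has_sum_SigmaD[OF n1 has_sum_infsum]] r1 by auto
  have t2: "((\<lambda>n. \<Sum>\<^sub>\<infinity>m. (norm (a (n - m)) * w1 (n - m)) * (norm (b m) * w2 m)) has_sum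
        (\<Sum>\<^sub>\<infinity>n. norm (a n) * w1 n) * (\<Sum>\<^sub>\<infinity>n. norm (b n) * w2 n)) UNIV"
    by (rule has_sum_SigmaD[OF n2]) (use r2 in auto)
  have s1: "(\<lambda>n. norm (c n)) summable_on UNIV"
    by (rule summable_on_comparison_test[OF t1]) (use c1 in auto)
  have c2: "norm (c n) * w3 n \<le> \<kappa> * (\<Sum>\<^sub>\<infinity>m. (norm (a (n - m)) * w1 (n - m)) * (norm (b m) * w2 m))" for n
  proof -
    have "norm (c n) * w3 n \<le> (\<Sum>\<^sub>\<infinity>m. norm (a (n - m)) * norm (b m)) * w3 n"
      using c1 w(3) by (rule mult_right_mono)
    also have "\<dots> = (\<Sum>\<^sub>\<infinity>m. norm (a (n - m)) * norm (b m) * w3 n)"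
      by (rule infsum_cmult_left[symmetric]) (use r1 in auto)
    also have "\<dots> \<le> (\<Sum>\<^sub>\<infinity>m. \<kappa> * ((norm (a (n - m)) * w1 (n - m)) * (norm (b m) * w2 m)))"
    proof (rule infsum_mono)
      show "norm (a (n - m)) * norm (b m) * w3 n \<le> \<kappa> * ((norm (a (n - m)) * w1 (n - m)) * (norm (b m) * w2 m))" for m
        using mult_left_mono[OF le[of "n - m" m], of "norm (a (n - m)) * norm (b m)"] by (simp add: algebra_simps)
    qed (use r1 r2 in \<open>auto intro!: summable_on_cmult_left summable_on_cmult_right\<close>)
    also have "\<dots> = \<kappa> * (\<Sum>\<^sub>\<infinity>m. (norm (a (n - m)) * w1 (n - m)) * (norm (b m) * w2 m))"
      by (rule infsum_cmult_right) (use r2 in auto)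
    finally show ?thesis .
  qed
  note t3 = has_sum_cmult_right[OF t2, of \<kappa>]
  have s2: "(\<lambda>n. norm (c n) * w3 n) summable_on UNIV"
    by (rule summable_on_comparison_test[OF has_sum_imp_summable[OF t3]]) (use c2 w in auto)
  have "(\<Sum>\<^sub>\<infinity>n. norm (c n) * w3 n) \<le> \<kappa> * ((\<Sum>\<^sub>\<infinity>n. norm (a n) * w1 n) * (\<Sum>\<^sub>\<infinity>n. norm (b n) * w2 n))"
    using has_sum_mono[OF has_sum_infsum[OF s2] t3] c2 by auto
  also have "\<dots> \<le> \<kappa> * (B * C)"
  proof -
    have "0 \<le> B" using infsum_nonneg[of UNIV "\<lambda>n. norm (a n) * w1 n"] a(3) w by (auto intro: order_trans)
    then show ?thesis
      using a(3) b(3) \<kappa> w by (intro mult_left_mono mult_mono) (auto intro!: infsum_nonneg)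
  qed
  finally have s3: "(\<Sum>\<^sub>\<infinity>n. norm (c n) * w3 n) \<le> \<kappa> * (B * C)" .
  have "((\<lambda>n. c n * cis (of_int n * t)) has_sum f t * g t) UNIV" for t
  proof (rule has_sum_SigmaD)
    show "((\<lambda>(n, m). (a (n - m) * cis (of_int (n - m) * t)) * (b m * cis (of_int m * t))) has_sum f t * g t) (UNIV \<times> UNIV)"
      using a(1) b(1) by (intro has_sum_convolution a(4) b(4)) (simp_all add: norm_mult)
    have "((\<lambda>m. a (n - m) * b m) has_sum c n) UNIV" for n
      unfolding c_def by (rule has_sum_infsum, rule abs_summable_summable) (use r1[of n] in \<open>simp add: norm_mult\<close>)
    then have "((\<lambda>m. a (n - m) * b m * cis (of_int n * t)) has_sum c n * cis (of_int n * t)) UNIV" for n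
      by (rule has_sum_cmult_left)
    moreover have "a (n - m) * b m * cis (of_int n * t) =
        (a (n - m) * cis (of_int (n - m) * t)) * (b m * cis (of_int m * t))" for n m
    proof -
      have "cis (of_int n * t) = cis (of_int (n - m) * t) * cis (of_int m * t)"
        by (simp add: cis_mult algebra_simps)
      then show ?thesis by simp
    qed
    ultimately have "((\<lambda>m. (a (n - m) * cis (of_int (n - m) * t)) * (b m * cis (of_int m * t)))
          has_sum c n * cis (of_int n * t)) UNIV" for n
      by (simp only:)
    then show "((\<lambda>m. case (n, m) of (n, m) \<Rightarrow> (a (n - m) * cis (of_int (n - m) * t)) * (b m * cis (of_int m * t)))
          has_sum c n * cis (of_int n * t)) UNIV" for n
      by (simp only: prod.case)
  qed
  with s1 s2 s3 show ?thesis unfolding weighted_fourier_def by blast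
qed

lemma weighted_fourier_power:
  assumes f: "weighted_fourier w B f" and w: "\<And>n. 0 \<le> w n" "w 0 \<le> 1" "\<And>n m. w (n + m) \<le> w n * w m"
  shows "weighted_fourier w (B ^ M) (\<lambda>t. f t ^ M)"
proof (induction M)
  case 0
  show ?case using weighted_fourier_mono[OF weighted_fourier_monomial[of w 1 0], of w 1 1] w by simp
next
  case (Suc M)
  show ?case using weighted_fourier_mult[OF f Suc.IH, of w 1] w by simp
qed

lemma weighted_fourier_dilate:
  assumes "weighted_fourier (\<lambda>m. w (D * m)) B f" and "D \<noteq> 0"
  shows "weighted_fourier w B (\<lambda>t. f (of_int D * t))"
proof -
  obtain a where a: "(\<lambda>n. norm (a n)) summable_on UNIV" "(\<lambda>n. norm (a n) * w (D * n)) summable_on UNIV"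
    "(\<Sum>\<^sub>\<infinity>n. norm (a n) * w (D * n)) \<le> B" "\<And>t. ((\<lambda>n. a n * cis (of_int n * t)) has_sum f t) UNIV"
    using assms(1) unfolding weighted_fourier_def by blast
  define b where "b n = (if D dvd n then a (n div D) else 0)" for n
  have bij: "bij_betw (\<lambda>n. D * n) UNIV {n. D dvd n}"
    using assms(2) by (intro bij_betwI[where g = "\<lambda>n. n div D"]) auto
  \<comment> \<open>One transport rule serves the absolute, the weighted and the pointwise sum;
    \<open>F n 0 = 0\<close> accounts for the indices not divisible by \<open>D\<close>.\<close>
  have *: "((\<lambda>n. F n (b n)) has_sum S) UNIV" if "((\<lambda>n. F (D * n) (a n)) has_sum S) UNIV" "\<And>n. F n 0 = 0"
    for S and F :: "int \<Rightarrow> complex \<Rightarrow> 'b :: {comm_monoid_add, topological_space}"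
  proof -
    have "((\<lambda>n. F n (b n)) has_sum S) {n. D dvd n}"
      using that(1) has_sum_reindex_bij_betw[OF bij, of "\<lambda>n. F n (b n)" S] assms(2) by (simp add: b_def)
    then show ?thesis
      by (subst has_sum_cong_neutral[where T = "{n. D dvd n}" and g = "\<lambda>n. F n (b n)"]) (auto simp: b_def that)
  qed
  have 1: "(\<lambda>n. norm (b n)) summable_on UNIV"
    using *[of "\<lambda>n z. norm z"] a(1) unfolding summable_on_def by fastforce
  have 2: "((\<lambda>n. norm (b n) * w n) has_sum (\<Sum>\<^sub>\<infinity>n. norm (a n) * w (D * n))) UNIV"
    using *[of "\<lambda>n z. norm z * w n"] a(2) by simp
  have 3: "((\<lambda>n. b n * cis (of_int n * t)) has_sum f (of_int D * t)) UNIV" for t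
    using *[of "\<lambda>n z. z * cis (of_int n * t)"] a(4)[of "of_int D * t"] by (simp add: mult_ac)
  show ?thesis unfolding weighted_fourier_def using 1 2 3 a(3) by (intro exI[of _ b]) (auto simp: has_sum_iff)
qed

section \<open>Interchange of unordered sums with limits and integrals\<close>

lemma uniform_limit_has_sum:
  fixes F :: "'i \<Rightarrow> 'x \<Rightarrow> complex"
  assumes "a summable_on UNIV" "\<And>n x. norm (F n x) \<le> a n" "\<And>x. ((\<lambda>n. F n x) has_sum f x) UNIV"
  shows "uniform_limit X (\<lambda>I x. \<Sum>n\<in>I. F n x) f (finite_subsets_at_top UNIV)"
  unfolding uniform_limit_iff
proof (intro allI impI)
  fix e :: real assume "e > 0"
  have nn: "0 \<le> a n" for n using order_trans[OF norm_ge_zero assms(2)[of n undefined]] .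
  from assms(1) have "(sum a \<longlongrightarrow> infsum a UNIV) (finite_subsets_at_top UNIV)"
    using has_sum_infsum has_sum_def by blast
  then have "\<forall>\<^sub>F I in finite_subsets_at_top UNIV. dist (sum a I) (infsum a UNIV) < e"
    using \<open>e > 0\<close> by (rule tendstoD)
  moreover have "\<forall>\<^sub>F I in finite_subsets_at_top (UNIV :: 'i set). finite I"
    by (rule eventually_finite_subsets_at_top_weakI) auto
  ultimately show "\<forall>\<^sub>F I in finite_subsets_at_top UNIV. \<forall>x\<in>X. dist (\<Sum>n\<in>I. F n x) (f x) < e"
  proof eventually_elim
    case (elim I)
    have sa: "a summable_on (- I)" using assms(1) by (rule summable_on_subset) auto
    have e: "infsum a UNIV = sum a I + infsum a (- I)"
      using infsum_Un_disjoint[of a I "- I"] elim sa by (simp add: Compl_partition)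
    show ?case
    proof
      fix x
      have sF: "(\<lambda>n. norm (F n x)) summable_on J" for J
        by (rule summable_on_comparison_test[where f = a]) (use assms(1,2) in \<open>auto intro: summable_on_subset\<close>)
      have "f x = (\<Sum>\<^sub>\<infinity>n. F n x)" using assms(3)[of x] by (simp add: has_sum_iff)
      also have "\<dots> = (\<Sum>n\<in>I. F n x) + (\<Sum>\<^sub>\<infinity>n\<in>-I. F n x)"
        using infsum_Un_disjoint[of "\<lambda>n. F n x" I "- I"] elim abs_summable_summable[OF sF] by (simp add: Compl_partition)
      finally have "dist (\<Sum>n\<in>I. F n x) (f x) = norm (\<Sum>\<^sub>\<infinity>n\<in>-I. F n x)"
        by (simp add: dist_norm)
      also have "\<dots> \<le> infsum a (- I)"
        by (rule norm_infsum_le[where f = "\<lambda>n. F n x" and X = "- I" and g = a]) (use sa abs_summable_summable[OF sF] assms(2) in auto)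
      also have "\<dots> < e" using elim e infsum_nonneg[of "-I" a] nn by (simp add: dist_real_def)
      finally show "dist (\<Sum>n\<in>I. F n x) (f x) < e" .
    qed
  qed
qed

lemma has_sum_integral:
  fixes F :: "'i \<Rightarrow> real \<Rightarrow> complex"
  assumes "a summable_on UNIV" "\<And>n x. norm (F n x) \<le> a n" "\<And>x. ((\<lambda>n. F n x) has_sum f x) UNIV"
    and c: "\<And>n. continuous_on {\<alpha>..\<beta>} (F n)"
  shows "continuous_on {\<alpha>..\<beta>} f" "((\<lambda>n. integral {\<alpha>..\<beta>} (F n)) has_sum integral {\<alpha>..\<beta>} f) UNIV"
proof -
  note u = uniform_limit_has_sum[OF assms(1-3), where X = "{\<alpha>..\<beta>}"]
  have cs: "continuous_on {\<alpha>..\<beta>} (\<lambda>x. \<Sum>n\<in>I. F n x)" for I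
    by (intro continuous_on_sum c)
  show "continuous_on {\<alpha>..\<beta>} f"
    by (rule uniform_limit_theorem[OF _ u]) (use cs in auto)
  obtain I J where IJ: "\<And>n. ((\<lambda>x. \<Sum>n\<in>n. F n x) has_integral I n) {\<alpha>..\<beta>}"
    "(f has_integral J) {\<alpha>..\<beta>}" "(I \<longlongrightarrow> J) (finite_subsets_at_top UNIV)"
    by (rule uniform_limit_integral[OF u cs]) auto
  have "I A = (\<Sum>n\<in>A. integral {\<alpha>..\<beta>} (F n))" for A
  proof -
    have "I A = integral {\<alpha>..\<beta>} (\<lambda>x. \<Sum>n\<in>A. F n x)" by (rule integral_unique[OF IJ(1), symmetric])
    also have "\<dots> = (\<Sum>n\<in>A. integral {\<alpha>..\<beta>} (F n))"
      by (cases "finite A") (auto intro!: integral_sum integrable_continuous_real c)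
    finally show ?thesis .
  qed
  then have "I = sum (\<lambda>n. integral {\<alpha>..\<beta>} (F n))" by auto
  then show "((\<lambda>n. integral {\<alpha>..\<beta>} (F n)) has_sum integral {\<alpha>..\<beta>} f) UNIV"
    unfolding has_sum_def using IJ by (simp add: integral_unique)
qed

text \<open>Tannery's theorem: domination makes the finite partial sums converge uniformly in the
  parameter, so the two limits may be exchanged.\<close>

lemma infsum_dominated_limit:
  fixes F :: "'k \<Rightarrow> 'i \<Rightarrow> complex"
  assumes a: "a summable_on UNIV" "\<And>k n. norm (F k n) \<le> a n" and lim: "\<And>n. ((\<lambda>k. F k n) \<longlongrightarrow> G n) L"
    and L: "L \<noteq> bot"
  shows "((\<lambda>k. \<Sum>\<^sub>\<infinity>n. F k n) \<longlongrightarrow> (\<Sum>\<^sub>\<infinity>n. G n)) L"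
proof -
  have le: "norm (G n) \<le> a n" for n
    by (rule Lim_norm_ubound[OF L lim]) (use a in auto)
  have sF: "(\<lambda>n. F k n) summable_on UNIV" for k
    by (rule abs_summable_summable, rule summable_on_comparison_test[OF a(1)]) (use a(2) in auto)
  have sG: "G summable_on UNIV"
    by (rule abs_summable_summable, rule summable_on_comparison_test[OF a(1)]) (use le in auto)
  show ?thesis
  proof (rule swap_uniform_limit')
    show "uniform_limit UNIV (\<lambda>I k. \<Sum>n\<in>I. F k n) (\<lambda>k. \<Sum>\<^sub>\<infinity>n. F k n) (finite_subsets_at_top UNIV)"
      by (rule uniform_limit_has_sum[where F = "\<lambda>n k. F k n", OF a(1)]) (use a sF in auto)
    show "\<forall>\<^sub>F I in finite_subsets_at_top UNIV. ((\<lambda>k. \<Sum>n\<in>I. F k n) \<longlongrightarrow> (\<Sum>n\<in>I. G n)) L"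
      by (intro always_eventually allI tendsto_sum lim)
    show "(sum G \<longlongrightarrow> (\<Sum>\<^sub>\<infinity>n. G n)) (finite_subsets_at_top UNIV)"
      using has_sum_infsum[OF sG] by (simp add: has_sum_def)
  qed auto
qed

lemma sum_int_symmetric_le:
  fixes \<phi> :: "nat \<Rightarrow> real"
  assumes "\<And>k. 0 \<le> \<phi> k"
  shows "(\<Sum>m\<in>{-int N..int N}. \<phi> (nat \<bar>m\<bar>)) \<le> 2 * (\<Sum>k\<le>N. \<phi> k)"
proof (induction N)
  case 0
  show ?case using assms[of 0] by simp
next
  case (Suc N)
  have "{-int (Suc N)..int (Suc N)} = insert (int (Suc N)) (insert (- int (Suc N)) {-int N..int N})"
    by auto
  then have "(\<Sum>m\<in>{-int (Suc N)..int (Suc N)}. \<phi> (nat \<bar>m\<bar>)) = 2 * \<phi> (Suc N) + (\<Sum>m\<in>{-int N..int N}. \<phi> (nat \<bar>m\<bar>))"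
    by (simp add: nat_add_distrib)
  with Suc show ?case by simp
qed

lemma summable_on_int_symmetric:
  fixes \<phi> :: "nat \<Rightarrow> real"
  assumes nn: "\<And>k. 0 \<le> \<phi> k" and le: "\<And>N. (\<Sum>k\<le>N. \<phi> k) \<le> B"
  shows "(\<lambda>m::int. \<phi> (nat \<bar>m\<bar>)) summable_on UNIV" "(\<Sum>\<^sub>\<infinity>m::int. \<phi> (nat \<bar>m\<bar>)) \<le> 2 * B"
proof -
  have *: "(\<Sum>m\<in>F. \<phi> (nat \<bar>m\<bar>)) \<le> 2 * B" if "finite F" for F :: "int set"
  proof -
    define N where "N = nat (Max (insert 0 (abs ` F)))"
    have "\<bar>m\<bar> \<le> Max (insert 0 (abs ` F))" if "m \<in> F" for m
      using that \<open>finite F\<close> by (intro Max_ge) auto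
    then have "F \<subseteq> {-int N..int N}" unfolding N_def by force
    then have "(\<Sum>m\<in>F. \<phi> (nat \<bar>m\<bar>)) \<le> (\<Sum>m\<in>{-int N..int N}. \<phi> (nat \<bar>m\<bar>))"
      by (intro sum_mono2) (auto simp: nn)
    also have "\<dots> \<le> 2 * (\<Sum>k\<le>N. \<phi> k)" by (rule sum_int_symmetric_le) (rule nn)
    also have "\<dots> \<le> 2 * B" using le by simp
    finally show ?thesis .
  qed
  show s: "(\<lambda>m::int. \<phi> (nat \<bar>m\<bar>)) summable_on UNIV"
    by (rule nonneg_bdd_above_summable_on) (auto simp: nn bdd_above_def intro!: exI[of _ "2 * B"] *)
  show "(\<Sum>\<^sub>\<infinity>m::int. \<phi> (nat \<bar>m\<bar>)) \<le> 2 * B"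
    by (rule infsum_le_finite_sums[OF s]) (rule *)
qed

section \<open>Bump functions from products of sinc factors\<close>

definition sinc :: "real \<Rightarrow> real" where "sinc x = (if x = 0 then 1 else sin x / x)"

lemma sinc_0 [simp]: "sinc 0 = 1" by (simp add: sinc_def)

lemma sinc_has_integral: "((\<lambda>s. cos (x * s)) has_integral sinc x) {0..1}"
proof (cases "x = 0")
  case True
  then show ?thesis using has_integral_const_real[of "1::real" 0 1] by simp
next
  case False
  have "((\<lambda>s. cos (x * s)) has_integral (sin (x * 1) / x - sin (x * 0) / x)) {0..1}"
    by (rule fundamental_theorem_of_calculus)
       (use False in \<open>auto intro!: derivative_eq_intros simp: has_real_derivative_iff_has_vector_derivative[symmetric]\<close>)
  with False show ?thesis by (simp add: sinc_def)
qed

lemma abs_sinc_diff_le: "\<bar>sinc x - sinc y\<bar> \<le> \<bar>x - y\<bar>"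
proof -
  have i: "((\<lambda>s. cos (x * s) - cos (y * s)) has_integral (sinc x - sinc y)) {0..1}"
    by (intro has_integral_diff sinc_has_integral)
  have "norm (sinc x - sinc y) \<le> \<bar>x - y\<bar> * measure lborel (cbox 0 (1::real))"
  proof (rule has_integral_bound[of _ "\<lambda>s. cos (x * s) - cos (y * s)"])
    show "((\<lambda>s. cos (x * s) - cos (y * s)) has_integral (sinc x - sinc y)) (cbox 0 1)" using i by simp
    fix s :: real assume s: "s \<in> cbox 0 1"
    have "\<bar>cos (x * s) - cos (y * s)\<bar> = 2 * (\<bar>sin ((x * s + y * s) / 2)\<bar> * \<bar>sin ((y * s - x * s) / 2)\<bar>)"
      by (simp add: cos_diff_cos abs_mult)
    also have "\<dots> \<le> 2 * (1 * \<bar>(y * s - x * s) / 2\<bar>)"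
      by (intro mult_left_mono mult_mono abs_sin_x_le_abs_x) auto
    also have "\<dots> = \<bar>x - y\<bar> * \<bar>s\<bar>" by (simp add: abs_mult[symmetric] left_diff_distrib)
    also have "\<dots> \<le> \<bar>x - y\<bar> * 1" using s by (intro mult_left_mono) auto
    finally show "norm (cos (x * s) - cos (y * s)) \<le> \<bar>x - y\<bar>" by simp
  qed simp
  then show ?thesis by simp
qed

lemma abs_sinc_le_1: "\<bar>sinc x\<bar> \<le> 1"
  using abs_sin_x_le_abs_x[of x] by (auto simp: sinc_def divide_simps)

lemma abs_sinc_le_inverse: "\<bar>sinc x\<bar> * \<bar>x\<bar> \<le> 1"
  by (auto simp: sinc_def)

lemma sinc_pi_int: "n \<noteq> 0 \<Longrightarrow> sinc (pi * of_int n) = 0"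
  using sin_zero_iff_int2[of "pi * of_int n"] by (auto simp: sinc_def)

lemma has_integral_cis_window:
  assumes "0 \<le> a"
  shows "((\<lambda>s. cis (x * s)) has_integral of_real (2 * a * sinc (a * x))) {-a..a}"
proof (cases "x = 0")
  case True
  then show ?thesis using assms has_integral_const_real[of "1::complex" "-a" a] by (simp add: scaleR_conv_of_real)
next
  case False
  have d: "((\<lambda>s. cis (x * s) / (\<i> * of_real x)) has_vector_derivative cis (x * s)) (at s within {-a..a})" for s
  proof -
    have "((\<lambda>s. exp (\<i> * of_real x * of_real s) / (\<i> * of_real x)) has_vector_derivative exp (\<i> * of_real x * of_real s)) (at s within {-a..a})"
      by (rule has_vector_derivative_real_field) (use False in \<open>auto intro!: derivative_eq_intros\<close>)
    then show ?thesis by (simp add: cis_conv_exp mult_ac)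
  qed
  have "((\<lambda>s. cis (x * s)) has_integral (cis (x * a) / (\<i> * of_real x) - cis (x * (- a)) / (\<i> * of_real x))) {-a..a}"
    by (rule fundamental_theorem_of_calculus) (use assms d in auto)
  moreover have "cis (x * a) / (\<i> * of_real x) - cis (x * (- a)) / (\<i> * of_real x) = of_real (2 * a * sinc (a * x))"
  proof -
    have "cis (x * a) - cis (x * (- a)) = 2 * \<i> * of_real (sin (a * x))"
      by (simp add: complex_eq_iff mult.commute)
    then have "cis (x * a) / (\<i> * of_real x) - cis (x * (- a)) / (\<i> * of_real x) = 2 * of_real (sin (a * x)) / of_real x"
      unfolding diff_divide_distrib[symmetric] by simp
    then show ?thesis using False by (cases "a = 0") (auto simp: sinc_def)
  qed
  ultimately show ?thesis by simp
qed

text \<open>Averaging over a window acts on the coefficients as the multiplier 2 a sinc(a m). The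
  mean value bound, the cutoff near 0 and the Fourier coefficient formula below are instances of
  this identity.\<close>

lemma fourier_window:
  assumes b: "(\<lambda>m. norm (b m)) summable_on UNIV" and f: "\<And>t. ((\<lambda>m. b m * cis (of_int m * t)) has_sum f t) UNIV"
    and a: "0 \<le> a"
  shows "((\<lambda>m. of_real (2 * a * sinc (a * of_int m)) * b m * cis (of_int m * t)) has_sum integral {-a..a} (\<lambda>s. f (t + s))) UNIV"
    "continuous_on {-a..a} (\<lambda>s. f (t + s))"
proof -
  let ?F = "\<lambda>m s. b m * cis (of_int m * (t + s))"
  have c: "continuous_on {-a..a} (?F m)" for m
    unfolding cis_conv_exp by (intro continuous_intros)
  note h = has_sum_integral[where F = ?F and f = "\<lambda>s. f (t + s)" and a = "\<lambda>m. norm (b m)" and \<alpha> = "-a" and \<beta> = a, OF b _ f c]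
  have n: "norm (?F m s) \<le> norm (b m)" for m s by (simp add: norm_mult)
  have "integral {-a..a} (?F m) = of_real (2 * a * sinc (a * of_int m)) * b m * cis (of_int m * t)" for m
  proof -
    have "((\<lambda>s. (b m * cis (of_int m * t)) * cis (of_int m * s)) has_integral
        (b m * cis (of_int m * t)) * of_real (2 * a * sinc (a * of_int m))) {-a..a}"
      by (intro has_integral_mult_right has_integral_cis_window a)
    moreover have "(b m * cis (of_int m * t)) * cis (of_int m * s) = ?F m s" for s
      by (simp add: cis_mult[symmetric] distrib_left)
    ultimately have "(?F m has_integral (b m * cis (of_int m * t)) * of_real (2 * a * sinc (a * of_int m))) {-a..a}"
      by simp
    then show ?thesis by (subst integral_unique) (auto simp: mult_ac)
  qed
  with h(2)[OF n] show "((\<lambda>m. of_real (2 * a * sinc (a * of_int m)) * b m * cis (of_int m * t)) has_sum integral {-a..a} (\<lambda>s. f (t + s))) UNIV"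
    by (simp only:)
  show "continuous_on {-a..a} (\<lambda>s. f (t + s))" using h(1)[OF n] .
qed

lemma poisson_has_sum:
  fixes r t :: real
  assumes r: "0 \<le> r" "r < 1"
  shows "((\<lambda>m. of_real (r ^ nat \<bar>m\<bar>) * cis (of_int m * t)) has_sum of_real ((1 - r\<^sup>2) / (1 - 2 * r * cos t + r\<^sup>2))) UNIV"
    (is "(?f has_sum _) _")
proof -
  let ?z = "of_real r * cis t"
  have nz: "norm ?z < 1" using r by (simp add: norm_mult)
  have 1: "((\<lambda>n. ?z ^ n) has_sum (?z / (1 - ?z))) {1..}"
    using has_sum_geometric_from_1[OF nz] by simp
  have 2: "((\<lambda>n. cnj ?z ^ n) has_sum (cnj ?z / (1 - cnj ?z))) {1..}"
    by (rule has_sum_geometric_from_1) (use nz in \<open>simp only: complex_mod_cnj\<close>)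
  have b1: "bij_betw int {1..} {1..}"
    by (rule bij_betwI[where g = nat]) auto
  have b2: "bij_betw (\<lambda>n. - int n) {1..} {..-1}"
    by (rule bij_betwI[where g = "\<lambda>n. nat (- n)"]) auto
  have g1: "(?f has_sum (?z / (1 - ?z))) {1..}"
  proof -
    have "?f (int n) = ?z ^ n" for n by (simp add: power_mult_distrib Complex.DeMoivre)
    then show ?thesis using has_sum_reindex_bij_betw[OF b1, of ?f] 1 by (simp only:)
  qed
  have g2: "(?f has_sum (cnj ?z / (1 - cnj ?z))) {..-1}"
  proof -
    have "?f (- int n) = cnj ?z ^ n" for n by (simp add: power_mult_distrib Complex.DeMoivre cis_cnj)
    then show ?thesis using has_sum_reindex_bij_betw[OF b2, of ?f] 2 by (simp only:)
  qed
  have 3: "(?f has_sum 1) {0}" by (rule has_sum_finiteI) auto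
  have 4: "(?f has_sum (?z / (1 - ?z) + 1)) ({1..} \<union> {0})"
    by (rule has_sum_Un_disjoint[OF g1 3]) auto
  have 5: "(?f has_sum (?z / (1 - ?z) + 1 + cnj ?z / (1 - cnj ?z))) (({1..} \<union> {0}) \<union> {..-1})"
    by (rule has_sum_Un_disjoint[OF 4 g2]) auto
  have "({1..} \<union> {0}) \<union> {..-1} = (UNIV :: int set)" by auto
  with 5 have 6: "(?f has_sum (?z / (1 - ?z) + 1 + cnj ?z / (1 - cnj ?z))) UNIV" by simp
  have "?z \<noteq> 1" "cnj ?z \<noteq> 1"
    using nz complex_mod_cnj[of ?z] by (metis norm_one less_irrefl)+
  then have ne: "1 - ?z \<noteq> 0" "1 - cnj ?z \<noteq> 0" by auto
  have nr: "norm ?z = r" using r by (simp add: norm_mult)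
  have zc: "?z * cnj ?z = of_real (r\<^sup>2)"
    using complex_norm_square[of ?z] unfolding nr by (simp only:)
  have zs: "?z + cnj ?z = of_real (2 * r * cos t)" by (simp add: complex_eq_iff)
  have den: "(1 - ?z) * (1 - cnj ?z) = of_real (1 - 2 * r * cos t + r\<^sup>2)"
  proof -
    have mm: "(1 - x) * (1 - y) = 1 - (x + y) + x * y" for x y :: complex by (simp add: algebra_simps)
    have "(1 - ?z) * (1 - cnj ?z) = 1 - (?z + cnj ?z) + ?z * cnj ?z"
      using mm by blast
    then show ?thesis unfolding zc zs by simp
  qed
  have *: "x / (1 - x) + 1 + y / (1 - y) = (1 - x * y) / ((1 - x) * (1 - y))" if "1 - x \<noteq> 0" "1 - y \<noteq> 0" for x y :: complex
    using that by (simp add: divide_simps) (simp add: algebra_simps)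
  show ?thesis using 6 unfolding *[OF ne] den zc by simp
qed

lemma fourier_window_bound:
  assumes b: "(\<lambda>m. norm (b m)) summable_on UNIV" and f: "\<And>t. ((\<lambda>m. b m * cis (of_int m * t)) has_sum f t) UNIV"
    and g: "((\<lambda>m. of_real (sinc (a * of_int m)) * b m * cis (of_int m * t)) has_sum g) UNIV"
    and a: "0 \<le> a" and C: "\<And>s. \<bar>s\<bar> \<le> a \<Longrightarrow> norm (f (t + s)) \<le> C"
  shows "norm g \<le> C"
proof (cases "a = 0")
  case True
  then have "((\<lambda>m. b m * cis (of_int m * t)) has_sum g) UNIV" using g by simp
  with f[of t] have "g = f t" using has_sum_unique by blast
  with C[of 0] True show ?thesis by simp
next
  case False
  have "((\<lambda>m. of_real (2 * a) * (of_real (sinc (a * of_int m)) * b m * cis (of_int m * t))) has_sum of_real (2 * a) * g) UNIV"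
    using g by (rule has_sum_cmult_right)
  moreover have "((\<lambda>m. of_real (2 * a) * (of_real (sinc (a * of_int m)) * b m * cis (of_int m * t))) has_sum integral {-a..a} (\<lambda>s. f (t + s))) UNIV"
    using fourier_window(1)[OF b f a, of t] by (simp add: mult_ac)
  ultimately have "of_real (2 * a) * g = integral {-a..a} (\<lambda>s. f (t + s))"
    using has_sum_unique by blast
  moreover have "norm (integral {-a..a} (\<lambda>s. f (t + s))) \<le> C * (a - (- a))"
    by (rule integral_bound) (use a C fourier_window(2)[OF b f a] in auto)
  moreover have "norm (of_real (2 * a) * g) = 2 * a * norm g" using a by (simp add: norm_mult)
  ultimately have "2 * a * norm g \<le> 2 * a * C" by (simp add: mult.commute)
  then show ?thesis using a False by simp
qed

lemma norm_prod_sinc_le_1: "\<bar>\<Prod>j<(J::nat). sinc (a j * x)\<bar> \<le> 1"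
  unfolding abs_prod by (rule prod_le_1) (auto simp: abs_sinc_le_1)

lemma poisson_sinc_bound:
  fixes a :: "nat \<Rightarrow> real"
  assumes r: "0 \<le> r" "r < 1" and a: "\<And>j. 0 \<le> a j"
    and C: "\<And>s. \<bar>s\<bar> \<le> (\<Sum>j<J. a j) \<Longrightarrow> \<bar>(1 - r\<^sup>2) / (1 - 2 * r * cos (t + s) + r\<^sup>2)\<bar> \<le> C"
  shows "norm (\<Sum>\<^sub>\<infinity>m. of_real (r ^ nat \<bar>m\<bar> * (\<Prod>j<J. sinc (a j * of_int m))) * cis (of_int m * t)) \<le> C"
  using C
proof (induction J arbitrary: t)
  case 0
  have "(\<Sum>\<^sub>\<infinity>m. complex_of_real (r ^ nat \<bar>m\<bar> * (\<Prod>j<0. sinc (a j * of_int m))) * cis (of_int m * t)) =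
      of_real ((1 - r\<^sup>2) / (1 - 2 * r * cos t + r\<^sup>2))"
    using infsumI[OF poisson_has_sum[OF r, of t]] by simp
  with 0[of 0] show ?case by (simp only: norm_of_real) simp
next
  case (Suc J)
  let ?b = "\<lambda>m. complex_of_real (r ^ nat \<bar>m\<bar> * (\<Prod>j<J. sinc (a j * of_int m)))"
  let ?f = "\<lambda>t. \<Sum>\<^sub>\<infinity>m. ?b m * cis (of_int m * t)"
  have "(\<Sum>k\<le>N. r ^ k) \<le> 1 / (1 - r)" for N
    using sum_le_suminf[of "\<lambda>k. r ^ k" "{..N}"] r by (auto simp: suminf_geometric)
  then have sr: "(\<lambda>m::int. r ^ nat \<bar>m\<bar>) summable_on UNIV"
    using r by (intro summable_on_int_symmetric(1)) auto
  have nb: "norm (?b m) \<le> r ^ nat \<bar>m\<bar>" for m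
    using mult_left_mono[OF norm_prod_sinc_le_1[of a "of_int m" J], of "r ^ nat \<bar>m\<bar>"] r
    by (simp only: norm_of_real abs_mult) simp
  have sb: "(\<lambda>m. norm (?b m)) summable_on UNIV"
    by (rule summable_on_comparison_test[OF sr]) (use nb in auto)
  have f: "((\<lambda>m. ?b m * cis (of_int m * t)) has_sum ?f t) UNIV" for t
    by (rule has_sum_infsum, rule abs_summable_summable) (use sb in \<open>simp add: norm_mult\<close>)
  have "(\<lambda>m. norm (complex_of_real (r ^ nat \<bar>m\<bar> * (\<Prod>j<Suc J. sinc (a j * of_int m))) * cis (of_int m * t))) summable_on UNIV"
  proof (rule summable_on_comparison_test[OF sr])
    fix m :: int
    show "norm (complex_of_real (r ^ nat \<bar>m\<bar> * (\<Prod>j<Suc J. sinc (a j * of_int m))) * cis (of_int m * t)) \<le> r ^ nat \<bar>m\<bar>"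
      using mult_left_mono[OF norm_prod_sinc_le_1[of a "of_int m" "Suc J"], of "r ^ nat \<bar>m\<bar>"] r
      by (simp only: norm_of_real abs_mult norm_mult) simp
  qed auto
  then have "((\<lambda>m. complex_of_real (r ^ nat \<bar>m\<bar> * (\<Prod>j<Suc J. sinc (a j * of_int m))) * cis (of_int m * t)) has_sum
     (\<Sum>\<^sub>\<infinity>m. complex_of_real (r ^ nat \<bar>m\<bar> * (\<Prod>j<Suc J. sinc (a j * of_int m))) * cis (of_int m * t))) UNIV"
    by (intro has_sum_infsum) (rule abs_summable_summable)
  moreover have "complex_of_real (r ^ nat \<bar>m\<bar> * (\<Prod>j<Suc J. sinc (a j * of_int m))) * cis (of_int m * t) =
    of_real (sinc (a J * of_int m)) * ?b m * cis (of_int m * t)" for m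
    by simp
  ultimately have g: "((\<lambda>m. of_real (sinc (a J * of_int m)) * ?b m * cis (of_int m * t)) has_sum
     (\<Sum>\<^sub>\<infinity>m. complex_of_real (r ^ nat \<bar>m\<bar> * (\<Prod>j<Suc J. sinc (a j * of_int m))) * cis (of_int m * t))) UNIV"
    by (simp only:)
  show ?case
  proof (rule fourier_window_bound[OF sb f g a])
    fix s assume s: "\<bar>s\<bar> \<le> a J"
    show "norm (?f (t + s)) \<le> C"
    proof (rule Suc.IH)
      fix s' assume "\<bar>s'\<bar> \<le> (\<Sum>j<J. a j)"
      with s have "\<bar>s + s'\<bar> \<le> (\<Sum>j<Suc J. a j)" by simp
      from Suc.prems[OF this] show "\<bar>(1 - r\<^sup>2) / (1 - 2 * r * cos (t + s + s') + r\<^sup>2)\<bar> \<le> C" by (simp add: add.assoc)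
    qed
  qed
qed

text \<open>
  Each sinc factor is an average over translations, so the series is an average of translates of the Poisson
  kernel \<open>P\<^sub>r\<close> by at most \<open>\<epsilon>\<close>, in the limit \<open>r \<rightarrow> 1\<close>.
\<close>

lemma sinc_product_vanishes:
  fixes a :: "nat \<Rightarrow> real"
  assumes a: "\<And>j. 0 \<le> a j" "\<And>J. (\<Sum>j<J. a j) \<le> \<epsilon>"
    and \<beta>: "\<And>m::int. (\<lambda>J. \<Prod>j<J. sinc (a j * of_int m)) \<longlonglongrightarrow> \<beta> m" "(\<lambda>m. \<bar>\<beta> m\<bar>) summable_on UNIV"
    and t: "\<epsilon> < t" "t < 2 * pi - \<epsilon>"
  shows "(\<Sum>\<^sub>\<infinity>m. of_real (\<beta> m) * cis (of_int m * t)) = 0"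
proof -
  \<comment> \<open>\<open>x\<close> is the distance that every translate of \<open>t\<close> by at
    most \<open>\<epsilon>\<close> keeps from the multiples of 2 pi; there \<open>1 - cos\<close> is
    at least \<open>\<delta>\<close>.\<close>
  define x where "x = min (t - \<epsilon>) (2 * pi - t - \<epsilon>)"
  have \<epsilon>: "0 \<le> \<epsilon>" using a(2)[of 0] by simp
  have x: "0 < x" "x \<le> pi" using t \<epsilon> by (auto simp: x_def)
  define \<delta> where "\<delta> = 1 - cos x"
  have "cos x < cos 0" by (rule cos_monotone_0_pi) (use x in auto)
  then have \<delta>: "0 < \<delta>" by (simp add: \<delta>_def)
  have cos_le: "cos (t + s) \<le> 1 - \<delta>" if "\<bar>s\<bar> \<le> \<epsilon>" for s
  proof (cases "t + s \<le> pi")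
    case True
    have "cos (t + s) \<le> cos x" by (rule cos_monotone_0_pi_le) (use that True x in \<open>auto simp: x_def\<close>)
    then show ?thesis by (simp add: \<delta>_def)
  next
    case False
    have "cos (t + s) = cos (2 * pi - (t + s))" by (simp add: cos_diff)
    also have "\<dots> \<le> cos x" by (rule cos_monotone_0_pi_le) (use that False x in \<open>auto simp: x_def\<close>)
    finally show ?thesis by (simp add: \<delta>_def)
  qed
  have fin: "norm (\<Sum>\<^sub>\<infinity>m. complex_of_real (r ^ nat \<bar>m\<bar> * \<beta> m) * cis (of_int m * t)) \<le> (1 - r\<^sup>2) / (2 * r * \<delta>)"
    if r: "0 < r" "r < 1" for r
  proof -
    have "(\<Sum>k\<le>N. r ^ k) \<le> 1 / (1 - r)" for N
      using sum_le_suminf[of "\<lambda>k. r ^ k" "{..N}"] r by (auto simp: suminf_geometric)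
    then have sr: "(\<lambda>m::int. r ^ nat \<bar>m\<bar>) summable_on UNIV"
      using r by (intro summable_on_int_symmetric(1)) auto
    have "(\<lambda>J. \<Sum>\<^sub>\<infinity>m. complex_of_real (r ^ nat \<bar>m\<bar> * (\<Prod>j<J. sinc (a j * of_int m))) * cis (of_int m * t))
        \<longlonglongrightarrow> (\<Sum>\<^sub>\<infinity>m. complex_of_real (r ^ nat \<bar>m\<bar> * \<beta> m) * cis (of_int m * t))"
    proof (rule infsum_dominated_limit[OF sr])
      show "norm (complex_of_real (r ^ nat \<bar>m\<bar> * (\<Prod>j<J. sinc (a j * of_int m))) * cis (of_int m * t)) \<le> r ^ nat \<bar>m\<bar>" for m J
        using mult_left_mono[OF norm_prod_sinc_le_1[of a "of_int m" J], of "r ^ nat \<bar>m\<bar>"] r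
        by (simp only: norm_of_real abs_mult norm_mult) simp
      show "(\<lambda>J. complex_of_real (r ^ nat \<bar>m\<bar> * (\<Prod>j<J. sinc (a j * of_int m))) * cis (of_int m * t))
          \<longlonglongrightarrow> complex_of_real (r ^ nat \<bar>m\<bar> * \<beta> m) * cis (of_int m * t)" for m
        by (intro tendsto_mult tendsto_of_real tendsto_const \<beta>(1))
    qed simp
    moreover have "norm (\<Sum>\<^sub>\<infinity>m. complex_of_real (r ^ nat \<bar>m\<bar> * (\<Prod>j<J. sinc (a j * of_int m))) * cis (of_int m * t)) \<le> (1 - r\<^sup>2) / (2 * r * \<delta>)" for J
    proof (rule poisson_sinc_bound)
      fix s assume "\<bar>s\<bar> \<le> (\<Sum>j<J. a j)"
      with a(2)[of J] have "cos (t + s) \<le> 1 - \<delta>" by (intro cos_le) simp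
      then have "r * cos (t + s) \<le> r * (1 - \<delta>)" using r by (intro mult_left_mono) auto
      \<comment> \<open>The denominator of the Poisson kernel is (1 - r)^2 + 2 r (1 - cos(t +
        s)).\<close>
      then have "2 * r * \<delta> + (1 - r)\<^sup>2 \<le> 1 - 2 * r * cos (t + s) + r\<^sup>2" by (simp add: power2_eq_square algebra_simps)
      then have d: "2 * r * \<delta> \<le> 1 - 2 * r * cos (t + s) + r\<^sup>2" using zero_le_power2[of "1 - r"] by linarith
      have p: "0 < 2 * r * \<delta>" using r \<delta> by simp
      have r2: "0 \<le> 1 - r\<^sup>2" using r by (simp add: power_le_one)
      have "(1 - r\<^sup>2) / (1 - 2 * r * cos (t + s) + r\<^sup>2) \<le> (1 - r\<^sup>2) / (2 * r * \<delta>)"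
        by (rule divide_left_mono[OF d r2]) (rule mult_pos_pos, use p d in linarith, rule p)
      moreover have "0 \<le> (1 - r\<^sup>2) / (1 - 2 * r * cos (t + s) + r\<^sup>2)" using r2 by (rule divide_nonneg_nonneg) (use p d in linarith)
      ultimately show "\<bar>(1 - r\<^sup>2) / (1 - 2 * r * cos (t + s) + r\<^sup>2)\<bar> \<le> (1 - r\<^sup>2) / (2 * r * \<delta>)" by linarith
    qed (use r a(1) in simp_all)
    ultimately show ?thesis by (intro Lim_norm_ubound[of sequentially]) auto
  qed
  define \<rho> where "\<rho> n = 1 - 1 / real (n + 2)" for n
  have \<rho>: "0 < \<rho> n" "\<rho> n < 1" for n by (auto simp: \<rho>_def)
  have \<rho>1: "\<rho> \<longlonglongrightarrow> 1 - 0" unfolding \<rho>_def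
    by (intro tendsto_diff tendsto_const) (rule LIMSEQ_ignore_initial_segment[OF lim_1_over_n])
  have "(\<lambda>n. \<Sum>\<^sub>\<infinity>m. complex_of_real (\<rho> n ^ nat \<bar>m\<bar> * \<beta> m) * cis (of_int m * t))
        \<longlonglongrightarrow> (\<Sum>\<^sub>\<infinity>m. complex_of_real (1 ^ nat \<bar>m\<bar> * \<beta> m) * cis (of_int m * t))"
  proof (rule infsum_dominated_limit[OF \<beta>(2)])
    fix n and m :: int
    have "\<rho> n ^ nat \<bar>m\<bar> \<le> 1" using \<rho>[of n] by (intro power_le_one) auto
    then have "\<rho> n ^ nat \<bar>m\<bar> * \<bar>\<beta> m\<bar> \<le> 1 * \<bar>\<beta> m\<bar>" by (intro mult_right_mono) auto
    then show "norm (complex_of_real (\<rho> n ^ nat \<bar>m\<bar> * \<beta> m) * cis (of_int m * t)) \<le> \<bar>\<beta> m\<bar>"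
      using \<rho>[of n] by (simp only: norm_mult norm_of_real abs_mult) simp
    show "(\<lambda>n. complex_of_real (\<rho> n ^ nat \<bar>m\<bar> * \<beta> m) * cis (of_int m * t))
        \<longlonglongrightarrow> complex_of_real (1 ^ nat \<bar>m\<bar> * \<beta> m) * cis (of_int m * t)" for m
      using \<rho>1 by (intro tendsto_mult tendsto_of_real tendsto_const tendsto_power) simp
  qed simp
  moreover have "(\<lambda>n. (1 - (\<rho> n)\<^sup>2) / (2 * \<rho> n * \<delta>)) \<longlonglongrightarrow> (1 - 1\<^sup>2) / (2 * 1 * \<delta>)"
    using \<rho>1 \<delta> by (intro tendsto_divide tendsto_mult tendsto_diff tendsto_power tendsto_const) simp_all
  ultimately have "norm (\<Sum>\<^sub>\<infinity>m. complex_of_real (1 ^ nat \<bar>m\<bar> * \<beta> m) * cis (of_int m * t)) \<le> (1 - 1\<^sup>2) / (2 * 1 * \<delta>)"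
    using LIMSEQ_le[OF tendsto_norm] fin[OF \<rho>] by blast
  then show ?thesis by simp
qed

text \<open>For such \<open>t\<close> the window of half width \<open>w\<close> contains the part of
  the period where \<open>f\<close> may be nonzero, so its integral is that over a full period,
  where sinc(pi m) = 0 leaves only the index 0. The series is thus a cutoff that is constant near 0
  and inherits the decay of \<open>b\<close>.\<close>

lemma bump_window:
  assumes b: "(\<lambda>m. norm (b m)) summable_on UNIV" and f: "\<And>t. ((\<lambda>m. b m * cis (of_int m * t)) has_sum f t) UNIV"
    and z: "\<And>x. \<epsilon> < x \<Longrightarrow> x < 2 * pi - \<epsilon> \<Longrightarrow> f x = 0"
    and z': "\<And>x. \<epsilon> < x \<Longrightarrow> x < 2 * pi - \<epsilon> \<Longrightarrow> f (- x) = 0"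
    and w: "\<bar>t\<bar> < w - \<epsilon>" "w \<le> pi" "0 \<le> \<epsilon>"
  shows "((\<lambda>m. of_real (w / pi * sinc (w * of_int m)) * b m * cis (of_int m * t)) has_sum b 0) UNIV"
proof -
  have w0: "0 \<le> w" using w by linarith
  have zero: "f (t + s) = 0" if "s \<in> {-pi..pi} - {-w..w}" for s
  proof (cases "s > 0")
    case True
    then show ?thesis using that w by (intro z) auto
  next
    case False
    then have "f (- (- (t + s))) = 0" using that w by (intro z') auto
    then show ?thesis by (simp add: add.commute)
  qed
  have i: "integral {-pi..pi} (\<lambda>s. f (t + s)) = integral {-w..w} (\<lambda>s. f (t + s))"
    using zero w by (intro integral_spike_set) (auto intro!: empty_imp_negligible)
  have "((\<lambda>m. of_real (2 * pi * sinc (pi * of_int m)) * b m * cis (of_int m * t)) has_sum (2 * pi * b 0)) UNIV"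
    by (rule has_sum_finite_neutralI[of "{0}"]) (auto simp: sinc_pi_int)
  moreover have "((\<lambda>m. of_real (2 * pi * sinc (pi * of_int m)) * b m * cis (of_int m * t)) has_sum integral {-pi..pi} (\<lambda>s. f (t + s))) UNIV"
    by (rule fourier_window[OF b f]) simp
  ultimately have "integral {-pi..pi} (\<lambda>s. f (t + s)) = 2 * pi * b 0" by (rule has_sum_unique[symmetric])
  then have e: "integral {-w..w} (\<lambda>s. f (t + s)) = 2 * pi * b 0" by (simp only: i)
  have "((\<lambda>m. of_real (2 * w * sinc (w * of_int m)) * b m * cis (of_int m * t)) has_sum 2 * pi * b 0) UNIV"
    using fourier_window(1)[OF b f w0, of t] unfolding e .
  note h = has_sum_cmult_right[OF this, of "of_real (1 / (2 * pi))"]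
  have "of_real (1 / (2 * pi)) * (of_real (2 * w * sinc (w * of_int m)) * b m * cis (of_int m * t)) =
    of_real (w / pi * sinc (w * of_int m)) * b m * cis (of_int m * t)" for m
    by simp
  moreover have "of_real (1 / (2 * pi)) * (2 * pi * b 0) = b 0" by simp
  ultimately show ?thesis using h by (simp only:)
qed

lemma cis_periodic_int: "cis (of_int m * (t + 2 * pi * of_int l)) = cis (of_int m * t)"
proof -
  have "cis (of_int m * (t + 2 * pi * of_int l)) = cis (of_int m * t) * cis (2 * pi * of_int (m * l))"
    by (simp add: cis_mult algebra_simps)
  then show ?thesis by (simp add: cis_multiple_2pi)
qed

lemma weighted_fourier_periodic: "weighted_fourier w B f \<Longrightarrow> f (t + 2 * pi * of_int l) = f t"
  unfolding weighted_fourier_def by (metis (no_types, lifting) cis_periodic_int has_sum_cong has_sum_unique)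

lemma sinc_product_convergent:
  assumes "\<And>j. 0 \<le> a j" "summable a"
  shows "convergent (\<lambda>J. \<Prod>j<J. sinc (a j * x))"
proof -
  let ?p = "\<lambda>J. \<Prod>j<J. sinc (a j * x)"
  have "summable (\<lambda>J. ?p (Suc J) - ?p J)"
  proof (rule summable_comparison_test'[OF summable_mult2[OF assms(2), of "\<bar>x\<bar>"]])
    fix J
    have "norm (?p (Suc J) - ?p J) = \<bar>?p J\<bar> * \<bar>sinc (a J * x) - sinc 0\<bar>"
      by (simp add: abs_mult[symmetric] algebra_simps)
    also have "\<dots> \<le> 1 * \<bar>a J * x - 0\<bar>"
      by (intro mult_mono norm_prod_sinc_le_1 abs_sinc_diff_le) auto
    also have "\<dots> = a J * \<bar>x\<bar>" using assms(1)[of J] by (simp add: abs_mult)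
    finally show "norm (?p (Suc J) - ?p J) \<le> a J * \<bar>x\<bar>" .
  qed
  then have "convergent (\<lambda>n. \<Sum>J<n. ?p (Suc J) - ?p J)" by (simp add: summable_iff_convergent)
  then have "convergent (\<lambda>n. ?p n - ?p 0)" by (simp only: sum_lessThan_telescope[of ?p])
  then show ?thesis using convergent_diff_const_right_iff by blast
qed

lemma abs_prod_sinc_diff_1_le:
  assumes "\<And>j. 0 \<le> a j"
  shows "\<bar>1 - (\<Prod>j<(J::nat). sinc (a j))\<bar> \<le> (\<Sum>j<J. a j)"
proof -
  have "norm ((\<Prod>j<J. 1) - (\<Prod>j<J. sinc (a j))) \<le> (\<Sum>j<J. norm (1 - sinc (a j)))"
    by (rule norm_prod_diff) (auto simp: abs_sinc_le_1)
  also have "\<dots> \<le> (\<Sum>j<J. a j)"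
  proof (rule sum_mono)
    fix j
    show "norm (1 - sinc (a j)) \<le> a j" using abs_sinc_diff_le[of 0 "a j"] assms[of j] by simp
  qed
  finally show ?thesis by simp
qed

lemma sum_inverse_squares_le: "(\<Sum>j<J. 1 / (real j + 1)\<^sup>2) \<le> 2"
proof -
  have *: "(\<Sum>j<Suc J. 1 / (real j + 1)\<^sup>2) \<le> 2 - 1 / (real J + 1)" for J
  proof (induction J)
    case (Suc J)
    have "1 / (real J + 2)\<^sup>2 \<le> 1 / ((real J + 1) * (real J + 2))"
      by (intro divide_left_mono) (auto simp: power2_eq_square intro!: mult_right_mono)
    also have "\<dots> = 1 / (real J + 1) - 1 / (real J + 2)" by (simp add: field_simps)
    finally show ?case using Suc by (simp add: add.commute)
  qed simp
  show ?thesis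
  proof (cases J)
    case (Suc n)
    have "(\<Sum>j<J. 1 / (real j + 1)\<^sup>2) \<le> 2 - 1 / (real n + 1)" using *[of n] Suc by simp
    also have "\<dots> \<le> 2" by simp
    finally show ?thesis .
  qed simp
qed

section \<open>Bumps with coefficients of size exp(-sqrt), and the arc function\<close>

text \<open>An infinite convolution of uniform densities on intervals of half widths \<epsilon>/(2
  (j + 1)^2), whose sum stays below \<open>\<epsilon>\<close>. At frequency m a number of factors of
  order sqrt(\<epsilon> |m|) is evaluated at arguments of size at least 3, and each of them gains
  1/e. In the last clause summability is a premise, to be discharged from the decay clause by
  comparison.\<close>

lemma rapid_bump_exists:
  fixes \<epsilon> :: real
  assumes \<epsilon>: "0 < \<epsilon>"
  shows "\<exists>\<beta> :: int \<Rightarrow> real. \<beta> 0 = 1 \<and> \<bar>1 - \<beta> 1\<bar> \<le> \<epsilon> \<and>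
    (\<forall>m. \<bar>\<beta> m\<bar> \<le> exp (1 - 2 / 5 * sqrt (\<epsilon> * \<bar>of_int m\<bar>))) \<and>
    ((\<lambda>m. \<bar>\<beta> m\<bar>) summable_on UNIV \<longrightarrow> (\<forall>t. \<epsilon> < t \<longrightarrow> t < 2 * pi - \<epsilon> \<longrightarrow>
       (\<Sum>\<^sub>\<infinity>m. of_real (\<beta> m) * cis (of_int m * t)) = 0))"
proof -
  define a where "a j = \<epsilon> / 2 * (1 / (real j + 1)\<^sup>2)" for j
  have a0: "0 \<le> a j" for j using \<epsilon> by (simp add: a_def)
  have aS: "(\<Sum>j<J. a j) \<le> \<epsilon>" for J
    using mult_left_mono[OF sum_inverse_squares_le[of J], of "\<epsilon> / 2"] \<epsilon> by (simp add: a_def sum_distrib_left)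
  have "summable a"
    by (rule summableI_nonneg_bounded[of _ \<epsilon>]) (use a0 aS in auto)
  then have "\<exists>l. (\<lambda>J. \<Prod>j<J. sinc (a j * of_int m)) \<longlonglongrightarrow> l" for m :: int
    using sinc_product_convergent[OF a0] by (simp add: convergent_def)
  then obtain \<beta> where \<beta>: "\<And>m::int. (\<lambda>J. \<Prod>j<J. sinc (a j * of_int m)) \<longlonglongrightarrow> \<beta> m" by metis
  show ?thesis
  proof (intro exI[of _ \<beta>] conjI allI impI)
    show "\<beta> 0 = 1" using \<beta>[of 0] by (simp add: LIMSEQ_const_iff)
    have "(\<lambda>J. \<bar>1 - (\<Prod>j<J. sinc (a j))\<bar>) \<longlonglongrightarrow> \<bar>1 - \<beta> 1\<bar>"
      using \<beta>[of 1] by (intro tendsto_rabs tendsto_diff tendsto_const) simp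
    then show "\<bar>1 - \<beta> 1\<bar> \<le> \<epsilon>"
      by (rule LIMSEQ_le_const2) (use order_trans[OF abs_prod_sinc_diff_1_le aS] a0 in blast)
    show "(\<Sum>\<^sub>\<infinity>m. of_real (\<beta> m) * cis (of_int m * t)) = 0"
      if "(\<lambda>m. \<bar>\<beta> m\<bar>) summable_on UNIV" "\<epsilon> < t" "t < 2 * pi - \<epsilon>" for t
      by (rule sinc_product_vanishes[OF a0 aS \<beta> that])
    fix m :: int
    define y where "y = \<epsilon> * \<bar>of_int m\<bar>"
    \<comment> \<open>\<open>j < N\<close> amounts to 6 (j + 1)^2 <= y, that is, to an argument
      \<open>a j * m\<close> of modulus at least 3.\<close>
    define N where "N = nat \<lfloor>sqrt (y / 6)\<rfloor>"
    have y0: "0 \<le> y" using \<epsilon> by (simp add: y_def)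
    have N: "real N \<le> sqrt (y / 6)" "sqrt (y / 6) - 1 \<le> real N"
      using y0 by (auto simp: N_def)
    have factor: "\<bar>sinc (a j * of_int m)\<bar> \<le> exp (- 1)" if "j < N" for j
    proof -
      have "(real j + 1)\<^sup>2 \<le> (sqrt (y / 6))\<^sup>2"
        using that N by (intro power_mono) auto
      then have "6 * (real j + 1)\<^sup>2 \<le> y" using y0 by simp
      then have "3 \<le> \<bar>a j * of_int m\<bar>"
        using \<epsilon> by (simp add: a_def y_def abs_mult field_simps)
      then have "\<bar>sinc (a j * of_int m)\<bar> * 3 \<le> \<bar>sinc (a j * of_int m)\<bar> * \<bar>a j * of_int m\<bar>"
        by (intro mult_left_mono) auto
      also have "\<dots> \<le> 1" by (rule abs_sinc_le_inverse)
      finally have "\<bar>sinc (a j * of_int m)\<bar> \<le> 1 / 3" by simp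
      also have "\<dots> \<le> exp (- 1)" using exp_le by (simp add: exp_minus field_simps)
      finally show ?thesis .
    qed
    have le: "\<bar>\<Prod>j<J. sinc (a j * of_int m)\<bar> \<le> exp (1 - 2 / 5 * sqrt y)" if "N \<le> J" for J
    proof -
      have "\<bar>\<Prod>j<J. sinc (a j * of_int m)\<bar> = (\<Prod>j<J. \<bar>sinc (a j * of_int m)\<bar>)" by (rule abs_prod)
      also have "\<dots> \<le> (\<Prod>j<J. if j < N then exp (- 1) else 1)"
        using factor abs_sinc_le_1 by (intro prod_mono) auto
      also have "\<dots> = (\<Prod>j\<in>{..<N}. exp (- 1))"
        using that by (intro prod.mono_neutral_cong_right) auto
      also have "\<dots> = exp (- real N)" by (simp add: exp_of_nat_mult[symmetric])
      also have "\<dots> \<le> exp (1 - sqrt (y / 6))" using N by simp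
      \<comment> \<open>2/5 is a rational number below 1/sqrt 6. Later one half of this rate pays
        for the weight with rate 1/5 and the other half for summability.\<close>
      also have "\<dots> \<le> exp (1 - 2 / 5 * sqrt y)"
      proof -
        have "2 / 5 * sqrt y = sqrt (4 / 25 * y)" by (simp add: real_sqrt_mult real_sqrt_divide)
        also have "\<dots> \<le> sqrt (y / 6)" using y0 by (intro real_sqrt_le_mono) simp
        finally show ?thesis by simp
      qed
      finally show ?thesis .
    qed
    have "(\<lambda>J. \<bar>\<Prod>j<J. sinc (a j * of_int m)\<bar>) \<longlonglongrightarrow> \<bar>\<beta> m\<bar>"
      by (intro tendsto_rabs \<beta>)
    then show "\<bar>\<beta> m\<bar> \<le> exp (1 - 2 / 5 * sqrt (\<epsilon> * \<bar>of_int m\<bar>))"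
      unfolding y_def[symmetric] by (rule LIMSEQ_le_const2) (use le in blast)
  qed
qed

text \<open>With z = sqrt x / 5, (1 + x)^2 <= 2 + 1250 z^4 and z^4 <= 256 e^z, and 1250 * 256 + 2 =
  320002.\<close>

lemma exp_neg_sqrt_le:
  fixes x :: real
  assumes "0 \<le> x"
  shows "exp (- sqrt x / 5) \<le> 320002 / (1 + x)\<^sup>2"
proof -
  define z where "z = sqrt x / 5"
  have z: "0 \<le> z" "x = 25 * z\<^sup>2" using assms by (auto simp: z_def power_divide)
  have "(z / 4) ^ 4 \<le> exp (z / 4) ^ 4" using z order_trans[OF _ exp_ge_add_one_self[of "z / 4"], of "z / 4"] by (intro power_mono) auto
  then have 4: "z ^ 4 \<le> 256 * exp z" by (simp add: exp_of_nat_mult[symmetric] power_divide)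
  have "(1 + x)\<^sup>2 \<le> 2 + 2 * x\<^sup>2" using sum_squares_ge_zero[of "1 - x" 0] by (simp add: power2_eq_square algebra_simps)
  also have "\<dots> = 2 + 1250 * z ^ 4" using z(2) by (simp add: power2_eq_square power4_eq_xxxx)
  also have "\<dots> \<le> 320002 * exp z" using 4 one_le_exp_iff[of z] z(1) by linarith
  finally have "(1 + x)\<^sup>2 * exp (- z) \<le> 320002" by (simp add: exp_minus field_simps)
  moreover have "0 < (1 + x)\<^sup>2" using assms by simp
  ultimately show ?thesis by (simp add: z_def field_simps)
qed

lemma sum_inverse_square_arith_le:
  fixes \<epsilon> :: real
  assumes "0 < \<epsilon>" "\<epsilon> \<le> 1"
  shows "(\<Sum>k\<le>N. 1 / (1 + \<epsilon> * real k)\<^sup>2) \<le> 2 / \<epsilon>"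
proof -
  have "(\<Sum>k\<le>N. 1 / (1 + \<epsilon> * real k)\<^sup>2) \<le> 1 + 1 / \<epsilon> - 1 / (\<epsilon> * (1 + \<epsilon> * real N))"
  proof (induction N)
    case (Suc N)
    define x where "x = 1 + \<epsilon> * real N"
    have x: "1 \<le> x" using assms by (simp add: x_def)
    have e: "1 + \<epsilon> * real (Suc N) = x + \<epsilon>" by (simp add: x_def algebra_simps)
    have "1 / (x + \<epsilon>)\<^sup>2 \<le> 1 / (x * (x + \<epsilon>))"
      using x assms by (intro divide_left_mono) (auto simp: power2_eq_square intro!: mult_right_mono mult_pos_pos)
    also have "\<dots> = 1 / (\<epsilon> * x) - 1 / (\<epsilon> * (x + \<epsilon>))" using x assms by (simp add: divide_simps)
    finally show ?case using Suc unfolding sum.atMost_Suc e x_def[symmetric] by linarith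
  qed simp
  also have "\<dots> \<le> 1 + 1 / \<epsilon>" using assms by simp
  also have "\<dots> \<le> 2 / \<epsilon>" using assms by (simp add: field_simps)
  finally show ?thesis .
qed

text \<open>
  \<open>Z\<close> is \<open>(1 - e^(i s)/\<beta>\<^sub>1)\<close> cut off to \<open>|s| \<le> 3 \<epsilon>\<close> and convolved with the bump \<open>\<beta>\<close>; dividing by \<open>\<beta>\<^sub>1\<close> undoes the
  effect of the convolution on \<open>e^(i s)\<close>.
\<close>

lemma small_arc_function:
  obtains C :: real where "0 < C"
    "\<And>\<epsilon>. 0 < \<epsilon> \<Longrightarrow> \<epsilon> \<le> 1 / 2 \<Longrightarrow> \<exists>Z. weighted_fourier (\<lambda>m. exp (sqrt (\<epsilon> * \<bar>of_int m\<bar>) / 5)) (C * \<epsilon>) Z \<and> (\<forall>t. \<bar>t\<bar> \<le> \<epsilon> \<longrightarrow> Z t = 1 - cis t)"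
proof -
  \<comment> \<open>The factors: e and 320002 from the decay of the bump, 4 because the sum of 1/(1
    + \<epsilon> |m|)^2 over the integers is at most 4/\<epsilon>, 5 from the difference of the two
    cutoffs, and 3/pi from the window of half width 3 \<epsilon>.\<close>
  define K where "K = exp 1 * 320002 * 4 * 5 * (3 / pi)"
  have "0 < K" by (simp add: K_def)
  moreover have "\<exists>Z. weighted_fourier (\<lambda>m. exp (sqrt (\<epsilon> * \<bar>of_int m\<bar>) / 5)) (K * \<epsilon>) Z \<and> (\<forall>t. \<bar>t\<bar> \<le> \<epsilon> \<longrightarrow> Z t = 1 - cis t)"
    if \<epsilon>: "0 < \<epsilon>" "\<epsilon> \<le> 1 / 2" for \<epsilon>
  proof -
    let ?w = "\<lambda>m::int. exp (sqrt (\<epsilon> * \<bar>of_int m\<bar>) / 5)"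
    let ?i = "\<lambda>m::int. 1 / (1 + \<epsilon> * real (nat \<bar>m\<bar>))\<^sup>2"
    obtain \<beta> :: "int \<Rightarrow> real" where \<beta>: "\<beta> 0 = 1" "\<bar>1 - \<beta> 1\<bar> \<le> \<epsilon>"
      "\<And>m. \<bar>\<beta> m\<bar> \<le> exp (1 - 2 / 5 * sqrt (\<epsilon> * \<bar>of_int m\<bar>))"
      "\<And>t. (\<lambda>m. \<bar>\<beta> m\<bar>) summable_on UNIV \<Longrightarrow> \<epsilon> < t \<Longrightarrow> t < 2 * pi - \<epsilon> \<Longrightarrow>
         (\<Sum>\<^sub>\<infinity>m. of_real (\<beta> m) * cis (of_int m * t)) = 0"
      using rapid_bump_exists[OF \<epsilon>(1)] by blast
    have i: "?i summable_on UNIV" "(\<Sum>\<^sub>\<infinity>m. ?i m) \<le> 2 * (2 / \<epsilon>)"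
      using summable_on_int_symmetric[of "\<lambda>k. 1 / (1 + \<epsilon> * real k)\<^sup>2" "2 / \<epsilon>"] sum_inverse_square_arith_le[of \<epsilon>] \<epsilon> by auto
    have \<beta>w: "\<bar>\<beta> m\<bar> * ?w m \<le> exp 1 * 320002 * ?i m" for m
    proof -
      have "\<bar>\<beta> m\<bar> * ?w m \<le> exp (1 - 2 / 5 * sqrt (\<epsilon> * \<bar>of_int m\<bar>)) * ?w m"
        using \<beta>(3) by (intro mult_right_mono) auto
      also have "\<dots> = exp 1 * exp (- sqrt (\<epsilon> * \<bar>of_int m\<bar>) / 5)"
        by (simp add: exp_add[symmetric])
      also have "\<dots> \<le> exp 1 * (320002 / (1 + \<epsilon> * \<bar>of_int m\<bar>)\<^sup>2)"
        using \<epsilon> by (intro mult_left_mono exp_neg_sqrt_le) auto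
      finally show ?thesis by simp
    qed
    have w1: "1 \<le> ?w m" for m using \<epsilon> by simp
    have \<beta>i: "\<bar>\<beta> m\<bar> \<le> exp 1 * 320002 * ?i m" for m
      using order_trans[OF mult_left_mono[OF w1[of m], of "\<bar>\<beta> m\<bar>"] \<beta>w[of m]] by simp
    have si: "(\<lambda>m. exp 1 * 320002 * ?i m) summable_on UNIV" using i(1) by (rule summable_on_cmult_right)
    have s\<beta>: "(\<lambda>m. \<bar>\<beta> m\<bar>) summable_on UNIV"
      by (rule summable_on_comparison_test[OF si]) (use \<beta>i in auto)
    define f where "f t = (\<Sum>\<^sub>\<infinity>m. of_real (\<beta> m) * cis (of_int m * t))" for t
    have f: "((\<lambda>m. of_real (\<beta> m) * cis (of_int m * t)) has_sum f t) UNIV" for t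
      unfolding f_def by (rule has_sum_infsum, rule abs_summable_summable) (use s\<beta> in \<open>simp add: norm_mult\<close>)
    have z: "f t = 0" if "\<epsilon> < t" "t < 2 * pi - \<epsilon>" for t
      unfolding f_def by (rule \<beta>(4)[OF s\<beta> that])
    have z': "f (- t) = 0" if "\<epsilon> < t" "t < 2 * pi - \<epsilon>" for t
    proof -
      have "f (- t) = f (- t + 2 * pi * of_int 1)" unfolding f_def cis_periodic_int ..
      then show ?thesis using z[of "2 * pi - t"] that by simp
    qed
    \<comment> \<open>Half width 3 \<epsilon> puts the arc of half width \<open>\<epsilon>\<close>
      strictly inside \<open>w - \<epsilon>\<close>, where the cutoff is constant.\<close>
    define w where "w = 3 * \<epsilon>"
    have w: "w \<le> pi" "0 < w" using \<epsilon> pi_gt3 by (auto simp: w_def)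
    have s\<beta>1: "(\<lambda>m. norm (complex_of_real (\<beta> m))) summable_on UNIV" using s\<beta> by simp
    have sh: "bij_betw (\<lambda>m::int. m + 1) UNIV UNIV" by (rule bij_betwI[where g = "\<lambda>m. m - 1"]) auto
    have s\<beta>2: "(\<lambda>m. norm (complex_of_real (\<beta> (m + 1)))) summable_on UNIV"
      using summable_on_reindex_bij_betw[OF sh, of "\<lambda>m. norm (complex_of_real (\<beta> m))"] s\<beta>1 by simp
    \<comment> \<open>Shifting the coefficients by one multiplies \<open>f\<close> by e^(-it). The
      cutoff of this function is the constant \<open>\<beta> 1\<close> on the arc, and multiplying
      it by e^(it) produces \<open>\<beta> 1\<close> e^(it) there.\<close>
    have f2: "((\<lambda>m. of_real (\<beta> (m + 1)) * cis (of_int m * t)) has_sum cis (- t) * f t) UNIV" for t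
    proof -
      have "((\<lambda>m. of_real (\<beta> (m + 1)) * cis (of_int (m + 1) * t)) has_sum f t) UNIV"
        using has_sum_reindex_bij_betw[OF sh, of "\<lambda>m. of_real (\<beta> m) * cis (of_int m * t)" "f t"] f[of t] by simp
      from has_sum_cmult_right[OF this, of "cis (- t)"]
      have "((\<lambda>m. cis (- t) * (of_real (\<beta> (m + 1)) * cis (of_int (m + 1) * t))) has_sum cis (- t) * f t) UNIV" .
      moreover have "cis (- t) * (of_real (\<beta> (m + 1)) * cis (of_int (m + 1) * t)) = of_real (\<beta> (m + 1)) * cis (of_int m * t)" for m
      proof -
        have "cis (- t) * cis (of_int (m + 1) * t) = cis (of_int m * t)" by (simp add: cis_mult algebra_simps)
        then show ?thesis by (metis mult.left_commute)
      qed
      ultimately show ?thesis by (simp only:)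
    qed
    define x1 where "x1 m = w / pi * sinc (w * of_int m) * \<beta> m" for m :: int
    define x2 where "x2 m = w / pi * sinc (w * of_int (m - 1)) * \<beta> m" for m :: int
    have X1: "((\<lambda>m. of_real (x1 m) * cis (of_int m * t)) has_sum 1) UNIV" if "\<bar>t\<bar> \<le> \<epsilon>" for t
    proof -
      have "((\<lambda>m. of_real (w / pi * sinc (w * of_int m)) * of_real (\<beta> m) * cis (of_int m * t)) has_sum of_real (\<beta> 0)) UNIV"
        by (rule bump_window[OF s\<beta>1 f z z' _ w(1)]) (use that \<epsilon> in \<open>auto simp: w_def\<close>)
      then show ?thesis unfolding x1_def of_real_mult \<beta>(1) by simp
    qed
    have X2: "((\<lambda>m. of_real (x2 m) * cis (of_int m * t)) has_sum of_real (\<beta> 1) * cis t) UNIV" if "\<bar>t\<bar> \<le> \<epsilon>" for t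
    proof -
      have "((\<lambda>m. of_real (w / pi * sinc (w * of_int m)) * of_real (\<beta> (m + 1)) * cis (of_int m * t)) has_sum of_real (\<beta> (0 + 1))) UNIV"
        by (rule bump_window[OF s\<beta>2 f2 _ _ _ w(1), of \<epsilon>]) (use that \<epsilon> z z' in \<open>auto simp: w_def\<close>)
      from has_sum_cmult_left[OF this, of "cis t"]
      have "((\<lambda>m. of_real (w / pi * sinc (w * of_int m)) * of_real (\<beta> (m + 1)) * cis (of_int m * t) * cis t) has_sum of_real (\<beta> 1) * cis t) UNIV"
        by simp
      moreover have "of_real (w / pi * sinc (w * of_int m)) * of_real (\<beta> (m + 1)) * cis (of_int m * t) * cis t =
          of_real (x2 (m + 1)) * cis (of_int (m + 1) * t)" for m
      proof -
        have "cis (of_int m * t) * cis t = cis (of_int (m + 1) * t)" by (simp add: cis_mult algebra_simps)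
        then show ?thesis by (simp add: x2_def mult.assoc)
      qed
      ultimately have "((\<lambda>m. of_real (x2 (m + 1)) * cis (of_int (m + 1) * t)) has_sum of_real (\<beta> 1) * cis t) UNIV"
        by (simp only:)
      then show ?thesis
        using has_sum_reindex_bij_betw[OF sh, of "\<lambda>m. of_real (x2 m) * cis (of_int m * t)"] by simp
    qed
    have \<beta>1: "1 / 2 \<le> \<beta> 1" using \<beta>(2) \<epsilon> by linarith
    define y where "y m = x1 m - x2 m / \<beta> 1" for m
    have ym: "\<bar>y m\<bar> \<le> w / pi * (5 * \<epsilon>) * \<bar>\<beta> m\<bar>" for m
    proof -
      have "y m = w / pi * (sinc (w * of_int m) - sinc (w * of_int (m - 1)) / \<beta> 1) * \<beta> m"
        by (simp add: y_def x1_def x2_def algebra_simps)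
      \<comment> \<open>This is the source of the factor \<epsilon> in the norm: multipliers at
        neighbouring indices differ by at most \<open>w\<close>, which is 3 \<epsilon>, and the
        division by \<open>\<beta> 1\<close>, which is within \<epsilon> of 1 and at least 1/2,
        costs at most 2 \<epsilon>.\<close>
      moreover have "\<bar>sinc (w * of_int m) - sinc (w * of_int (m - 1)) / \<beta> 1\<bar> \<le> 5 * \<epsilon>"
      proof -
        have 1: "\<bar>sinc (w * of_int m) - sinc (w * of_int (m - 1))\<bar> \<le> 3 * \<epsilon>"
          using abs_sinc_diff_le[of "w * of_int m" "w * of_int (m - 1)"] \<epsilon> by (simp add: w_def algebra_simps)
        have "\<bar>sinc (w * of_int (m - 1)) - sinc (w * of_int (m - 1)) / \<beta> 1\<bar> = \<bar>sinc (w * of_int (m - 1))\<bar> * (\<bar>1 - \<beta> 1\<bar> / \<beta> 1)"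
          using \<beta>1 by (simp add: abs_mult[symmetric] abs_divide[symmetric] field_simps abs_minus_commute)
        also have "\<dots> \<le> 1 * (\<epsilon> / (1 / 2))"
          using \<beta>1 \<beta>(2) \<epsilon> by (intro mult_mono frac_le abs_sinc_le_1) auto
        finally have 2: "\<bar>sinc (w * of_int (m - 1)) - sinc (w * of_int (m - 1)) / \<beta> 1\<bar> \<le> 2 * \<epsilon>" by simp
        have "\<bar>A - B\<bar> \<le> 3 * \<epsilon> \<Longrightarrow> \<bar>B - C\<bar> \<le> 2 * \<epsilon> \<Longrightarrow> \<bar>A - C\<bar> \<le> 5 * \<epsilon>" for A B C :: real by linarith
        from this[OF 1 2] show ?thesis .
      qed
      moreover have "\<bar>w / pi * s * b\<bar> \<le> w / pi * (5 * \<epsilon>) * \<bar>b\<bar>" if "\<bar>s\<bar> \<le> 5 * \<epsilon>" for s b :: real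
      proof -
        have "w / pi * \<bar>s\<bar> * \<bar>b\<bar> \<le> w / pi * (5 * \<epsilon>) * \<bar>b\<bar>" using that w by (intro mult_right_mono mult_left_mono) auto
        then show ?thesis using w by (simp add: abs_mult)
      qed
      ultimately show ?thesis by presburger
    qed
    have yw: "norm (complex_of_real (y m)) * ?w m \<le> (w / pi * (5 * \<epsilon>)) * (exp 1 * 320002 * ?i m)" for m
    proof -
      have "norm (complex_of_real (y m)) * ?w m \<le> (w / pi * (5 * \<epsilon>) * \<bar>\<beta> m\<bar>) * ?w m"
        using ym by (intro mult_right_mono) auto
      also have "\<dots> = (w / pi * (5 * \<epsilon>)) * (\<bar>\<beta> m\<bar> * ?w m)" by (simp only: mult.assoc)
      also have "\<dots> \<le> (w / pi * (5 * \<epsilon>)) * (exp 1 * 320002 * ?i m)"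
        using \<beta>w w \<epsilon> by (intro mult_left_mono) auto
      finally show ?thesis .
    qed
    have sK: "(\<lambda>m. (w / pi * (5 * \<epsilon>)) * (exp 1 * 320002 * ?i m)) summable_on UNIV"
      using si by (rule summable_on_cmult_right)
    have syw: "(\<lambda>m. norm (complex_of_real (y m)) * ?w m) summable_on UNIV"
      by (rule summable_on_comparison_test[OF sK]) (use yw in auto)
    have sy: "(\<lambda>m. norm (complex_of_real (y m))) summable_on UNIV"
    proof (rule summable_on_comparison_test[OF syw])
      show "norm (complex_of_real (y m)) \<le> norm (complex_of_real (y m)) * ?w m" for m
        using mult_left_mono[OF w1[of m], of "norm (complex_of_real (y m))"] by simp
    qed auto
    have "(\<Sum>\<^sub>\<infinity>m. norm (complex_of_real (y m)) * ?w m) \<le> (\<Sum>\<^sub>\<infinity>m. (w / pi * (5 * \<epsilon>)) * (exp 1 * 320002 * ?i m))"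
      by (rule infsum_mono[OF syw sK]) (rule yw)
    also have "\<dots> = (w / pi * (5 * \<epsilon>)) * (exp 1 * 320002 * (\<Sum>\<^sub>\<infinity>m. ?i m))"
      by (simp only: infsum_cmult_right')
    also have "\<dots> \<le> (w / pi * (5 * \<epsilon>)) * (exp 1 * 320002 * (2 * (2 / \<epsilon>)))"
      using i(2) w \<epsilon> by (intro mult_left_mono) auto
    also have "\<dots> = K * \<epsilon>" using \<epsilon> by (simp add: K_def w_def)
    finally have le: "(\<Sum>\<^sub>\<infinity>m. norm (complex_of_real (y m)) * ?w m) \<le> K * \<epsilon>" .
    define Z where "Z t = (\<Sum>\<^sub>\<infinity>m. of_real (y m) * cis (of_int m * t))" for t
    have Z: "((\<lambda>m. of_real (y m) * cis (of_int m * t)) has_sum Z t) UNIV" for t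
      unfolding Z_def by (rule has_sum_infsum, rule abs_summable_summable) (use sy in \<open>simp add: norm_mult\<close>)
    have "Z t = 1 - cis t" if "\<bar>t\<bar> \<le> \<epsilon>" for t
    proof -
      have "((\<lambda>m. of_real (x1 m) * cis (of_int m * t) + (- 1 / of_real (\<beta> 1)) * (of_real (x2 m) * cis (of_int m * t))) has_sum
          1 + (- 1 / of_real (\<beta> 1)) * (of_real (\<beta> 1) * cis t)) UNIV"
        by (intro has_sum_add has_sum_cmult_right X1 X2 that)
      moreover have "of_real (x1 m) * cis (of_int m * t) + (- 1 / of_real (\<beta> 1)) * (of_real (x2 m) * cis (of_int m * t)) =
          of_real (y m) * cis (of_int m * t)" for m
        by (simp add: y_def algebra_simps)
      moreover have "1 + (- 1 / of_real (\<beta> 1)) * (of_real (\<beta> 1) * cis t) = 1 - cis t"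
        using \<beta>1 by (simp add: field_simps)
      ultimately have "((\<lambda>m. of_real (y m) * cis (of_int m * t)) has_sum 1 - cis t) UNIV" by (simp only:)
      with Z[of t] show ?thesis using has_sum_unique by blast
    qed
    moreover have "weighted_fourier ?w (K * \<epsilon>) Z"
      unfolding weighted_fourier_def by (rule exI[of _ "\<lambda>m. complex_of_real (y m)"]) (intro conjI allI sy syw le Z)
    ultimately show ?thesis by blast
  qed
  ultimately show ?thesis using that by blast
qed

section \<open>Vanishing on an arc\<close>

text \<open>\<open>G\<close> is left general so that norms, weighted norms and exponential terms are
  all extended by zero to the negative indices by the same rule.\<close>

lemma has_sum_int_of_nat:
  fixes G :: "int \<Rightarrow> 'a::zero \<Rightarrow> 'b :: {comm_monoid_add, topological_space}"
  assumes "((\<lambda>k. G (int k) (c k)) has_sum S) UNIV" "\<And>n. G n 0 = 0"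
  shows "((\<lambda>n. G n (if n < 0 then 0 else c (nat n))) has_sum S) UNIV"
proof -
  have b1: "bij_betw int UNIV {0..}" by (rule bij_betwI[where g = nat]) auto
  have "((\<lambda>n. G n (if n < 0 then 0 else c (nat n))) has_sum S) {0..}"
    using assms(1) has_sum_reindex_bij_betw[OF b1, of "\<lambda>n. G n (if n < 0 then 0 else c (nat n))" S] by simp
  then show ?thesis
    by (subst has_sum_cong_neutral[where T = "{0..}" and g = "\<lambda>n. G n (if n < 0 then 0 else c (nat n))"]) (auto simp: assms)
qed

lemma holomorphic_fourier:
  assumes hol: "F holomorphic_on ball 0 R" and \<rho>: "1 < \<rho>" "\<rho> < R" and B: "\<And>z. norm z = \<rho> \<Longrightarrow> norm (F z) \<le> B"
  obtains a :: "int \<Rightarrow> complex" where "\<And>n. n < 0 \<Longrightarrow> a n = 0" "a 0 = F 0" "\<And>n. 0 \<le> n \<Longrightarrow> norm (a n) \<le> B * (1 / \<rho>) ^ nat n"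
    "(\<lambda>n. norm (a n)) summable_on UNIV" "\<And>t. ((\<lambda>n. a n * cis (of_int n * t)) has_sum F (cis t)) UNIV"
proof -
  define c where "c n = (deriv ^^ n) F 0 / fact n" for n
  define a where "a n = (if n < 0 then 0 else c (nat n))" for n :: int
  have c: "norm (c n) \<le> B * (1 / \<rho>) ^ n" for n
  proof -
    have "norm ((deriv ^^ n) F 0) \<le> fact n * B / \<rho> ^ n"
    proof (rule Cauchy_inequality)
      show "F holomorphic_on ball 0 \<rho>" using hol by (rule holomorphic_on_subset) (use \<rho> in auto)
      show "continuous_on (cball 0 \<rho>) F"
        by (rule holomorphic_on_imp_continuous_on, rule holomorphic_on_subset[OF hol]) (use \<rho> in auto)
    qed (use \<rho> B in auto)
    then show ?thesis by (simp add: c_def norm_divide field_simps power_one_over)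
  qed
  have geo: "(\<lambda>n. B * (1 / \<rho>) ^ n) sums (B * (1 / (1 - 1 / \<rho>)))"
    by (intro sums_mult geometric_sums) (use \<rho> in auto)
  note ext = has_sum_int_of_nat[where c = c, folded a_def]
  have sc: "summable (\<lambda>n. norm (c n))"
    by (rule summable_comparison_test'[OF sums_summable[OF geo]]) (use c in auto)
  then have sc': "(\<lambda>n. norm (c n)) summable_on UNIV" by (simp add: summable_nonneg_imp_summable_on)
  show ?thesis
  proof (rule that)
    show "a n = 0" if "n < 0" for n using that by (simp add: a_def)
    show "a 0 = F 0" by (simp add: a_def c_def)
    show "norm (a n) \<le> B * (1 / \<rho>) ^ nat n" if "0 \<le> n" for n using that c[of "nat n"] by (simp add: a_def)
    show "(\<lambda>n. norm (a n)) summable_on UNIV"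
      using ext[of "\<lambda>n z. norm z"] sc' unfolding summable_on_def by force
    fix t
    have "(\<lambda>n. (deriv ^^ n) F 0 / fact n * (cis t - 0) ^ n) sums F (cis t)"
      by (rule holomorphic_power_series[OF hol]) (use \<rho> in auto)
    then have "(\<lambda>n. c n * cis (real n * t)) sums F (cis t)" by (simp add: c_def Complex.DeMoivre)
    moreover have "summable (\<lambda>n. norm (c n * cis (real n * t)))" using sc by (simp add: norm_mult)
    ultimately have "((\<lambda>n. c n * cis (real n * t)) has_sum F (cis t)) UNIV"
      by (intro norm_summable_imp_has_sum)
    then show "((\<lambda>n. a n * cis (of_int n * t)) has_sum F (cis t)) UNIV"
      using ext[of "\<lambda>n z. z * cis (of_int n * t)"] by simp
  qed
qed

text \<open>Removing the constant term means that the weight is controlled only from n = 1 on; after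
  dilation by \<open>D\<close> these are frequencies >= D, where the weights in use are at most 1.
  Cauchy's estimates then leave a geometric series with sum \<open>B / (\<rho> - 1)\<close>.\<close>

lemma weighted_fourier_holomorphic:
  assumes hol: "F holomorphic_on ball 0 R" and \<rho>: "1 < \<rho>" "\<rho> < R" and B: "\<And>z. norm z = \<rho> \<Longrightarrow> norm (F z) \<le> B"
    and w: "\<And>n. 0 \<le> w n" "\<And>n. 1 \<le> n \<Longrightarrow> w n \<le> 1"
  shows "weighted_fourier w (B / (\<rho> - 1)) (\<lambda>t. F (cis t) - F 0)"
proof -
  obtain a :: "int \<Rightarrow> complex" where a: "\<And>n. n < 0 \<Longrightarrow> a n = 0" "a 0 = F 0" "\<And>n. 0 \<le> n \<Longrightarrow> norm (a n) \<le> B * (1 / \<rho>) ^ nat n"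
    "(\<lambda>n. norm (a n)) summable_on UNIV" "\<And>t. ((\<lambda>n. a n * cis (of_int n * t)) has_sum F (cis t)) UNIV"
    using holomorphic_fourier[OF hol \<rho> B] by blast
  define b where "b n = (if n = 0 then 0 else a n)" for n
  have s1: "(\<lambda>n. norm (b n)) summable_on UNIV"
    by (rule summable_on_comparison_test[OF a(4)]) (auto simp: b_def)
  have geo: "((\<lambda>n::nat. B * (1 / \<rho>) ^ n) has_sum B * (1 / \<rho> / (1 - 1 / \<rho>))) {1..}"
    by (intro has_sum_cmult_right has_sum_geometric_from_1) (use \<rho> in auto)
  have b1: "bij_betw int {1..} {1..}" by (rule bij_betwI[where g = nat]) auto
  have "((\<lambda>n::int. B * (1 / \<rho>) ^ nat n) has_sum B * (1 / \<rho> / (1 - 1 / \<rho>))) {1..}"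
    using has_sum_reindex_bij_betw[OF b1, of "\<lambda>n. B * (1 / \<rho>) ^ nat n"] geo by simp
  then have g: "((\<lambda>n::int. if 1 \<le> n then B * (1 / \<rho>) ^ nat n else 0) has_sum B * (1 / \<rho> / (1 - 1 / \<rho>))) UNIV"
    by (subst has_sum_cong_neutral[where T = "{1..}" and g = "\<lambda>n. B * (1 / \<rho>) ^ nat n"]) auto
  have le: "norm (b n) * w n \<le> (if 1 \<le> n then B * (1 / \<rho>) ^ nat n else 0)" for n
  proof (cases "1 \<le> n")
    case True
    have "norm (b n) * w n \<le> norm (b n) * 1" using w(2)[OF True] by (intro mult_left_mono) auto
    also have "\<dots> \<le> B * (1 / \<rho>) ^ nat n" using True a(3)[of n] by (simp add: b_def)
    finally show ?thesis using True by simp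
  next
    case False
    then have "b n = 0" using a(1)[of n] by (auto simp: b_def)
    then show ?thesis using False by simp
  qed
  have s2: "(\<lambda>n. norm (b n) * w n) summable_on UNIV"
    by (rule summable_on_comparison_test[OF has_sum_imp_summable[OF g]]) (use le w in auto)
  have "(\<Sum>\<^sub>\<infinity>n. norm (b n) * w n) \<le> B * (1 / \<rho> / (1 - 1 / \<rho>))"
    by (rule has_sum_mono[OF has_sum_infsum[OF s2] g]) (rule le)
  also have "\<dots> = B / (\<rho> - 1)" using \<rho> by (simp add: field_simps)
  finally have s3: "(\<Sum>\<^sub>\<infinity>n. norm (b n) * w n) \<le> B / (\<rho> - 1)" .
  have "((\<lambda>n. b n * cis (of_int n * t)) has_sum F (cis t) - F 0) UNIV" for t
  proof -
    have z: "((\<lambda>n. if n = 0 then - F 0 else 0) has_sum - F 0) (UNIV :: int set)"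
      by (rule has_sum_finite_neutralI[of "{0}"]) auto
    have "((\<lambda>n. a n * cis (of_int n * t) + (if n = 0 then - F 0 else 0)) has_sum F (cis t) + - F 0) UNIV"
      by (rule has_sum_add[OF a(5) z])
    moreover have "a n * cis (of_int n * t) + (if n = 0 then - F 0 else 0) = b n * cis (of_int n * t)" for n
      using a(2) by (simp add: b_def)
    ultimately show ?thesis by (simp only:) simp
  qed
  with s1 s2 s3 show ?thesis unfolding weighted_fourier_def by blast
qed

text \<open>On the circle, the squares of both sides are affine functions of Re z, so it suffices to
  compare them at the two real points and to interpolate. The radius 1 + \<eta>/2 lies between the
  unit circle and the pole 1/(1 - \<eta>).\<close>

lemma moebius_quotient_bound:
  fixes z :: complex
  assumes \<eta>: "0 < \<eta>" "\<eta> \<le> 1 / 2" and z: "norm z = 1 + \<eta> / 2"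
  shows "norm (1 - z) \<le> (1 + 2 * \<eta>) * norm (1 - of_real (1 - \<eta>) * z)"
proof -
  define \<rho> r K where defs: "\<rho> = 1 + \<eta> / 2" "r = 1 - \<eta>" "K = 1 + 2 * \<eta>"
  have nz: "(Re z)\<^sup>2 + (Im z)\<^sup>2 = \<rho>\<^sup>2" using z by (simp add: cmod_power2[symmetric] defs)
  have n1: "(norm (1 - z))\<^sup>2 = 1 - 2 * Re z + \<rho>\<^sup>2"
    unfolding cmod_power2 nz[symmetric] by (simp add: power2_eq_square algebra_simps)
  have n2: "(norm (1 - of_real r * z))\<^sup>2 = 1 - 2 * r * Re z + r\<^sup>2 * \<rho>\<^sup>2"
    unfolding cmod_power2 nz[symmetric] by (simp add: power2_eq_square algebra_simps)
  define \<phi> where "\<phi> x = K\<^sup>2 * (1 - 2 * r * x + r\<^sup>2 * \<rho>\<^sup>2) - (1 - 2 * x + \<rho>\<^sup>2)" for x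
  have \<rho>0: "0 < \<rho>" using \<eta> by (simp add: defs)
  have xb: "- \<rho> \<le> Re z" "Re z \<le> \<rho>" using abs_Re_le_cmod[of z] z by (auto simp: defs)
  have r\<rho>: "1 - r * \<rho> = \<eta> / 2 + \<eta>\<^sup>2 / 2" by (simp add: defs power2_eq_square field_simps)
  have e1: "\<phi> \<rho> = (K * (1 - r * \<rho>))\<^sup>2 - (\<rho> - 1)\<^sup>2" by (simp add: \<phi>_def power2_eq_square algebra_simps)
  have "\<rho> - 1 \<le> K * (1 - r * \<rho>)"
  proof -
    have "\<rho> - 1 \<le> 1 * (1 - r * \<rho>)" unfolding r\<rho> by (simp add: defs)
    also have "\<dots> \<le> K * (1 - r * \<rho>)" using \<eta> unfolding r\<rho> by (intro mult_right_mono) (auto simp: defs)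
    finally show ?thesis .
  qed
  then have p1: "0 \<le> \<phi> \<rho>" unfolding e1 using \<eta> power_mono[of "\<rho> - 1" "K * (1 - r * \<rho>)" 2] by (simp add: defs)
  have e2: "\<phi> (- \<rho>) = (K * (1 + r * \<rho>))\<^sup>2 - (1 + \<rho>)\<^sup>2" by (simp add: \<phi>_def power2_eq_square algebra_simps)
  have "1 + \<rho> \<le> K * (1 + r * \<rho>)"
  proof -
    have "\<eta>\<^sup>2 \<le> (1 / 2)\<^sup>2" using \<eta> by (intro power_mono) auto
    then have "0 \<le> \<eta> * (3 - \<eta> * 3 / 2 - \<eta>\<^sup>2)" using \<eta> by (intro mult_nonneg_nonneg) (auto simp: power2_eq_square)
    also have "\<eta> * (3 - \<eta> * 3 / 2 - \<eta>\<^sup>2) = K * (1 + r * \<rho>) - (1 + \<rho>)"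
      by (simp add: defs power2_eq_square field_simps)
    finally show ?thesis by simp
  qed
  then have p2: "0 \<le> \<phi> (- \<rho>)" unfolding e2 using \<rho>0 power_mono[of "1 + \<rho>" "K * (1 + r * \<rho>)" 2] by simp
  have "2 * \<rho> * \<phi> (Re z) = (\<rho> + Re z) * \<phi> \<rho> + (\<rho> - Re z) * \<phi> (- \<rho>)"
    by (simp add: \<phi>_def algebra_simps)
  moreover have "0 \<le> (\<rho> + Re z) * \<phi> \<rho> + (\<rho> - Re z) * \<phi> (- \<rho>)"
    by (rule add_nonneg_nonneg; rule mult_nonneg_nonneg) (use xb p1 p2 in linarith)+
  ultimately have "0 \<le> \<phi> (Re z)" using \<rho>0 by (metis mult_2 zero_le_mult_iff add_pos_pos not_less)
  then have "(norm (1 - z))\<^sup>2 \<le> (K * norm (1 - of_real r * z))\<^sup>2"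
    unfolding power_mult_distrib n1 n2 \<phi>_def by simp
  then have "norm (1 - z) \<le> K * norm (1 - of_real r * z)"
    by (rule power2_le_imp_le) (use \<eta> in \<open>auto simp: defs\<close>)
  then show ?thesis by (simp add: defs)
qed

lemma outer_power_weighted_fourier:
  fixes M :: nat and \<eta> :: real
  assumes \<eta>: "0 < \<eta>" "\<eta> \<le> 1 / 2" and w: "\<And>n. 0 \<le> w n" "\<And>n. 1 \<le> n \<Longrightarrow> w n \<le> 1"
  shows "weighted_fourier w (2 * exp (2 * \<eta> * M) / \<eta>) (\<lambda>t. ((1 - cis t) / (1 - of_real (1 - \<eta>) * cis t)) ^ M - 1)"
proof -
  let ?F = "\<lambda>z::complex. ((1 - z) / (1 - of_real (1 - \<eta>) * z)) ^ M"
  have ne: "1 - of_real (1 - \<eta>) * z \<noteq> 0" if "norm z < 1 / (1 - \<eta>)" for z :: complex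
  proof
    assume "1 - of_real (1 - \<eta>) * z = 0"
    then have "of_real (1 - \<eta>) * z = 1" by simp
    then have "norm (of_real (1 - \<eta>) * z) = 1" by simp
    then have "\<bar>1 - \<eta>\<bar> * norm z = 1" using \<eta> by (simp only: norm_mult norm_of_real)
    with that \<eta> show False by (simp add: field_simps)
  qed
  have "weighted_fourier w (exp (2 * \<eta> * M) / (1 + \<eta> / 2 - 1)) (\<lambda>t. ?F (cis t) - ?F 0)"
  proof (rule weighted_fourier_holomorphic)
    show "?F holomorphic_on ball 0 (1 / (1 - \<eta>))"
      using ne by (intro holomorphic_intros) auto
    show "1 < 1 + \<eta> / 2" using \<eta> by simp
    show lt: "1 + \<eta> / 2 < 1 / (1 - \<eta>)" using \<eta> add_pos_pos[OF \<eta>(1) mult_pos_pos[OF \<eta>(1) \<eta>(1)]] by (simp add: field_simps)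
    fix z :: complex assume z: "norm z = 1 + \<eta> / 2"
    have p: "0 < norm (1 - of_real (1 - \<eta>) * z)" using ne[of z] z lt by simp
    have "norm ((1 - z) / (1 - of_real (1 - \<eta>) * z)) \<le> 1 + 2 * \<eta>"
      unfolding norm_divide using moebius_quotient_bound[OF \<eta> z] p by (simp only: pos_divide_le_eq)
    also have "\<dots> \<le> exp (2 * \<eta>)" by (rule exp_ge_add_one_self)
    finally have "norm (?F z) \<le> exp (2 * \<eta>) ^ M" unfolding norm_power by (rule power_mono) simp
    then show "norm (?F z) \<le> exp (2 * \<eta> * M)" by (simp add: exp_of_nat_mult[symmetric] mult.commute)
  qed (use w in auto)
  then show ?thesis by (simp add: mult.commute)
qed

text \<open>Since \<open>\<epsilon> \<le> \<eta>\<close>, the weight is at most e^(\<eta> n/2 + 1)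
  and spends only half of the decay (1 - \<eta>)^n <= e^(-\<eta> n). The remaining geometric series
  has sum at most 4/\<eta>, and e <= 3 gives 12.\<close>

lemma geometric_weighted_fourier:
  assumes \<eta>: "0 < \<eta>" "\<eta> \<le> 1 / 2" and \<epsilon>: "0 < \<epsilon>" "\<epsilon> \<le> \<eta>"
  shows "weighted_fourier (\<lambda>m. exp (sqrt (\<epsilon> * \<bar>of_int m\<bar>) / 5)) (12 / \<eta>) (\<lambda>t. 1 / (1 - of_real (1 - \<eta>) * cis t))"
proof -
  let ?w = "\<lambda>m::int. exp (sqrt (\<epsilon> * \<bar>of_int m\<bar>) / 5)"
  define c where "c n = complex_of_real ((1 - \<eta>) ^ n)" for n
  define a where "a n = (if n < 0 then 0 else c (nat n))" for n :: int
  define s where "s = exp (- (\<eta> / 2))"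
  note ext = has_sum_int_of_nat[where c = c, folded a_def]
  have nc: "norm (c n) = (1 - \<eta>) ^ n" for n unfolding c_def norm_of_real using \<eta> by simp
  have "s * (1 + \<eta> / 2) \<le> s * exp (\<eta> / 2)" unfolding s_def by (intro mult_left_mono exp_ge_add_one_self) auto
  also have "\<dots> = 1" by (simp add: s_def exp_minus)
  finally have s: "0 < s" "s \<le> 1 / (1 + \<eta> / 2)" using \<eta> by (auto simp: s_def field_simps)
  have "1 / (1 + \<eta> / 2) \<le> 1 - \<eta> / 4" using \<eta> mult_left_mono[OF \<eta>(2), of \<eta>] by (simp add: field_simps)
  with s have s1: "s \<le> 1 - \<eta> / 4" by linarith
  have le: "norm (c n) * ?w (int n) \<le> exp 1 * s ^ n" for n
  proof -
    have y: "x / 5 \<le> x\<^sup>2 / 2 + 1" for x :: real using zero_le_power2[of "x - 1/5"] by (simp add: power2_eq_square algebra_simps)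
    have "norm (c n) \<le> exp (- \<eta>) ^ n"
      unfolding nc using \<eta> exp_ge_add_one_self[of "- \<eta>"] by (intro power_mono) auto
    then have 1: "norm (c n) \<le> exp (- \<eta> * n)" by (simp add: exp_of_nat_mult[symmetric] mult.commute)
    have "sqrt (\<epsilon> * \<bar>of_int (int n)\<bar>) / 5 \<le> sqrt (\<eta> * n) / 5"
      using \<epsilon> by (intro divide_right_mono real_sqrt_le_mono) (auto intro!: mult_right_mono)
    also have "\<dots> \<le> \<eta> * n / 2 + 1" using y[of "sqrt (\<eta> * n)"] \<eta> by simp
    finally have 2: "?w (int n) \<le> exp (\<eta> * n / 2 + 1)" by simp
    have "norm (c n) * ?w (int n) \<le> exp (- \<eta> * n) * exp (\<eta> * n / 2 + 1)"
      by (rule mult_mono[OF 1 2]) auto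
    also have "\<dots> = exp 1 * s ^ n" by (simp add: s_def exp_of_nat_mult[symmetric] exp_add[symmetric] algebra_simps)
    finally show ?thesis .
  qed
  have geo: "(\<lambda>n. exp 1 * s ^ n) sums (exp 1 * (1 / (1 - s)))"
    using s s1 \<eta> by (intro sums_mult geometric_sums) auto
  have geo': "((\<lambda>n. exp 1 * s ^ n) has_sum (exp 1 * (1 / (1 - s)))) UNIV"
    by (rule sums_nonneg_imp_has_sum[OF geo]) (use s in auto)
  have sw: "(\<lambda>n. norm (c n) * ?w (int n)) summable_on UNIV"
    by (rule summable_on_comparison_test[OF has_sum_imp_summable[OF geo']]) (use le in auto)
  have sn: "(\<lambda>n. norm (c n)) summable_on UNIV"
  proof (rule summable_on_comparison_test[OF sw])
    have "1 \<le> ?w (int n)" for n using \<epsilon> by simp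
    then show "norm (c n) \<le> norm (c n) * ?w (int n)" for n using mult_left_mono[of 1 "?w (int n)" "norm (c n)"] by simp
  qed auto
  have "(\<Sum>\<^sub>\<infinity>n. norm (c n) * ?w (int n)) \<le> exp 1 * (1 / (1 - s))"
    by (rule has_sum_mono[OF has_sum_infsum[OF sw] geo']) (rule le)
  also have "\<dots> \<le> 3 * (1 / (\<eta> / 4))"
    using s1 \<eta> exp_le by (intro mult_mono divide_left_mono) auto
  finally have le2: "(\<Sum>\<^sub>\<infinity>n. norm (c n) * ?w (int n)) \<le> 12 / \<eta>" by simp
  have W: "((\<lambda>n. norm (a n) * ?w n) has_sum (\<Sum>\<^sub>\<infinity>n. norm (c n) * ?w (int n))) UNIV"
    using ext[of "\<lambda>n z. norm z * ?w n", OF has_sum_infsum[OF sw]] by simp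
  have N: "((\<lambda>n. norm (a n)) has_sum (\<Sum>\<^sub>\<infinity>n. norm (c n))) UNIV"
    using ext[of "\<lambda>n z. norm z", OF has_sum_infsum[OF sn]] by simp
  have "((\<lambda>n. a n * cis (of_int n * t)) has_sum 1 / (1 - of_real (1 - \<eta>) * cis t)) UNIV" for t
  proof -
    have nz: "norm (of_real (1 - \<eta>) * cis t) < 1" using \<eta> by (simp only: norm_mult norm_of_real norm_cis) simp
    have "(\<lambda>n. (of_real (1 - \<eta>) * cis t) ^ n) sums (1 / (1 - of_real (1 - \<eta>) * cis t))"
      using nz by (rule geometric_sums)
    moreover have "(of_real (1 - \<eta>) * cis t) ^ n = c n * cis (of_int (int n) * t)" for n
      by (simp add: c_def power_mult_distrib Complex.DeMoivre)
    ultimately have "(\<lambda>n. c n * cis (of_int (int n) * t)) sums (1 / (1 - of_real (1 - \<eta>) * cis t))" by (simp only:)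
    moreover have "summable (\<lambda>n. norm (c n * cis (of_int (int n) * t)))"
      using summable_on_imp_summable[OF sn] by (simp add: norm_mult)
    ultimately have "((\<lambda>n. c n * cis (of_int (int n) * t)) has_sum 1 / (1 - of_real (1 - \<eta>) * cis t)) UNIV"
      by (intro norm_summable_imp_has_sum)
    from ext[of "\<lambda>n z. z * cis (of_int n * t)", OF this] show ?thesis by simp
  qed
  then show ?thesis unfolding weighted_fourier_def using W N le2
    by (intro exI[of _ a]) (simp add: has_sum_iff)
qed

text \<open>On the arc, 1 - e^(it) may be replaced by a function of norm of order \<epsilon>, while
  1/(1 - (1 - \<eta>) e^(it)) has norm of order 1/\<eta>. The weight is submultiplicative because
  the square root is subadditive, so the M-th power costs only the M-th power of the norm C
  \<epsilon>/\<eta>, which is tiny once \<epsilon> is a small multiple of \<eta>. The integer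
  \<open>l\<close> expresses agreement modulo 2 pi.\<close>

lemma outer_power_match:
  obtains C :: real where "1 \<le> C"
    "\<And>\<eta> \<epsilon> M. 0 < \<eta> \<Longrightarrow> \<eta> \<le> 1 / 2 \<Longrightarrow> 0 < \<epsilon> \<Longrightarrow> \<epsilon> \<le> \<eta> \<Longrightarrow>
       \<exists>Y. weighted_fourier (\<lambda>m. exp (sqrt (\<epsilon> * \<bar>of_int m\<bar>) / 5)) ((C * \<epsilon> / \<eta>) ^ M) Y \<and>
         (\<forall>t l. \<bar>t + 2 * pi * of_int l\<bar> \<le> \<epsilon> \<longrightarrow> Y t = ((1 - cis t) / (1 - of_real (1 - \<eta>) * cis t)) ^ M)"
proof -
  obtain K :: real where K: "0 < K"
    "\<And>\<epsilon>. 0 < \<epsilon> \<Longrightarrow> \<epsilon> \<le> 1 / 2 \<Longrightarrow> \<exists>Z. weighted_fourier (\<lambda>m. exp (sqrt (\<epsilon> * \<bar>of_int m\<bar>) / 5)) (K * \<epsilon>) Z \<and> (\<forall>t. \<bar>t\<bar> \<le> \<epsilon> \<longrightarrow> Z t = 1 - cis t)"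
    using small_arc_function by metis
  define C where "C = max 1 (12 * K)"
  have "\<exists>Y. weighted_fourier (\<lambda>m. exp (sqrt (\<epsilon> * \<bar>of_int m\<bar>) / 5)) ((C * \<epsilon> / \<eta>) ^ M) Y \<and>
         (\<forall>t l. \<bar>t + 2 * pi * of_int l\<bar> \<le> \<epsilon> \<longrightarrow> Y t = ((1 - cis t) / (1 - of_real (1 - \<eta>) * cis t)) ^ M)"
    if \<eta>: "0 < \<eta>" "\<eta> \<le> 1 / 2" and \<epsilon>: "0 < \<epsilon>" "\<epsilon> \<le> \<eta>" for \<eta> \<epsilon> M
  proof -
    let ?w = "\<lambda>m::int. exp (sqrt (\<epsilon> * \<bar>of_int m\<bar>) / 5)"
    let ?q = "\<lambda>t. 1 / (1 - of_real (1 - \<eta>) * cis t)"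
    have sub: "?w (n + m) \<le> ?w n * ?w m" for n m
    proof -
      have "sqrt (\<epsilon> * \<bar>of_int (n + m)\<bar>) \<le> sqrt (\<epsilon> * \<bar>of_int n\<bar> + \<epsilon> * \<bar>of_int m\<bar>)"
        unfolding distrib_left[symmetric] using \<epsilon> by (intro real_sqrt_le_mono mult_left_mono) auto
      also have "\<dots> \<le> sqrt (\<epsilon> * \<bar>of_int n\<bar>) + sqrt (\<epsilon> * \<bar>of_int m\<bar>)"
        using \<epsilon> by (intro sqrt_add_le_add_sqrt) auto
      finally show ?thesis by (simp add: exp_add[symmetric])
    qed
    obtain Z where Z: "weighted_fourier ?w (K * \<epsilon>) Z" "\<And>t. \<bar>t\<bar> \<le> \<epsilon> \<Longrightarrow> Z t = 1 - cis t"
      using K(2)[of \<epsilon>] \<epsilon> \<eta> by (meson order_trans)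
    have "weighted_fourier ?w (1 * ((12 / \<eta>) * (K * \<epsilon>))) (\<lambda>t. ?q t * Z t)"
      by (rule weighted_fourier_mult[OF geometric_weighted_fourier[OF \<eta> \<epsilon>] Z(1)]) (use sub in auto)
    then have "weighted_fourier ?w (C * \<epsilon> / \<eta>) (\<lambda>t. ?q t * Z t)"
      by (rule weighted_fourier_mono[where K = 1]) (use \<epsilon> \<eta> in \<open>auto simp: C_def field_simps\<close>)
    then have Y: "weighted_fourier ?w ((C * \<epsilon> / \<eta>) ^ M) (\<lambda>t. (?q t * Z t) ^ M)"
      by (rule weighted_fourier_power) (use sub in auto)
    have "(?q t * Z t) ^ M = ((1 - cis t) / (1 - of_real (1 - \<eta>) * cis t)) ^ M" if "\<bar>t + 2 * pi * of_int l\<bar> \<le> \<epsilon>" for t l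
    proof -
      have "Z t = 1 - cis (t + 2 * pi * of_int l)"
        using Z(2)[OF that] weighted_fourier_periodic[OF Z(1), of t l] by simp
      also have "\<dots> = 1 - cis t" using cis_periodic_int[of 1 t l] by simp
      finally show ?thesis by simp
    qed
    with Y show ?thesis by blast
  qed
  moreover have "1 \<le> C" by (simp add: C_def)
  ultimately show ?thesis using that by blast
qed

section \<open>The weights\<close>

text \<open>A concave function that decreases somewhere eventually falls below any line of negative
  slope. \<open>T\<close> is chosen so far to the right that the chord from \<open>s\<close> to
  \<open>T\<close>, with g(T) replaced by 0, takes the value (g(s) + g(t))/2 > g(t) at
  \<open>t\<close>.\<close>

lemma concave_pos_mono:
  fixes g :: "real \<Rightarrow> real"
  assumes conc: "concave_on {0<..} g" and pos: "\<And>t. 0 < t \<Longrightarrow> 0 < g t" and st: "0 < s" "s \<le> t"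
  shows "g s \<le> g t"
proof (rule ccontr)
  assume "\<not> g s \<le> g t"
  then have lt: "g t < g s" "s < t" using st by (auto simp: order_less_le)
  define \<mu> where "\<mu> = (g s - g t) / g s / 2"
  have \<mu>: "0 < \<mu>" "\<mu> < 1" using lt pos[of t] pos[of s] st by (auto simp: \<mu>_def field_simps)
  define T where "T = s + (t - s) / \<mu>"
  have T: "0 < T" using st lt \<mu> by (auto simp: T_def intro!: add_pos_pos)
  have e: "(1 - \<mu>) *\<^sub>R s + \<mu> *\<^sub>R T = t" using \<mu> by (simp add: T_def field_simps)
  have "(1 - \<mu>) * g s + \<mu> * g T \<le> g ((1 - \<mu>) *\<^sub>R s + \<mu> *\<^sub>R T)"
    using concave_onD[OF conc, of \<mu> s T] \<mu> st T by auto
  then have "(1 - \<mu>) * g s + \<mu> * g T \<le> g t" unfolding e .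
  moreover have "0 < \<mu> * g T" using \<mu> pos[OF T] by simp
  moreover have "(1 - \<mu>) * g s = (g s + g t) / 2" using pos[of s] st by (simp add: \<mu>_def field_simps)
  moreover have "False" if "x + p \<le> b" "0 < p" "x = (a + b) / 2" "b < a" for x p a b :: real
    using that by (simp add: field_simps)
  ultimately show False using lt(1) by blast
qed

text \<open>The chord argument from the origin, where \<open>g\<close> is not controlled: it is run
  from a small \<open>e > 0\<close>, dropping the positive value \<open>g e\<close>, and then
  \<open>e\<close> tends to 0.\<close>

lemma concave_pos_ratio:
  fixes g :: "real \<Rightarrow> real"
  assumes conc: "concave_on {0<..} g" and pos: "\<And>t. 0 < t \<Longrightarrow> 0 < g t" and st: "0 < s" "s \<le> t"
  shows "g t * s \<le> g s * t"
proof (cases "s = t")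
  case False
  then have lt: "s < t" using st by simp
  have *: "g t * (s - e) \<le> g s * t" if e: "0 < e" "e < s" for e
  proof -
    define \<mu> where "\<mu> = (s - e) / (t - e)"
    have \<mu>: "0 < \<mu>" "\<mu> < 1" using e lt by (auto simp: \<mu>_def field_simps)
    have q: "(1 - \<mu>) *\<^sub>R e + \<mu> *\<^sub>R t = s"
    proof -
      have "\<mu> * (t - e) = s - e" using e lt by (simp add: \<mu>_def)
      then show ?thesis by (simp add: algebra_simps)
    qed
    have "(1 - \<mu>) * g e + \<mu> * g t \<le> g ((1 - \<mu>) *\<^sub>R e + \<mu> *\<^sub>R t)"
      using concave_onD[OF conc, of \<mu> e t] \<mu> st e by auto
    then have "(1 - \<mu>) * g e + \<mu> * g t \<le> g s" unfolding q .
    moreover have "0 < (1 - \<mu>) * g e" using \<mu> pos[OF e(1)] by simp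
    ultimately have "\<mu> * g t \<le> g s" by linarith
    then have "(s - e) * g t \<le> g s * (t - e)" using e lt by (simp add: \<mu>_def field_simps)
    also have "\<dots> \<le> g s * t" using pos[of s] st e by (intro mult_left_mono) auto
    finally show ?thesis by (simp add: mult.commute)
  qed
  show ?thesis
  proof (rule field_le_epsilon)
    fix d :: real assume d: "0 < d"
    define e where "e = min (s / 2) (d / g t)"
    have gt: "0 < g t" using pos st by simp
    have e: "0 < e" "e < s" using st d gt by (auto simp: e_def)
    have "g t * e \<le> g t * (d / g t)" using gt by (intro mult_left_mono) (auto simp: e_def)
    then have "g t * e \<le> d" using gt by simp
    then show "g t * s \<le> g s * t + d" using *[OF e] by (simp add: algebra_simps)
  qed
qed simp

lemma ln_sq_ratio_antimono:
  fixes x s :: real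
  assumes "0 < x" "x \<le> s"
  shows "(ln (s + 8))\<^sup>2 * x \<le> (ln (x + 8))\<^sup>2 * s"
proof -
  let ?f = "\<lambda>x. (ln (x + 8))\<^sup>2 / x"
  have "exp (2::real) = exp 1 ^ 2" by (simp add: exp_of_nat_mult[symmetric])
  also have "\<dots> \<le> (272 / 100) ^ 2" using e_less_272 by (intro power_mono) auto
  also have "\<dots> \<le> (8::real)" by (simp add: power2_eq_square)
  finally have e2: "exp (2::real) \<le> 8" .
  have "?f s \<le> ?f x"
  proof (rule DERIV_nonpos_imp_nonincreasing[OF assms(2)])
    fix y assume y: "x \<le> y" "y \<le> s"
    have y0: "0 < y" using y assms by simp
    have "(2::real) \<le> ln 8" using e2 by (subst ln_ge_iff) auto
    also have "\<dots> \<le> ln (y + 8)" using y0 by simp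
    finally have l: "2 \<le> ln (y + 8)" .
    let ?D = "(2 * ln (y + 8) * (1 / (y + 8)) * y - (ln (y + 8))\<^sup>2) / (y * y)"
    have "(?f has_real_derivative ?D) (at y)"
      using y0 by (auto intro!: derivative_eq_intros simp: power2_eq_square)
    moreover have "?D \<le> 0"
    proof (rule divide_nonpos_pos)
      have "2 * ln (y + 8) * (1 / (y + 8)) * y = ln (y + 8) * (2 * (y / (y + 8)))" by simp
      also have "\<dots> \<le> ln (y + 8) * (2 * 1)" using l y0 by (intro mult_left_mono) auto
      also have "\<dots> \<le> ln (y + 8) * ln (y + 8)" using l by (intro mult_left_mono) auto
      finally show "2 * ln (y + 8) * (1 / (y + 8)) * y - (ln (y + 8))\<^sup>2 \<le> 0" by (simp add: power2_eq_square)
    qed (use y0 in simp)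
    ultimately show "\<exists>D. (?f has_real_derivative D) (at y) \<and> D \<le> 0" by blast
  qed
  then show ?thesis using assms by (simp add: field_simps)
qed

text \<open>
  The exponent \<open>-1/3\<close> is the decay rate of the coefficients of powers of the Moebius map. The factor 10
  makes room for the spreading of negative frequencies under composition with it, and 8 exceeds
  \<open>e^2\<close>, which makes \<open>log(x + 8)^2/x\<close> decreasing.
\<close>

definition weight_u :: "(real \<Rightarrow> real) \<Rightarrow> int \<Rightarrow> real" where
  "weight_u \<omega> n = (if 0 \<le> n then (1 + of_int n) powr (- 1 / 3) else exp (\<omega> (ln (10 * \<bar>of_int n\<bar> + 8))))"

text \<open>The linear factor raises the exponent from \<omega>(T) to \<omega>(T) + T, where T =
  ln(10 |n| + 8). It is needed when a far negative frequency meets a positive one of size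
  \<open>D\<close>: the sum may lie near 0, where the decaying weight gains nothing.\<close>

definition weight_v :: "(real \<Rightarrow> real) \<Rightarrow> int \<Rightarrow> real" where
  "weight_v \<omega> n = (if 0 \<le> n then 1 else (10 * \<bar>of_int n\<bar> + 8) * exp (\<omega> (ln (10 * \<bar>of_int n\<bar> + 8))))"

locale concave_ratio =
  fixes \<omega> :: "real \<Rightarrow> real"
  assumes pos: "\<forall>t>0. \<omega> t > 0"
    and conc: "concave_on {0<..} (\<lambda>t. \<omega> t / t)"
begin

text \<open>The summand 1 ensures \<open>G \<ge> 1\<close>, respects both the monotonicity of
  \<open>G\<close> and the decrease of G(t)/t, and makes \<open>t * G t\<close> equal to the
  exponent in \<open>weight_v\<close>.\<close>

definition G :: "real \<Rightarrow> real" where "G t = \<omega> t / t + 1"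

lemma G_ge_1: "0 < t \<Longrightarrow> 1 \<le> G t"
  using pos by (auto simp: G_def intro!: divide_nonneg_nonneg order_less_imp_le)

lemma G_mono: "0 < s \<Longrightarrow> s \<le> t \<Longrightarrow> G s \<le> G t"
  using concave_pos_mono[OF conc, of s t] pos by (auto simp: G_def)

lemma G_ratio: "0 < s \<Longrightarrow> s \<le> t \<Longrightarrow> G t * s \<le> G s * t"
  using concave_pos_ratio[OF conc, of s t] pos by (auto simp: G_def algebra_simps)

lemma mult_G: "0 < t \<Longrightarrow> t * G t = \<omega> t + t"
  by (simp add: G_def field_simps)

lemma \<omega>_mono: "0 < s \<Longrightarrow> s \<le> t \<Longrightarrow> \<omega> s \<le> \<omega> t"
proof -
  assume st: "0 < s" "s \<le> t"
  have "s * (\<omega> s / s) \<le> t * (\<omega> t / t)"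
    using concave_pos_mono[OF conc _ st] pos st by (intro mult_mono) (auto intro: order_less_imp_le)
  then show ?thesis using st by simp
qed

lemma weight_v_neg: "n < 0 \<Longrightarrow> weight_v \<omega> n = exp (ln (10 * \<bar>of_int n\<bar> + 8) * G (ln (10 * \<bar>of_int n\<bar> + 8)))"
proof -
  assume "n < 0"
  then have p: "0 < 10 * \<bar>real_of_int n\<bar> + 8" "0 < ln (10 * \<bar>real_of_int n\<bar> + 8)" by (auto intro!: ln_gt_zero)
  show ?thesis unfolding mult_G[OF p(2)] exp_add using p \<open>n < 0\<close> by (simp add: weight_v_def)
qed

lemma weight_v_ge_1: "1 \<le> weight_v \<omega> n"
proof (cases "0 \<le> n")
  case False
  have p: "0 < ln (10 * \<bar>real_of_int n\<bar> + 8)" by (auto intro!: ln_gt_zero)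
  show ?thesis using False p G_ge_1[OF p] by (simp add: weight_v_neg)
qed (simp add: weight_v_def)

text \<open>A function H for which H(s)/s decreases is subadditive. With b = ln(s + 8) the ratio
  here factors as (G(b)/b) (b^2/s), and both factors decrease; this is why the square of the
  logarithm was studied.\<close>

lemma scaled_subadditive:
  assumes "0 < x" "0 < y"
  shows "ln (x + y + 8) * G (ln (x + y + 8)) \<le> ln (x + 8) * G (ln (x + 8)) + ln (y + 8) * G (ln (y + 8))"
proof -
  define H where "H x = ln (x + 8) * G (ln (x + 8))" for x
  have *: "H s * x \<le> H x * s" if "0 < x" "x \<le> s" for x s
  proof -
    define a b where ab: "a = ln (x + 8)" "b = ln (s + 8)"
    have a: "0 < a" "a \<le> b" using that by (auto simp: ab intro!: ln_gt_zero)
    have "(b * G b) * x * a = (b * x) * (G b * a)" by simp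
    also have "\<dots> \<le> (b * x) * (G a * b)" using a that by (intro mult_left_mono G_ratio) auto
    also have "\<dots> = G a * (b\<^sup>2 * x)" by (simp add: power2_eq_square)
    also have "\<dots> \<le> G a * (a\<^sup>2 * s)"
      using ln_sq_ratio_antimono[OF that] G_ge_1[OF a(1)] by (intro mult_left_mono) (auto simp: ab)
    also have "\<dots> = (a * G a) * s * a" by (simp add: power2_eq_square)
    finally have "(b * G b) * x * a \<le> (a * G a) * s * a" .
    then have "(b * G b) * x \<le> (a * G a) * s" using a(1) by (rule mult_right_le_imp_le)
    then show ?thesis unfolding H_def ab[symmetric] .
  qed
  have "H (x + y) * (x + y) = H (x + y) * x + H (x + y) * y" by (simp add: algebra_simps)
  also have "\<dots> \<le> H x * (x + y) + H y * (x + y)" using assms by (intro add_mono *) auto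
  also have "\<dots> = (H x + H y) * (x + y)" by (simp add: algebra_simps)
  finally have "H (x + y) \<le> H x + H y" using assms by simp
  then show ?thesis by (simp add: H_def)
qed

lemma weight_v_antimono: "n \<le> m \<Longrightarrow> weight_v \<omega> m \<le> weight_v \<omega> n"
proof (cases "0 \<le> m")
  case True
  then show ?thesis using weight_v_ge_1[of n] by (simp add: weight_v_def)
next
  case False
  assume nm: "n \<le> m"
  define x y where xy: "x = ln (10 * \<bar>real_of_int m\<bar> + 8)" "y = ln (10 * \<bar>real_of_int n\<bar> + 8)"
  have p: "0 < x" by (auto simp: xy intro!: ln_gt_zero)
  have le: "x \<le> y" using False nm by (auto simp: xy)
  have "x * G x \<le> y * G y" using p le G_mono[OF p le] G_ge_1[OF p] by (intro mult_mono) auto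
  then show ?thesis using False nm by (simp add: weight_v_neg xy)
qed

lemma weight_v_submult: "weight_v \<omega> (n + m) \<le> weight_v \<omega> n * weight_v \<omega> m"
proof -
  have *: "weight_v \<omega> (n + m) \<le> weight_v \<omega> n * weight_v \<omega> m" if "0 \<le> m" for n m
  proof -
    have "weight_v \<omega> (n + m) \<le> weight_v \<omega> n" using that by (intro weight_v_antimono) simp
    then show ?thesis using that by (simp add: weight_v_def)
  qed
  consider "0 \<le> m" | "0 \<le> n" | "n < 0" "m < 0" by linarith
  then show ?thesis
  proof cases
    case 1 then show ?thesis by (rule *)
  next
    case 2 then show ?thesis using *[of n m] by (simp add: add.commute mult.commute)
  next
    case 3
    then show ?thesis
      using scaled_subadditive[of "10 * \<bar>real_of_int n\<bar>" "10 * \<bar>real_of_int m\<bar>"]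
      by (simp add: weight_v_neg exp_add[symmetric] algebra_simps)
  qed
qed

lemma weight_u_pos: "0 < weight_u \<omega> n"
  by (auto simp: weight_u_def)

lemma weight_u_le_v: "weight_u \<omega> n \<le> weight_v \<omega> n"
proof (cases "0 \<le> n")
  case True
  have "(1 + real_of_int n) powr (- 1 / 3) \<le> (1 + real_of_int n) powr 0" using True by (intro powr_mono) auto
  then show ?thesis using True by (simp add: weight_u_def weight_v_def)
next
  case False
  have "1 * exp (\<omega> (ln (10 * \<bar>of_int n\<bar> + 8))) \<le> (10 * \<bar>of_int n\<bar> + 8) * exp (\<omega> (ln (10 * \<bar>of_int n\<bar> + 8)))"
    by (intro mult_right_mono) auto
  then show ?thesis using False by (simp add: weight_u_def weight_v_def)
qed

text \<open>If n >= -D/2, then n + m >= D/2 and the decay of \<open>weight_u\<close> itself gives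
  \<open>\<kappa>\<close>. If n < -D/2, no decay is left, but the linear factor in
  \<open>weight_v\<close> is at least D/2 >= 1/\<kappa>. Frequencies m < D gain nothing, which the
  division by \<open>\<kappa>\<close> records.\<close>

lemma weight_u_shift_le:
  fixes D :: int
  assumes D: "2 \<le> D"
  defines "\<kappa> \<equiv> (of_int D / 2) powr (- 1 / 3)"
  shows "weight_u \<omega> (n + m) \<le> \<kappa> * (weight_v \<omega> n * (if D \<le> m then 1 else weight_v \<omega> m / \<kappa>))"
proof (cases "D \<le> m")
  case False
  have "0 < \<kappa>" using D by (simp add: \<kappa>_def)
  then show ?thesis using False order_trans[OF weight_u_le_v weight_v_submult] by simp
next
  case True
  have x1: "1 \<le> real_of_int D / 2" using D by simp
  have "weight_u \<omega> (n + m) \<le> \<kappa> * weight_v \<omega> n"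
  proof (cases "- D \<le> 2 * n")
    case T2: True
    have nm: "real_of_int D / 2 \<le> 1 + real_of_int (n + m)" "0 \<le> n + m" using T2 True D by linarith+
    have "weight_u \<omega> (n + m) \<le> \<kappa>"
      using nm x1 unfolding weight_u_def \<kappa>_def by (auto intro!: powr_mono2')
    also have "\<dots> \<le> \<kappa> * weight_v \<omega> n" using weight_v_ge_1[of n] mult_left_mono[of 1 "weight_v \<omega> n" \<kappa>] by (simp add: \<kappa>_def)
    finally show ?thesis .
  next
    case F2: False
    then have n: "n < 0" "real_of_int D / 2 \<le> \<bar>real_of_int n\<bar>" using D by linarith+
    let ?e = "exp (\<omega> (ln (10 * \<bar>real_of_int n\<bar> + 8)))"
    have lnpos: "0 < ln (10 * \<bar>real_of_int k\<bar> + 8)" for k by (auto intro!: ln_gt_zero)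
    have e1: "1 \<le> ?e" using pos lnpos[of n] by (auto intro: order_less_imp_le)
    have u: "weight_u \<omega> (n + m) \<le> ?e"
    proof (cases "0 \<le> n + m")
      case True
      have "weight_u \<omega> (n + m) \<le> weight_v \<omega> (n + m)" by (rule weight_u_le_v)
      also have "\<dots> = 1" using True by (simp add: weight_v_def)
      finally show ?thesis using e1 by (rule order_trans)
    next
      case False
      have "\<omega> (ln (10 * \<bar>real_of_int (n + m)\<bar> + 8)) \<le> \<omega> (ln (10 * \<bar>real_of_int n\<bar> + 8))"
        using False \<open>D \<le> m\<close> D by (intro \<omega>_mono lnpos) auto
      then show ?thesis using False by (simp add: weight_u_def)
    qed
    have "(real_of_int D / 2) powr (-1) \<le> \<kappa>" unfolding \<kappa>_def using x1 by (intro powr_mono) auto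
    then have k: "1 \<le> \<kappa> * (real_of_int D / 2)" using x1 by (simp add: powr_minus_divide field_simps)
    have "?e \<le> (\<kappa> * (real_of_int D / 2)) * ?e" using mult_right_mono[OF k, of ?e] by simp
    also have "\<dots> \<le> (\<kappa> * (10 * \<bar>real_of_int n\<bar> + 8)) * ?e"
      using n by (intro mult_right_mono mult_left_mono) (auto simp: \<kappa>_def)
    also have "\<dots> = \<kappa> * weight_v \<omega> n" using n by (simp add: weight_v_def)
    finally show ?thesis using u by linarith
  qed
  then show ?thesis using True by simp
qed

text \<open>The logarithm of the frequency is at most L + x with L = ln D and x = ln |m| + 3, since
  ln 18 <= 3. When x <= L, the decrease of G(t)/t gives G(L + x) <= 2 G(L). Otherwise (L + x) G(L +
  x) is at most 4 G(1) x^2, and x <= 8 |m|^(1/8). The resulting |m|^(1/4) is of lower order than the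
  square root in the bump weight and can be absorbed by it.\<close>

lemma weight_v_growth:
  fixes D m :: int
  assumes D: "3 \<le> D" and m: "m < 0"
  shows "weight_v \<omega> (D * m) \<le> exp (4 * G (ln D) * ln D + 256 * G 1 * sqrt (sqrt \<bar>of_int m\<bar>))"
proof -
  define L where "L = ln (real_of_int D)"
  define k where "k = \<bar>real_of_int m\<bar>"
  define x where "x = ln k + 3"
  define T where "T = ln (10 * \<bar>real_of_int (D * m)\<bar> + 8)"
  have k: "1 \<le> k" using m by (simp add: k_def)
  have "exp 1 \<le> (3::real)" by (rule exp_le)
  then have L: "1 \<le> L" using D unfolding L_def by (subst ln_ge_iff) auto
  have x: "3 \<le> x" using k by (simp add: x_def)
  have Dk: "\<bar>real_of_int (D * m)\<bar> = real_of_int D * k" using D by (simp add: k_def abs_mult)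
  have Dk1: "1 \<le> real_of_int D * k" using D k mult_mono[of 1 "real_of_int D" 1 k] by simp
  have T0: "0 < T" unfolding T_def by (auto intro!: ln_gt_zero)
  have "exp (3::real) \<ge> 18"
  proof -
    have "(18::real) \<le> (2.7) ^ 3" by (simp add: power3_eq_cube)
    also have "\<dots> \<le> exp 1 ^ 3" using e_approx_32 by (intro power_mono) (auto simp: abs_if split: if_splits)
    also have "\<dots> = exp (3::real)" by (simp add: exp_of_nat_mult[symmetric])
    finally show ?thesis .
  qed
  then have ln18: "ln (18::real) \<le> 3" by (simp add: ln_le_cancel_iff[symmetric] del: ln_le_cancel_iff)
  have "T \<le> ln (18 * (real_of_int D * k))"
    unfolding T_def Dk using Dk1 by (subst ln_le_cancel_iff) linarith+
  also have "\<dots> = ln 18 + L + ln k" using D k by (simp add: ln_mult L_def)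
  also have "\<dots> \<le> L + x" using ln18 by (simp add: x_def)
  finally have T: "T \<le> L + x" .
  have TG: "T * G T \<le> (L + x) * G (L + x)"
    using T T0 G_mono[OF T0 T] G_ge_1[OF T0] by (intro mult_mono) auto
  have x2: "x\<^sup>2 \<le> 64 * sqrt (sqrt k)"
  proof -
    define z where "z = k powr (1/8)"
    have z: "1 \<le> z" unfolding z_def using k by (simp add: ge_one_powr_ge_zero)
    have "ln k = 8 * ln z" using k by (simp add: z_def ln_powr)
    also have "\<dots> \<le> 8 * (z - 1)" using z by (intro mult_left_mono ln_le_minus_one) auto
    finally have "x \<le> 8 * z" by (simp add: x_def)
    then have "x\<^sup>2 \<le> (8 * z)\<^sup>2" using x by (intro power_mono) auto
    also have "\<dots> = 64 * z\<^sup>2" by (simp add: power_mult_distrib)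
    also have "z\<^sup>2 = sqrt (sqrt k)"
    proof -
      have "sqrt (sqrt k) = (k powr (1/2)) powr (1/2)" using k by (simp add: powr_half_sqrt)
      then show ?thesis using k by (simp add: powr_powr z_def powr_power)
    qed
    finally show ?thesis .
  qed
  have G1: "1 \<le> G 1" by (rule G_ge_1) simp
  have "(L + x) * G (L + x) \<le> 4 * G L * L + 256 * G 1 * sqrt (sqrt k)"
  proof (cases "x \<le> L")
    case True
    have "G (L + x) * L \<le> G L * (L + x)" using L x by (intro G_ratio) auto
    also have "\<dots> \<le> G L * (2 * L)" using True G_ge_1[of L] L by (intro mult_left_mono) auto
    finally have "G (L + x) \<le> 2 * G L" using L by (simp add: mult.commute)
    then have "(L + x) * G (L + x) \<le> (2 * L) * (2 * G L)"
      using True L x G_ge_1[of "L + x"] by (intro mult_mono) auto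
    moreover have "(2 * L) * (2 * G L) = 4 * G L * L" by simp
    moreover have "0 \<le> 256 * G 1 * sqrt (sqrt k)" using G1 k by simp
    ultimately show ?thesis by linarith
  next
    case False
    have "G (2 * x) * 1 \<le> G 1 * (2 * x)" using x by (intro G_ratio) auto
    moreover have "G (L + x) \<le> G (2 * x)" using False L x by (intro G_mono) auto
    ultimately have "G (L + x) \<le> G 1 * (2 * x)" by simp
    then have "(L + x) * G (L + x) \<le> (2 * x) * (G 1 * (2 * x))"
      using False L x G_ge_1[of "L + x"] by (intro mult_mono) auto
    also have "\<dots> = 4 * G 1 * x\<^sup>2" by (simp add: power2_eq_square)
    also have "\<dots> \<le> 4 * G 1 * (64 * sqrt (sqrt k))" using x2 G1 by (intro mult_left_mono) auto
    finally have "(L + x) * G (L + x) \<le> 256 * G 1 * sqrt (sqrt k)" by simp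
    moreover have "0 \<le> 4 * G L * L" using L G_ge_1[of L] by simp
    ultimately show ?thesis by linarith
  qed
  then have "T * G T \<le> 4 * G L * L + 256 * G 1 * sqrt (sqrt k)" using TG by linarith
  moreover have "D * m < 0" using D m by (simp add: mult_pos_neg)
  ultimately show ?thesis by (simp add: weight_v_neg T_def L_def k_def)
qed

end

section \<open>One level of the construction\<close>

context concave_ratio
begin

text \<open>The norm of \<open>S\<close> controls the products, that of \<open>S - 1\<close> their
  increments. The second weight is the partner of \<open>weight_v\<close> in
  \<open>weight_u_shift_le\<close>: for frequencies below \<open>D\<close> it includes a factor of
  order D^(1/3), which only the tiny correction has to pay, since the nonconstant analytic part
  starts at frequency \<open>D\<close>.\<close>

lemma level_block:
  obtains c :: real and D0 :: int where "0 < c" "c \<le> 1" "3 \<le> D0"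
    "\<And>D. D0 \<le> D \<Longrightarrow> \<exists>S. (\<forall>t l. \<bar>of_int D * t + 2 * pi * of_int l\<bar> \<le> c / G (ln D) \<longrightarrow> S t = 0) \<and>
        weighted_fourier (weight_v \<omega>) (of_int D powr (1/8)) S \<and>
        weighted_fourier (\<lambda>m. if D \<le> m then 1 else weight_v \<omega> m / (of_int D / 2) powr (- 1 / 3)) (2 * of_int D powr (1/12)) (\<lambda>t. S t - 1)"
proof -
  obtain C :: real where C: "1 \<le> C"
    "\<And>\<eta> \<epsilon> M. 0 < \<eta> \<Longrightarrow> \<eta> \<le> 1 / 2 \<Longrightarrow> 0 < \<epsilon> \<Longrightarrow> \<epsilon> \<le> \<eta> \<Longrightarrow>
       \<exists>Y. weighted_fourier (\<lambda>m. exp (sqrt (\<epsilon> * \<bar>of_int m\<bar>) / 5)) ((C * \<epsilon> / \<eta>) ^ M) Y \<and>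
         (\<forall>t l. \<bar>t + 2 * pi * of_int l\<bar> \<le> \<epsilon> \<longrightarrow> Y t = ((1 - cis t) / (1 - of_real (1 - \<eta>) * cis t)) ^ M)"
    by (rule outer_power_match) blast
  \<comment> \<open>Chosen so that \<open>C * \<epsilon> / \<eta>\<close> equals 1/3 for \<epsilon>
    = c/Q and \<eta> = 1/(336 Q). Here 336 = 14 * 24, so that M <= 7 Q L yields 2 \<eta> M <=
    L/24.\<close>
  define c where "c = 1 / (3 * C) / 336"
  define P where "P = 256 * G 1"
  have G1: "1 \<le> G 1" by (rule G_ge_1) simp
  have c: "0 < c" "c \<le> 1" using C(1) by (auto simp: c_def field_simps)
  have "eventually (\<lambda>x. K * ln x \<le> x powr (1/24)) at_top" if "0 < K" for K :: real using that by real_asymp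
  from this[of "672 * G 1"] have "eventually (\<lambda>x. 672 * G 1 * ln x \<le> x powr (1/24)) at_top" using G1 by simp
  moreover have "eventually (\<lambda>x::real. 2 + x powr (1/12) \<le> x powr (1/8)) at_top" by real_asymp
  moreover have "eventually (\<lambda>x. P\<^sup>2 * 5 / 4 / sqrt c \<le> ln x) at_top"
    using ln_at_top unfolding filterlim_at_top by blast
  ultimately have "eventually (\<lambda>x. 672 * G 1 * ln x \<le> x powr (1/24) \<and> 2 + x powr (1/12) \<le> x powr (1/8) \<and> P\<^sup>2 * 5 / 4 / sqrt c \<le> ln x) at_top"
    by (intro eventually_conj)
  then obtain x0 where x0: "\<And>x. x0 \<le> x \<Longrightarrow> 672 * G 1 * ln x \<le> x powr (1/24) \<and> 2 + x powr (1/12) \<le> x powr (1/8) \<and> P\<^sup>2 * 5 / 4 / sqrt c \<le> ln x"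
    unfolding eventually_at_top_linorder by blast
  define D0 where "D0 = max 3 \<lceil>x0\<rceil>"
  show ?thesis
  proof (rule that)
    show "0 < c" "c \<le> 1" by fact+
    show "3 \<le> D0" by (simp add: D0_def)
    fix D assume D0: "D0 \<le> D"
    define x where "x = real_of_int D"
    define L where "L = ln x"
    define Q where "Q = G L"
    define \<eta> where "\<eta> = 1 / 336 / Q"
    define \<epsilon> where "\<epsilon> = c / Q"
    define M where "M = nat \<lceil>6 * Q * L\<rceil>"
    define \<kappa> where "\<kappa> = (x / 2) powr (- 1 / 3)"
    define w2 where "w2 m = (if D \<le> m then 1 else weight_v \<omega> m / \<kappa>)" for m
    have D3: "3 \<le> D" using D0 by (simp add: D0_def)
    have x3: "3 \<le> x" using D3 by (simp add: x_def)
    have "x0 \<le> x" using D0 unfolding D0_def x_def by linarith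
    note big = x0[OF this, folded L_def]
    have "exp 1 \<le> (3::real)" by (rule exp_le)
    then have L1: "1 \<le> L" using x3 unfolding L_def by (subst ln_ge_iff) auto
    have Q1: "1 \<le> Q" unfolding Q_def using L1 by (intro G_ge_1) auto
    have QL: "Q \<le> G 1 * L" using G_ratio[of 1 L] L1 by (simp add: Q_def)
    have QL1: "1 \<le> Q * L" using mult_mono[OF Q1 L1] L1 Q1 by simp
    have \<eta>: "0 < \<eta>" "\<eta> \<le> 1 / 2" using Q1 by (auto simp: \<eta>_def field_simps)
    have \<epsilon>\<eta>: "C * \<epsilon> / \<eta> = 1 / 3" using C(1) Q1 by (simp add: \<epsilon>_def \<eta>_def c_def field_simps)
    have \<epsilon>: "0 < \<epsilon>" "\<epsilon> \<le> \<eta>"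
    proof -
      show "0 < \<epsilon>" using c Q1 by (simp add: \<epsilon>_def)
      have "c \<le> 1 / 336" using C(1) by (simp add: c_def field_simps)
      then show "\<epsilon> \<le> \<eta>" unfolding \<epsilon>_def \<eta>_def using Q1 by (intro divide_right_mono) auto
    qed
    have M: "6 * Q * L \<le> real M" "real M \<le> 7 * (Q * L)"
    proof -
      show "6 * Q * L \<le> real M" unfolding M_def by linarith
      have "0 \<le> 6 * Q * L" using Q1 L1 by simp
      then have "real M \<le> 6 * Q * L + 1" unfolding M_def by linarith
      then show "real M \<le> 7 * (Q * L)" using QL1 by linarith
    qed
    have \<kappa>0: "0 < \<kappa>" using x3 by (simp add: \<kappa>_def)
    have \<kappa>1: "1 / \<kappa> \<le> x"
    proof -
      have "1 / \<kappa> = (x / 2) powr (1 / 3)" using x3 by (simp add: \<kappa>_def powr_minus_divide)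
      also have "\<dots> \<le> (x / 2) powr 1" using x3 by (intro powr_mono) auto
      also have "\<dots> \<le> x" using x3 by simp
      finally show ?thesis .
    qed
    have \<kappa>le: "\<kappa> \<le> 1" using x3 powr_mono[of "- 1/3" 0 "x / 2"] by (simp add: \<kappa>_def)
    let ?A = "\<lambda>t. ((1 - cis t) / (1 - of_real (1 - \<eta>) * cis t)) ^ M"
    obtain Y where Y: "weighted_fourier (\<lambda>m. exp (sqrt (\<epsilon> * \<bar>of_int m\<bar>) / 5)) ((1 / 3) ^ M) Y"
      "\<And>t l. \<bar>t + 2 * pi * of_int l\<bar> \<le> \<epsilon> \<Longrightarrow> Y t = ?A t"
      using C(2)[OF \<eta> \<epsilon>, of M] unfolding \<epsilon>\<eta> by blast
    have growth: "weight_v \<omega> (D * m) \<le> exp (5 * (Q * L)) * exp (sqrt (\<epsilon> * \<bar>of_int m\<bar>) / 5)" for m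
    proof (cases "0 \<le> m")
      case True
      then have "weight_v \<omega> (D * m) = 1" using D3 by (simp add: weight_v_def)
      moreover have "1 \<le> exp (5 * (Q * L))" "1 \<le> exp (sqrt (\<epsilon> * \<bar>of_int m\<bar>) / 5)" using QL1 \<epsilon> by auto
      then have "1 * 1 \<le> exp (5 * (Q * L)) * exp (sqrt (\<epsilon> * \<bar>of_int m\<bar>) / 5)" by (intro mult_mono) auto
      ultimately show ?thesis by simp
    next
      case False
      define y where "y = sqrt (sqrt \<bar>real_of_int m\<bar>)"
      have y: "y\<^sup>2 = sqrt \<bar>real_of_int m\<bar>" "0 \<le> y" by (auto simp: y_def)
      define s where "s = sqrt \<epsilon>"
      have s: "0 < s" using \<epsilon> by (simp add: s_def)
      have sq: "sqrt (\<epsilon> * \<bar>of_int m\<bar>) = s * y\<^sup>2" unfolding y(1) s_def by (simp add: real_sqrt_mult)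
      \<comment> \<open>Completing the square absorbs \<open>P * y\<close>, with y = |m|^(1/4), into
        the bump weight, whose exponent is s y^2 / 5. The remaining constant is of order Q and is at
        most Q L once ln D is large; this turns 4 Q L into 5 Q L.\<close>
      have "s * y\<^sup>2 / 5 + P\<^sup>2 * 5 / 4 / s - P * y = (s * y / 5 * 2 - P)\<^sup>2 * (5 / (4 * s))"
        using s by (simp add: power2_eq_square field_simps)
      also have "\<dots> \<ge> 0" using s by (intro mult_nonneg_nonneg) auto
      finally have 1: "P * y \<le> s * y\<^sup>2 / 5 + P\<^sup>2 * 5 / 4 / s" by simp
      have "1 / s = sqrt Q / sqrt c" by (simp add: s_def \<epsilon>_def real_sqrt_divide)
      also have "\<dots> \<le> Q / sqrt c"
      proof (rule divide_right_mono)
        show "sqrt Q \<le> Q" using Q1 real_sqrt_le_mono[of Q "Q\<^sup>2"] mult_left_mono[OF Q1, of Q] by (simp add: power2_eq_square)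
      qed (use c in simp)
      finally have "P\<^sup>2 * 5 / 4 * (1 / s) \<le> P\<^sup>2 * 5 / 4 * (Q / sqrt c)" by (intro mult_left_mono) auto
      also have "\<dots> = Q * (P\<^sup>2 * 5 / 4 / sqrt c)" by simp
      also have "\<dots> \<le> Q * L" using big Q1 by (intro mult_left_mono) auto
      finally have 2: "P\<^sup>2 * 5 / 4 / s \<le> Q * L" by simp
      have "weight_v \<omega> (D * m) \<le> exp (4 * G (ln D) * ln D + 256 * G 1 * sqrt (sqrt \<bar>of_int m\<bar>))"
        using False by (intro weight_v_growth D3) simp
      also have "\<dots> = exp (4 * (Q * L) + P * y)" by (simp add: Q_def L_def x_def P_def y_def)
      also have "\<dots> \<le> exp (5 * (Q * L) + s * y\<^sup>2 / 5)"
        unfolding exp_le_cancel_iff using 1 2 by linarith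
      also have "\<dots> = exp (5 * (Q * L)) * exp (sqrt (\<epsilon> * \<bar>of_int m\<bar>) / 5)" unfolding sq by (simp add: exp_add)
      finally show ?thesis .
    qed
    have v0: "0 \<le> weight_v \<omega> n" for n using weight_v_ge_1[of n] by linarith
    \<comment> \<open>With M >= 6 Q L the power 3^(-M) beats the weight growth e^(5 Q L) with e^(-Q
      L) to spare, and this is at most 1/D.\<close>
    have YB: "exp (5 * (Q * L)) * (1 / 3) ^ M \<le> 1 / x"
    proof -
      have "(1 / 3 :: real) \<le> exp (- 1)" using exp_le by (simp add: exp_minus field_simps)
      then have "(1 / 3 :: real) ^ M \<le> exp (- 1) ^ M" by (intro power_mono) auto
      also have "\<dots> = exp (- real M)" by (simp add: exp_of_nat_mult[symmetric])
      also have "\<dots> \<le> exp (- (6 * (Q * L)))" using M by simp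
      finally have "exp (5 * (Q * L)) * (1 / 3) ^ M \<le> exp (5 * (Q * L)) * exp (- (6 * (Q * L)))" by (intro mult_left_mono) auto
      also have "\<dots> = exp (- (Q * L))" by (simp add: exp_add[symmetric])
      also have "\<dots> \<le> exp (- L)" using mult_right_mono[OF Q1, of L] L1 by simp
      also have "\<dots> = 1 / x" using x3 by (simp add: L_def exp_minus inverse_eq_divide)
      finally show ?thesis .
    qed
    have "weighted_fourier (\<lambda>m. weight_v \<omega> (D * m)) (1 / x) Y"
      by (rule weighted_fourier_mono[OF Y(1) _ growth _ YB]) (use v0 in auto)
    then have YD: "weighted_fourier (weight_v \<omega>) (1 / x) (\<lambda>t. Y (of_int D * t))"
      by (rule weighted_fourier_dilate) (use D3 in simp)
    \<comment> \<open>Half of the exponent 1/12 pays for e^(2 \<eta> M), the other half for 2/\<eta>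
      = 672 Q, which is only logarithmic in D.\<close>
    have AB: "2 * exp (2 * \<eta> * M) / \<eta> \<le> x powr (1/12)"
    proof -
      have "2 * \<eta> * M \<le> 2 * \<eta> * (7 * (Q * L))" using M \<eta> by (intro mult_left_mono) auto
      also have "\<dots> = L / 24" using Q1 by (simp add: \<eta>_def field_simps)
      finally have "exp (2 * \<eta> * M) \<le> exp (L / 24)" by simp
      also have "\<dots> = x powr (1/24)" using x3 by (simp add: powr_def L_def)
      finally have 1: "exp (2 * \<eta> * M) \<le> x powr (1/24)" .
      have "2 / \<eta> = 672 * Q" by (simp add: \<eta>_def)
      also have "\<dots> \<le> 672 * (G 1 * L)" using QL by simp
      also have "\<dots> \<le> x powr (1/24)" using big by simp
      finally have 2: "2 / \<eta> \<le> x powr (1/24)" .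
      have "2 * exp (2 * \<eta> * M) / \<eta> = (2 / \<eta>) * exp (2 * \<eta> * M)" by simp
      also have "\<dots> \<le> x powr (1/24) * x powr (1/24)" using 1 2 \<eta> by (intro mult_mono) auto
      also have "\<dots> = x powr (1/12)" by (simp add: powr_add[symmetric])
      finally show ?thesis .
    qed
    have AD: "weighted_fourier w (x powr (1/12)) (\<lambda>t. ?A (of_int D * t) - 1)" if w: "\<And>n. 0 \<le> w n" "\<And>n. D \<le> n \<Longrightarrow> w n \<le> 1" for w
    proof -
      have "weighted_fourier (\<lambda>m. w (D * m)) (2 * exp (2 * \<eta> * M) / \<eta>) (\<lambda>t. ?A t - 1)"
      proof (rule outer_power_weighted_fourier[OF \<eta>])
        fix n :: int assume "1 \<le> n"
        then have "D * 1 \<le> D * n" using D3 by (intro mult_left_mono) auto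
        then show "w (D * n) \<le> 1" by (intro w) simp
      qed (use w in auto)
      then have "weighted_fourier (\<lambda>m. w (D * m)) (x powr (1/12)) (\<lambda>t. ?A t - 1)"
        by (rule weighted_fourier_mono[where K = 1]) (use w AB in auto)
      then show ?thesis by (rule weighted_fourier_dilate) (use D3 in simp)
    qed
    define S where "S t = ?A (of_int D * t) - Y (of_int D * t)" for t
    have vD1: "weighted_fourier (weight_v \<omega>) (x powr (1/12)) (\<lambda>t. ?A (of_int D * t) - 1)"
      by (rule AD) (use v0 D3 in \<open>auto simp: weight_v_def\<close>)
    have v1: "weighted_fourier (weight_v \<omega>) 1 (\<lambda>t. 1)"
      using weighted_fourier_monomial[of "weight_v \<omega>" 1 0] by (simp add: weight_v_def)
    have nY: "weighted_fourier (weight_v \<omega>) (1 / x) (\<lambda>t. - Y (of_int D * t))"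
      by (rule weighted_fourier_uminus[OF YD])
    have S1: "weighted_fourier (weight_v \<omega>) (1 + (x powr (1/12) + 1 / x)) (\<lambda>t. 1 + ((?A (of_int D * t) - 1) + - Y (of_int D * t)))"
      by (intro weighted_fourier_add v1 vD1 nY v0)
    have vS: "weighted_fourier (weight_v \<omega>) (x powr (1/8)) (\<lambda>t. 1 + ((?A (of_int D * t) - 1) + - Y (of_int D * t)))"
    proof (rule weighted_fourier_mono[OF S1, where K = 1])
      have "1 / x \<le> 1" using x3 by simp
      moreover have "1 * (1 + (p + y)) \<le> q" if "y \<le> 1" "2 + p \<le> q" for y p q :: real using that by simp
      ultimately show "1 * (1 + (x powr (1/12) + 1 / x)) \<le> x powr (1/8)" using big by blast
    qed (use v0 in auto)
    have w20: "0 \<le> w2 n" for n using v0 \<kappa>0 by (simp add: w2_def)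
    have w2D: "weighted_fourier w2 (x powr (1/12)) (\<lambda>t. ?A (of_int D * t) - 1)"
      by (rule AD) (use w20 in \<open>auto simp: w2_def\<close>)
    have w2v: "w2 n \<le> 1 / \<kappa> * weight_v \<omega> n" for n
      using \<kappa>0 \<kappa>le weight_v_ge_1[of n] by (auto simp: w2_def field_simps)
    \<comment> \<open>The penalty \<open>1 / \<kappa>\<close> on low frequencies is at most
      \<open>x\<close>, and the norm 1/x of the correction pays for it.\<close>
    have w2Y: "weighted_fourier w2 1 (\<lambda>t. - Y (of_int D * t))"
    proof (rule weighted_fourier_mono[OF nY w20 w2v])
      have "1 / \<kappa> * (1 / x) \<le> x * (1 / x)" using \<kappa>1 x3 by (intro mult_right_mono) auto
      then show "1 / \<kappa> * (1 / x) \<le> 1" using x3 by simp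
    qed (use \<kappa>0 in simp)
    have S2: "weighted_fourier w2 (x powr (1/12) + 1) (\<lambda>t. (?A (of_int D * t) - 1) + - Y (of_int D * t))"
      by (intro weighted_fourier_add w2D w2Y w20)
    have w2S: "weighted_fourier w2 (2 * x powr (1/12)) (\<lambda>t. (?A (of_int D * t) - 1) + - Y (of_int D * t))"
    proof (rule weighted_fourier_mono[OF S2, where K = 1])
      have "1 \<le> x powr (1/12)" using x3 by (intro ge_one_powr_ge_zero) auto
      then show "1 * (x powr (1/12) + 1) \<le> 2 * x powr (1/12)" by simp
    qed (use w20 in auto)
    have "\<forall>t l. \<bar>of_int D * t + 2 * pi * of_int l\<bar> \<le> c / G (ln D) \<longrightarrow> S t = 0"
      using Y(2) unfolding S_def \<epsilon>_def Q_def L_def x_def by simp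
    moreover have "weighted_fourier (weight_v \<omega>) (of_int D powr (1/8)) S"
    proof -
      have "S = (\<lambda>t. 1 + ((?A (of_int D * t) - 1) + - Y (of_int D * t)))" by (rule ext) (simp add: S_def)
      then show ?thesis using vS by (simp only: x_def)
    qed
    moreover have "weighted_fourier (\<lambda>m. if D \<le> m then 1 else weight_v \<omega> m / (of_int D / 2) powr (- 1 / 3)) (2 * of_int D powr (1/12)) (\<lambda>t. S t - 1)"
    proof -
      have "(\<lambda>t. S t - 1) = (\<lambda>t. (?A (of_int D * t) - 1) + - Y (of_int D * t))" by (rule ext) (simp add: S_def)
      then show ?thesis using w2S unfolding w2_def[abs_def] \<kappa>_def by (simp only: x_def)
    qed
    ultimately show "\<exists>S. (\<forall>t l. \<bar>of_int D * t + 2 * pi * of_int l\<bar> \<le> c / G (ln D) \<longrightarrow> S t = 0) \<and>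
        weighted_fourier (weight_v \<omega>) (of_int D powr (1/8)) S \<and>
        weighted_fourier (\<lambda>m. if D \<le> m then 1 else weight_v \<omega> m / (of_int D / 2) powr (- 1 / 3)) (2 * of_int D powr (1/12)) (\<lambda>t. S t - 1)"
      by blast
  qed
qed
end

section \<open>Composition with a Moebius transformation\<close>

text \<open>A lift to the real line of the action of z -> (2 z - 1)/(2 - z) on the unit circle. The
  denominator 2 - cos s never vanishes, so the arctangent needs no choice of branch and the lift is
  smooth and odd.\<close>

definition moebius_arg :: "real \<Rightarrow> real" where
  "moebius_arg s = s + 2 * arctan (sin s / (2 - cos s))"

lemma two_minus_cos_pos: "0 < 2 - cos (s::real)"
  using cos_le_one[of s] by linarith

lemma five_minus_cos_pos: "1 \<le> 5 - 4 * cos (s::real)" "5 - 4 * cos s \<le> 9"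
  using cos_le_one[of s] cos_ge_minus_one[of s] by linarith+

text \<open>The derivative is the Poisson kernel of radius 1/2: it lies between 1/3 and 3 and
  decreases on [0, pi].\<close>

lemma moebius_arg_deriv: "(moebius_arg has_real_derivative 3 / (5 - 4 * cos s)) (at s)"
proof -
  define c where "c = 2 - cos s"
  have c: "0 < c" unfolding c_def by (rule two_minus_cos_pos)
  have s2: "(sin s)\<^sup>2 = 1 - (cos s)\<^sup>2" by (simp add: sin_squared_eq)
  have 5: "c\<^sup>2 + (sin s)\<^sup>2 = 5 - 4 * cos s" unfolding s2 c_def by (simp add: power2_eq_square algebra_simps)
  have D: "(moebius_arg has_real_derivative 1 + 2 * (inverse (1 + (sin s / c)\<^sup>2) * ((cos s * c - sin s * sin s) / (c * c)))) (at s)"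
    unfolding moebius_arg_def[abs_def] c_def
    by (rule derivative_eq_intros DERIV_arctan refl | use c in \<open>simp add: c_def\<close>)+
  have "inverse (1 + (sin s / c)\<^sup>2) * ((cos s * c - sin s * sin s) / (c * c)) = (cos s * c - sin s * sin s) / (5 - 4 * cos s)"
  proof -
    have "1 + (sin s / c)\<^sup>2 = (5 - 4 * cos s) / c\<^sup>2" using c unfolding 5[symmetric] by (simp add: field_simps)
    then show ?thesis using c by (simp add: power2_eq_square)
  qed
  moreover have "cos s * c - sin s * sin s = 2 * cos s - 1"
    using s2 by (simp add: c_def power2_eq_square algebra_simps)
  ultimately have e: "inverse (1 + (sin s / c)\<^sup>2) * ((cos s * c - sin s * sin s) / (c * c)) = (2 * cos s - 1) / (5 - 4 * cos s)"
    by (simp only:)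
  have "1 + 2 * ((2 * cos s - 1) / (5 - 4 * cos s)) = 3 / (5 - 4 * cos s)"
  proof -
    have aux: "1 + 2 * ((2 * k - 1) / x) = 3 / x" if "x = 5 - 4 * k" "x \<noteq> 0" for x k :: real
      using that(2) by (simp add: divide_simps) (simp add: that(1))
    have "5 - 4 * cos s \<noteq> 0" using five_minus_cos_pos(1)[of s] by linarith
    from aux[OF refl this] show ?thesis .
  qed
  with D show ?thesis unfolding e by (simp only:)
qed

lemma cis_moebius_arg: "cis (moebius_arg s) = (2 * cis s - 1) / (2 - cis s)"
proof -
  define c where "c = 2 - cos s"
  define x where "x = sin s / c"
  have c: "0 < c" unfolding c_def by (rule two_minus_cos_pos)
  have nz: "(1 - \<i> * x) \<noteq> 0" by (simp add: complex_eq_iff)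
  have "cis (arctan x) = (1 + \<i> * x) / sqrt (1 + x\<^sup>2)"
    by (simp add: complex_eq_iff cos_arctan sin_arctan)
  then have "cis (2 * arctan x) = ((1 + \<i> * x) / sqrt (1 + x\<^sup>2))\<^sup>2"
    by (metis Complex.DeMoivre of_nat_numeral)
  also have "\<dots> = (1 + \<i> * x)\<^sup>2 / ((1 + \<i> * x) * (1 - \<i> * x))"
  proof -
    have "(complex_of_real (sqrt (1 + x\<^sup>2)))\<^sup>2 = of_real (1 + x\<^sup>2)" by (simp add: of_real_power[symmetric] del: of_real_power)
    also have "\<dots> = (1 + \<i> * x) * (1 - \<i> * x)" by (simp add: complex_eq_iff power2_eq_square)
    finally show ?thesis by (simp add: power_divide)
  qed
  also have "\<dots> = (1 + \<i> * x) / (1 - \<i> * x)"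
    using nz by (simp add: power2_eq_square divide_simps)
  also have "\<dots> = (of_real c * (1 + \<i> * x)) / (of_real c * (1 - \<i> * x))" using c by simp
  also have "of_real c * (1 + \<i> * x) = 2 - cis (- s)" using c by (simp add: complex_eq_iff x_def c_def)
  also have "of_real c * (1 - \<i> * x) = 2 - cis s" using c by (simp add: complex_eq_iff x_def c_def)
  finally have "cis (moebius_arg s) = cis s * ((2 - cis (- s)) / (2 - cis s))"
    by (simp add: moebius_arg_def x_def c_def cis_mult[symmetric])
  also have "\<dots> = (2 * cis s - 1) / (2 - cis s)" by (simp add: right_diff_distrib cis_mult)
  finally show ?thesis .
qed

lemma moebius_arg_minus: "moebius_arg (- s) = - moebius_arg s"
  by (simp add: moebius_arg_def arctan_minus)

lemma moebius_arg_shift: "moebius_arg (s + 2 * pi) = moebius_arg s + 2 * pi"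
  by (simp add: moebius_arg_def)

lemma continuous_on_moebius_arg [continuous_intros]:
  fixes f :: "real \<Rightarrow> real"
  shows "continuous_on A f \<Longrightarrow> continuous_on A (\<lambda>x. moebius_arg (f x))"
proof -
  assume f: "continuous_on A f"
  have "2 - cos (f x) \<noteq> 0" for x using two_minus_cos_pos[of "f x"] by simp
  then show ?thesis unfolding moebius_arg_def
    by (intro continuous_on_add continuous_on_mult continuous_on_const continuous_on_arctan continuous_on_divide
        continuous_on_diff continuous_on_sin continuous_on_cos f) auto
qed

section \<open>Oscillatory integrals with the Moebius phase\<close>

lemma sin_ge_quarter:
  fixes x :: real
  assumes "0 \<le> x" "x \<le> pi / 2"
  shows "x / 4 \<le> sin x"
proof (cases "x \<le> pi / 6")
  case True
  have "sin 0 - 0 / 4 \<le> sin x - x / 4"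
  proof (rule DERIV_nonneg_imp_nondecreasing[OF assms(1)])
    fix y assume y: "0 \<le> y" "y \<le> x"
    have "cos (pi / 3) \<le> cos y" using y True pi_gt_zero by (intro cos_monotone_0_pi_le) auto
    then have "0 \<le> cos y - 1 / 4" by (simp add: cos_60)
    moreover have "((\<lambda>y. sin y - y / 4) has_real_derivative cos y - 1 / 4) (at y)" by (auto intro!: derivative_eq_intros)
    ultimately show "\<exists>D. ((\<lambda>y. sin y - y / 4) has_real_derivative D) (at y) \<and> 0 \<le> D" by blast
  qed
  then show ?thesis by simp
next
  case False
  have "sin (pi / 6) \<le> sin x" using False assms by (intro sin_monotone_2pi_le) auto
  then have "1 / 2 \<le> sin x" by (simp add: sin_30)
  moreover have "x \<le> 2" using assms pi_half_less_two by simp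
  ultimately show ?thesis by simp
qed

text \<open>Integration by parts. The two boundary terms give 2/\<mu>; the remaining integrand has
  norm |\<phi>''|/(\<phi>')^2, which by the sign of \<phi>'' is the derivative of 1/\<phi>', so its
  integral is again at most 2/\<mu>.\<close>

lemma van_der_corput_first:
  fixes \<phi> \<phi>1 \<phi>2 :: "real \<Rightarrow> real"
  assumes ab: "a \<le> b"
    and d1: "\<And>s. (\<phi> has_real_derivative \<phi>1 s) (at s)" and d2: "\<And>s. (\<phi>1 has_real_derivative \<phi>2 s) (at s)"
    and le: "\<And>s. s \<in> {a..b} \<Longrightarrow> \<phi>2 s \<le> 0" and \<mu>: "0 < \<mu>" "\<And>s. s \<in> {a..b} \<Longrightarrow> \<mu> \<le> \<bar>\<phi>1 s\<bar>"
  shows "norm (integral {a..b} (\<lambda>s. cis (\<phi> s))) \<le> 4 / \<mu>"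
proof -
  define E where "E s = 1 / \<i> * (cis (\<phi> s) * complex_of_real (1 / \<phi>1 s))" for s
  define h where "h s = 1 / \<i> * (cis (\<phi> s) * complex_of_real (\<phi>2 s / (\<phi>1 s)\<^sup>2))" for s
  have nz: "\<phi>1 s \<noteq> 0" if "s \<in> {a..b}" for s using \<mu>(2)[OF that] \<mu>(1) by auto
  have c1: "continuous_on {a..b} \<phi>" using d1 by (meson DERIV_atLeastAtMost_imp_continuous_on)
  have cc: "(\<lambda>s. cis (\<phi> s)) integrable_on {a..b}"
    unfolding cis_conv_exp by (intro integrable_continuous_real continuous_intros c1)
  have dcis: "((\<lambda>s. cis (\<phi> s)) has_vector_derivative (\<i> * of_real (\<phi>1 s) * cis (\<phi> s))) (at s within {a..b})" for s
  proof -
    have "((\<lambda>s. exp (\<i> * of_real (\<phi> s))) has_vector_derivative (\<i> * of_real (\<phi>1 s) * exp (\<i> * of_real (\<phi> s)))) (at s within {a..b})"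
    proof -
      have "((\<lambda>x. \<i> * of_real (\<phi> x)) has_vector_derivative \<i> * of_real (\<phi>1 s)) (at s within {a..b})"
        using has_field_derivative_at_within[OF d1[of s], of "{a..b}"]
        by (intro has_vector_derivative_mult_right has_vector_derivative_of_real) (simp add: has_real_derivative_iff_has_vector_derivative)
      from field_vector_diff_chain_within[OF this, of exp "exp (\<i> * of_real (\<phi> s))"]
      show ?thesis by (simp add: o_def DERIV_exp has_field_derivative_at_within)
    qed
    then show ?thesis by (simp add: cis_conv_exp)
  qed
  have dinv: "((\<lambda>s. 1 / \<phi>1 s) has_real_derivative - \<phi>2 s / (\<phi>1 s)\<^sup>2) (at s within {a..b})" if "s \<in> {a..b}" for s
    using has_field_derivative_at_within[OF d2[of s], of "{a..b}"] nz[OF that]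
    by (auto intro!: derivative_eq_intros simp: power2_eq_square)
  have dE: "(E has_vector_derivative (cis (\<phi> s) - h s)) (at s within {a..b})" if s: "s \<in> {a..b}" for s
  proof -
    have "((\<lambda>s. complex_of_real (1 / \<phi>1 s)) has_vector_derivative of_real (- \<phi>2 s / (\<phi>1 s)\<^sup>2)) (at s within {a..b})"
      using dinv[OF s] by (intro has_vector_derivative_of_real) (simp add: has_real_derivative_iff_has_vector_derivative)
    from has_vector_derivative_mult[OF dcis this]
    have "((\<lambda>s. cis (\<phi> s) * complex_of_real (1 / \<phi>1 s)) has_vector_derivative
       (cis (\<phi> s) * of_real (- \<phi>2 s / (\<phi>1 s)\<^sup>2) + \<i> * of_real (\<phi>1 s) * cis (\<phi> s) * of_real (1 / \<phi>1 s))) (at s within {a..b})" .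
    from has_vector_derivative_mult_right[OF this, of "1 / \<i>"]
    have "((\<lambda>s. 1 / \<i> * (cis (\<phi> s) * complex_of_real (1 / \<phi>1 s))) has_vector_derivative
       1 / \<i> * (cis (\<phi> s) * of_real (- \<phi>2 s / (\<phi>1 s)\<^sup>2) + \<i> * of_real (\<phi>1 s) * cis (\<phi> s) * of_real (1 / \<phi>1 s))) (at s within {a..b})" .
    moreover have "(\<lambda>s. 1 / \<i> * (cis (\<phi> s) * complex_of_real (1 / \<phi>1 s))) = E" by (rule ext) (simp only: E_def)
    moreover have "1 / \<i> * (cis (\<phi> s) * of_real (- \<phi>2 s / (\<phi>1 s)\<^sup>2) + \<i> * of_real (\<phi>1 s) * cis (\<phi> s) * of_real (1 / \<phi>1 s)) = cis (\<phi> s) - h s"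
      using nz[OF s] by (simp add: h_def field_simps)
    ultimately show ?thesis by simp
  qed
  have i1: "((\<lambda>s. cis (\<phi> s) - h s) has_integral (E b - E a)) {a..b}"
    by (rule fundamental_theorem_of_calculus[OF ab dE])
  have i2: "((\<lambda>s. - \<phi>2 s / (\<phi>1 s)\<^sup>2) has_integral (1 / \<phi>1 b - 1 / \<phi>1 a)) {a..b}"
    by (rule fundamental_theorem_of_calculus[OF ab]) (use dinv in \<open>simp add: has_real_derivative_iff_has_vector_derivative\<close>)
  have hi: "h integrable_on {a..b}"
    using integrable_diff[OF cc has_integral_integrable[OF i1]] by simp
  have nh: "norm (integral {a..b} h) \<le> integral {a..b} (\<lambda>s. - \<phi>2 s / (\<phi>1 s)\<^sup>2)"
  proof (rule Henstock_Kurzweil_Integration.integral_norm_bound_integral[OF hi has_integral_integrable[OF i2]])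
    fix s assume "s \<in> {a..b}"
    then show "norm (h s) \<le> - \<phi>2 s / (\<phi>1 s)\<^sup>2" using le[of s] by (simp add: h_def norm_mult norm_divide norm_power)
  qed
  have iab: "\<bar>1 / \<phi>1 s\<bar> \<le> 1 / \<mu>" if "s \<in> {a..b}" for s
    using \<mu>(2)[OF that] \<mu>(1) by (simp add: abs_divide frac_le)
  have "integral {a..b} (\<lambda>s. cis (\<phi> s)) = (E b - E a) + integral {a..b} h"
    using integral_unique[OF i1] integral_diff[OF cc hi] by (simp add: diff_eq_eq)
  then have "norm (integral {a..b} (\<lambda>s. cis (\<phi> s))) \<le> (norm (E b) + norm (E a)) + norm (integral {a..b} h)"
    using order_trans[OF norm_triangle_ineq[of "E b - E a" "integral {a..b} h"] add_right_mono[OF norm_triangle_ineq4[of "E b" "E a"]]] by simp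
  also have "\<dots> \<le> (1 / \<mu> + 1 / \<mu>) + (1 / \<mu> + 1 / \<mu>)"
  proof (intro add_mono)
    have nE: "norm (E s) = \<bar>1 / \<phi>1 s\<bar>" for s by (simp add: E_def norm_divide norm_mult)
    show "norm (E b) \<le> 1 / \<mu>" "norm (E a) \<le> 1 / \<mu>" unfolding nE using ab iab[of a] iab[of b] by simp_all
    have "1 / \<phi>1 b \<le> 1 / \<mu>" "- (1 / \<phi>1 a) \<le> 1 / \<mu>"
      using iab[of a] iab[of b] ab by (simp_all only: abs_le_iff atLeastAtMost_iff order_refl simp_thms)
    from add_mono[OF this] show "norm (integral {a..b} h) \<le> 1 / \<mu> + 1 / \<mu>"
      using nh unfolding integral_unique[OF i2] by simp
  qed
  finally show ?thesis by simp
qed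

text \<open>The disjunctions cover the case that the level is not attained: then one of the two
  pieces degenerates to a point.\<close>

lemma antimono_split:
  fixes f :: "real \<Rightarrow> real"
  assumes "continuous_on {a..b} f" "a \<le> b" "\<And>x y. a \<le> x \<Longrightarrow> x \<le> y \<Longrightarrow> y \<le> b \<Longrightarrow> f y \<le> f x"
  obtains s where "a \<le> s" "s \<le> b" "s = a \<or> (\<forall>x\<in>{a..s}. \<mu> \<le> f x)" "s = b \<or> (\<forall>x\<in>{s..b}. f x \<le> \<mu>)"
proof -
  consider "\<mu> \<le> f b" | "f a \<le> \<mu>" | "f b \<le> \<mu>" "\<mu> \<le> f a" by linarith
  then show ?thesis
  proof cases
    case 1 then show ?thesis using that[of b] assms by (meson atLeastAtMost_iff order_refl order_trans)
  next
    case 2 then show ?thesis using that[of a] assms by (meson atLeastAtMost_iff order_refl order_trans)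
  next
    case 3
    then obtain s where s: "a \<le> s" "s \<le> b" "f s = \<mu>" using IVT2'[of f b \<mu> a] assms by auto
    then show ?thesis using that[of s] assms(3) by (metis atLeastAtMost_iff order_refl)
  qed
qed

text \<open>On [0, pi] the derivative of the phase decreases, so it lies in [-\<mu>, \<mu>] on a
  single interval, and the first derivative test handles both sides. The second derivative vanishes
  like sin s at the endpoints, so the length of the middle interval is only O(sqrt(\<mu>/n)).
  Balancing this with 1/\<mu> gives \<mu> = n^(1/3); the constants add up to 4 + 21 + 4.\<close>

lemma moebius_phase_integral_bound:
  fixes n :: nat and j :: real
  assumes n: "1 \<le> n"
  shows "norm (integral {0..pi} (\<lambda>s. cis (real n * moebius_arg s - j * s))) \<le> 29 * real n powr (- 1 / 3)"
proof -
  define \<mu> where "\<mu> = real n powr (1/3)"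
  define P where "P s = 3 / (5 - 4 * cos s)" for s :: real
  define \<phi> where "\<phi> s = real n * moebius_arg s - j * s" for s
  define \<phi>1 where "\<phi>1 s = real n * P s - j" for s
  define \<phi>2 where "\<phi>2 s = real n * (- 12 * sin s / (5 - 4 * cos s)\<^sup>2)" for s
  have n0: "0 < real n" using n by simp
  have \<mu>: "0 < \<mu>" using n0 by (simp add: \<mu>_def)
  have nz: "5 - 4 * cos s \<noteq> 0" for s :: real using five_minus_cos_pos(1)[of s] by linarith
  have d1: "(\<phi> has_real_derivative \<phi>1 s) (at s)" for s
    unfolding \<phi>_def[abs_def] \<phi>1_def P_def by (auto intro!: derivative_eq_intros moebius_arg_deriv)
  have d2: "(\<phi>1 has_real_derivative \<phi>2 s) (at s)" for s
    unfolding \<phi>1_def[abs_def] \<phi>2_def P_def[abs_def] using nz[of s]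
    by (auto intro!: derivative_eq_intros simp: power2_eq_square)
  have neg: "\<phi>2 s \<le> 0" if "0 \<le> s" "s \<le> pi" for s
    unfolding \<phi>2_def using sin_ge_zero[OF that] n0 by (simp add: mult_nonneg_nonpos divide_nonneg_nonneg)
  have c1: "continuous_on A \<phi>1" for A
    using d2 by (meson DERIV_isCont continuous_at_imp_continuous_on)
  have c0: "continuous_on A \<phi>" for A
    using d1 by (meson DERIV_isCont continuous_at_imp_continuous_on)
  have anti: "\<phi>1 y \<le> \<phi>1 x" if "0 \<le> x" "x \<le> y" "y \<le> pi" for x y
    using that by (intro DERIV_nonpos_imp_nonincreasing[of x y \<phi>1]) (use d2 neg in \<open>force+\<close>)
  obtain s1 where s1: "0 \<le> s1" "s1 \<le> pi" "s1 = 0 \<or> (\<forall>x\<in>{0..s1}. \<mu> \<le> \<phi>1 x)" "s1 = pi \<or> (\<forall>x\<in>{s1..pi}. \<phi>1 x \<le> \<mu>)"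
    by (rule antimono_split[of 0 pi \<phi>1 \<mu>]) (use c1 anti in auto)
  obtain s2 where s2: "s1 \<le> s2" "s2 \<le> pi" "s2 = s1 \<or> (\<forall>x\<in>{s1..s2}. - \<mu> \<le> \<phi>1 x)" "s2 = pi \<or> (\<forall>x\<in>{s2..pi}. \<phi>1 x \<le> - \<mu>)"
    by (rule antimono_split[of s1 pi \<phi>1 "- \<mu>"]) (use c1 anti s1 in auto)
  have i: "(\<lambda>s. cis (\<phi> s)) integrable_on {a..b}" for a b
    unfolding cis_conv_exp by (intro integrable_continuous_real continuous_intros c0)
  have p1: "norm (integral {0..s1} (\<lambda>s. cis (\<phi> s))) \<le> 4 / \<mu>"
  proof (cases "s1 = 0")
    case False
    show ?thesis
    proof (rule van_der_corput_first[OF s1(1) d1 d2])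
      fix s assume s: "s \<in> {0..s1}"
      then show "\<phi>2 s \<le> 0" using s1 by (intro neg) auto
      have "\<mu> \<le> \<phi>1 s" using s1(3) False s by blast
      then show "\<mu> \<le> \<bar>\<phi>1 s\<bar>" by linarith
    qed (rule \<mu>)
  qed (use \<mu> in simp)
  have p3: "norm (integral {s2..pi} (\<lambda>s. cis (\<phi> s))) \<le> 4 / \<mu>"
  proof (cases "s2 = pi")
    case False
    show ?thesis
    proof (rule van_der_corput_first[OF s2(2) d1 d2])
      fix s assume s: "s \<in> {s2..pi}"
      then show "\<phi>2 s \<le> 0" using s1 s2(1) by (intro neg) auto
      have "\<phi>1 s \<le> - \<mu>" using s2(4) False s by blast
      then show "\<mu> \<le> \<bar>\<phi>1 s\<bar>" by linarith
    qed (rule \<mu>)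
  qed (use \<mu> in simp)
  have len: "s2 - s1 \<le> 21 / \<mu>"
  proof (cases "s2 = s1")
    case False
    then have "s1 \<noteq> pi" using s2 by auto
    have l: "- \<mu> \<le> \<phi>1 s2" "\<phi>1 s1 \<le> \<mu>" using False s2 s1 \<open>s1 \<noteq> pi\<close> by auto
    define d where "d = s2 - s1"
    have d0: "0 \<le> d" "d / 2 \<le> pi / 2" using s1 s2 by (auto simp: d_def)
    have "(d / 2 / 4) * (d / 2 / 4) \<le> sin (d / 2) * sin (d / 2)"
      using sin_ge_quarter[of "d / 2"] d0 by (intro mult_mono) auto
    \<comment> \<open>The midpoint of \<open>s1\<close> and \<open>s2\<close> is at distance at
      least d/2 from both 0 and pi.\<close>
    also have "\<dots> \<le> sin ((s1 + s2) / 2) * sin (d / 2)"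
    proof (rule mult_right_mono)
      show "0 \<le> sin (d / 2)" using d0 by (intro sin_ge_zero) auto
      show "sin (d / 2) \<le> sin ((s1 + s2) / 2)"
      proof (cases "(s1 + s2) / 2 \<le> pi / 2")
        case True
        then show ?thesis using s1 s2 d0 by (intro sin_monotone_2pi_le) (auto simp: d_def)
      next
        case False
        have "sin (d / 2) \<le> sin (pi - (s1 + s2) / 2)"
          using False s1 s2 d0 by (intro sin_monotone_2pi_le) (auto simp: d_def field_simps)
        then show ?thesis by simp
      qed
    qed
    also have "\<dots> = (cos s1 - cos s2) / 2" by (simp add: cos_diff_cos d_def)
    finally have cc: "d\<^sup>2 \<le> 32 * (cos s1 - cos s2)" by (simp add: power2_eq_square)
    have "(5 - 4 * cos s1) * (5 - 4 * cos s2) \<le> 9 * 9"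
      using five_minus_cos_pos(2)[of s1] five_minus_cos_pos[of s2] by (intro mult_mono) linarith+
    moreover have "0 < (5 - 4 * cos s1) * (5 - 4 * cos s2)"
      using five_minus_cos_pos(1)[of s1] five_minus_cos_pos(1)[of s2] by (intro mult_pos_pos) linarith+
    moreover have "0 \<le> 12 * (cos s1 - cos s2)" using cc zero_le_power2[of d] by linarith
    ultimately have "12 * (cos s1 - cos s2) / 81 \<le> 12 * (cos s1 - cos s2) / ((5 - 4 * cos s1) * (5 - 4 * cos s2))"
      by (intro divide_left_mono) auto
    also have "\<dots> = P s1 - P s2" unfolding P_def using nz[of s1] nz[of s2] by (simp add: divide_simps)
    finally have "12 * (cos s1 - cos s2) \<le> 81 * (P s1 - P s2)" by simp
    then have "d\<^sup>2 \<le> 216 * (P s1 - P s2)" using cc by linarith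
    then have "real n * d\<^sup>2 \<le> real n * (216 * (P s1 - P s2))" using n0 by (intro mult_left_mono) auto
    also have "\<dots> = 216 * (\<phi>1 s1 - \<phi>1 s2)" by (simp add: \<phi>1_def algebra_simps)
    also have "\<dots> \<le> 216 * (2 * \<mu>)" using l by (intro mult_left_mono) linarith+
    \<comment> \<open>The factor 216 is 32 * 81 / 12. Since n = \<mu>^3, the bound becomes (d
      \<mu>)^2 <= 432 < 21^2.\<close>
    finally have "d\<^sup>2 * real n \<le> 432 * \<mu>" by (simp add: mult.commute)
    moreover have "real n = \<mu> ^ 3" using n0 by (simp add: \<mu>_def powr_power)
    ultimately have "d\<^sup>2 * \<mu>\<^sup>2 * \<mu> \<le> 432 * \<mu>" by (simp add: power2_eq_square power3_eq_cube mult_ac)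
    then have "(d * \<mu>)\<^sup>2 \<le> 21\<^sup>2" using \<mu> by (simp add: power_mult_distrib)
    then have "d * \<mu> \<le> 21" by (rule power2_le_imp_le) simp
    then show ?thesis using \<mu> by (simp add: d_def field_simps)
  qed (use \<mu> in simp)
  have p2: "norm (integral {s1..s2} (\<lambda>s. cis (\<phi> s))) \<le> 1 * (s2 - s1)"
    using s2 by (intro integral_bound) (auto simp: cis_conv_exp intro!: continuous_intros c0)
  have "integral {0..pi} (\<lambda>s. cis (\<phi> s)) = integral {0..s1} (\<lambda>s. cis (\<phi> s)) + integral {s1..pi} (\<lambda>s. cis (\<phi> s))"
    using s1 i by (intro Henstock_Kurzweil_Integration.integral_combine[symmetric]) auto
  also have "integral {s1..pi} (\<lambda>s. cis (\<phi> s)) = integral {s1..s2} (\<lambda>s. cis (\<phi> s)) + integral {s2..pi} (\<lambda>s. cis (\<phi> s))"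
    using s2 i by (intro Henstock_Kurzweil_Integration.integral_combine[symmetric]) auto
  finally have "norm (integral {0..pi} (\<lambda>s. cis (\<phi> s))) \<le> norm (integral {0..s1} (\<lambda>s. cis (\<phi> s))) +
      (norm (integral {s1..s2} (\<lambda>s. cis (\<phi> s))) + norm (integral {s2..pi} (\<lambda>s. cis (\<phi> s))))"
    by (metis (no_types, lifting) add_left_mono norm_triangle_ineq order_trans)
  also have "\<dots> \<le> 4 / \<mu> + (21 / \<mu> + 4 / \<mu>)" by (intro add_mono p1 p3 order_trans[OF p2]) (use len in simp)
  also have "\<dots> = 29 / \<mu>" by simp
  also have "\<dots> = 29 * real n powr (- 1 / 3)" using n0 by (simp add: \<mu>_def powr_minus_divide)
  finally show ?thesis by (simp add: \<phi>_def)
qed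

section \<open>Fourier coefficients after composition with the Moebius map\<close>

definition moebius_coeff :: "(real \<Rightarrow> complex) \<Rightarrow> int \<Rightarrow> complex" where
  "moebius_coeff f j = integral {-pi..pi} (\<lambda>s. f (moebius_arg s) * cis (- (of_int j * s))) / (2 * pi)"

lemma fourier_coeff:
  fixes a :: "int \<Rightarrow> complex"
  assumes a: "(\<lambda>m. norm (a m)) summable_on UNIV" and f: "\<And>t. ((\<lambda>m. a m * cis (of_int m * t)) has_sum f t) UNIV"
  shows "integral {-pi..pi} (\<lambda>s. f s * cis (- (of_int j * s))) = 2 * pi * a j"
proof -
  have sh: "bij_betw (\<lambda>m::int. m + j) UNIV UNIV" by (rule bij_betwI[where g = "\<lambda>m. m - j"]) auto
  have a': "(\<lambda>m. norm (a (m + j))) summable_on UNIV"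
    using summable_on_reindex_bij_betw[OF sh, of "\<lambda>m. norm (a m)"] a by simp
  have f': "((\<lambda>m. a (m + j) * cis (of_int m * t)) has_sum f t * cis (- (of_int j * t))) UNIV" for t
  proof -
    have "((\<lambda>m. a (m + j) * cis (of_int (m + j) * t)) has_sum f t) UNIV"
      using has_sum_reindex_bij_betw[OF sh, of "\<lambda>m. a m * cis (of_int m * t)" "f t"] f[of t] by simp
    from has_sum_cmult_left[OF this, of "cis (- (of_int j * t))"]
    have "((\<lambda>m. a (m + j) * cis (of_int (m + j) * t) * cis (- (of_int j * t))) has_sum f t * cis (- (of_int j * t))) UNIV" .
    moreover have "a (m + j) * cis (of_int (m + j) * t) * cis (- (of_int j * t)) = a (m + j) * cis (of_int m * t)" for m
      by (simp add: mult.assoc cis_mult algebra_simps)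
    ultimately show ?thesis by (simp only:)
  qed
  have pi0: "0 \<le> pi" by simp
  have "((\<lambda>m. of_real (2 * pi * sinc (pi * of_int m)) * a (m + j) * cis (of_int m * 0)) has_sum (2 * pi * a j)) UNIV"
    by (rule has_sum_finite_neutralI[of "{0}"]) (auto simp: sinc_pi_int)
  with fourier_window(1)[OF a' f' pi0, of 0] show ?thesis
    using has_sum_unique by fastforce
qed

lemma cis_moebius_power: "cis (of_nat n * moebius_arg s) = ((2 * cis s - 1) / (2 - cis s)) ^ n"
  by (simp add: Complex.DeMoivre[symmetric] cis_moebius_arg)

text \<open>Nonnegative powers of the disc automorphism are analytic up to the pole at 2. On |z| =
  3/2 the automorphism has modulus at most 4, its value at z = 3/2, so Cauchy's estimates apply
  there.\<close>

lemma moebius_coeff_analytic: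
  fixes n :: nat
  shows "j < 0 \<Longrightarrow> moebius_coeff (\<lambda>t. cis (of_int (int n) * t)) j = 0"
    and "0 \<le> j \<Longrightarrow> norm (moebius_coeff (\<lambda>t. cis (of_int (int n) * t)) j) \<le> 4 ^ n * (2 / 3) ^ nat j"
proof -
  let ?F = "\<lambda>z::complex. ((2 * z - 1) / (2 - z)) ^ n"
  have ne: "2 - z \<noteq> 0" if "norm z < 2" for z :: complex using that by auto
  have bd: "norm (?F z) \<le> 4 ^ n" if z: "norm z = 3 / 2" for z
  proof -
    have nz: "(Re z)\<^sup>2 + (Im z)\<^sup>2 = 9 / 4"
    proof -
      have "(norm z)\<^sup>2 = 9 / 4" unfolding z by (simp add: power_divide)
      then show ?thesis unfolding cmod_power2 .
    qed
    have "(norm (2 * z - 1))\<^sup>2 = 10 - 4 * Re z" using nz unfolding cmod_power2 by (simp add: power2_eq_square algebra_simps)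
    moreover have "(norm (2 - z))\<^sup>2 = 25 / 4 - 4 * Re z" using nz unfolding cmod_power2 by (simp add: power2_eq_square algebra_simps)
    moreover have "Re z \<le> 3 / 2" using complex_Re_le_cmod[of z] z by simp
    ultimately have "(norm (2 * z - 1))\<^sup>2 \<le> (4 * norm (2 - z))\<^sup>2" by (simp add: power_mult_distrib)
    then have "norm (2 * z - 1) \<le> 4 * norm (2 - z)" by (rule power2_le_imp_le) simp
    moreover have "0 < norm (2 - z)" using ne[of z] z by simp
    ultimately have "norm ((2 * z - 1) / (2 - z)) \<le> 4" unfolding norm_divide by (simp only: pos_divide_le_eq)
    then show ?thesis unfolding norm_power by (intro power_mono) auto
  qed
  have hol: "?F holomorphic_on ball 0 2" using ne by (intro holomorphic_intros) auto
  have h: "(1::real) < 3 / 2" "(3 / 2 :: real) < 2" by auto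
  obtain a :: "int \<Rightarrow> complex" where a: "\<And>n. n < 0 \<Longrightarrow> a n = 0" "a 0 = ?F 0" "\<And>k. 0 \<le> k \<Longrightarrow> norm (a k) \<le> 4 ^ n * (1 / (3 / 2)) ^ nat k"
    "(\<lambda>n. norm (a n)) summable_on UNIV" "\<And>t. ((\<lambda>n. a n * cis (of_int n * t)) has_sum ?F (cis t)) UNIV"
    using holomorphic_fourier[OF hol h bd] by blast
  have e: "moebius_coeff (\<lambda>t. cis (of_int (int n) * t)) j = a j" for j
    unfolding moebius_coeff_def of_int_of_nat_eq cis_moebius_power fourier_coeff[OF a(4,5)] by simp
  show "j < 0 \<Longrightarrow> moebius_coeff (\<lambda>t. cis (of_int (int n) * t)) j = 0"
    "0 \<le> j \<Longrightarrow> norm (moebius_coeff (\<lambda>t. cis (of_int (int n) * t)) j) \<le> 4 ^ n * (2 / 3) ^ nat j"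
    unfolding e using a(1)[of j] a(3)[of j] by auto
qed

lemma moebius_coeff_cnj:
  "moebius_coeff (\<lambda>t. cis (of_int (- n) * t)) (- j) = cnj (moebius_coeff (\<lambda>t. cis (of_int n * t)) j)"
  unfolding moebius_coeff_def by (simp add: Henstock_Kurzweil_Integration.integral_cnj cis_cnj)

lemma moebius_coeff_cis_integrable:
  "(\<lambda>s. cis (of_int n * moebius_arg s) * cis (- (of_int j * s))) integrable_on {a..b}"
  unfolding cis_conv_exp by (intro integrable_continuous_real continuous_intros)

text \<open>The phase is odd, so the two halves of the period contribute conjugate integrals,
  together 58 n^(-1/3). Dividing by 2 pi > 6 leaves 10, and passing from n to 1 + n costs at most a
  factor 2.\<close>

lemma moebius_coeff_decay:
  "norm (moebius_coeff (\<lambda>t. cis (of_int n * t)) j) \<le> 20 * (1 + \<bar>of_int n\<bar>) powr (- 1 / 3)"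
proof -
  have *: "norm (moebius_coeff (\<lambda>t. cis (of_int (int n) * t)) j) \<le> 20 * (1 + real n) powr (- 1 / 3)" for n :: nat and j
  proof (cases "n = 0")
    case True
    have "norm (integral {-pi..pi} (\<lambda>s. cis (- (of_int j * s)))) \<le> 1 * (pi - (- pi))"
      by (intro integral_bound) (auto simp: cis_conv_exp intro!: continuous_intros)
    then have "norm (moebius_coeff (\<lambda>t. cis (of_int (int n) * t)) j) \<le> 1"
      using True by (simp add: moebius_coeff_def norm_divide)
    then show ?thesis using True by simp
  next
    case False
    let ?f = "\<lambda>s. cis (of_int (int n) * moebius_arg s) * cis (- (of_int j * s))"
    have f: "?f = (\<lambda>s. cis (real n * moebius_arg s - of_int j * s))" by (rule ext) (simp add: cis_mult)
    have "integral {-pi..pi} ?f = integral {-pi..0} ?f + integral {0..pi} ?f"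
      by (intro Henstock_Kurzweil_Integration.integral_combine[symmetric] moebius_coeff_cis_integrable) auto
    also have "integral {-pi..0} ?f = integral {0..pi} (\<lambda>s. ?f (- s))"
      using Henstock_Kurzweil_Integration.integral_reflect_real[of pi 0 "\<lambda>s. ?f (- s)"] by simp
    also have "(\<lambda>s. ?f (- s)) = (\<lambda>s. cnj (?f s))" by (rule ext) (simp add: moebius_arg_minus cis_cnj)
    also have "integral {0..pi} \<dots> = cnj (integral {0..pi} ?f)" by (rule Henstock_Kurzweil_Integration.integral_cnj[symmetric])
    finally have e: "integral {-pi..pi} ?f = cnj (integral {0..pi} ?f) + integral {0..pi} ?f" .
    have "norm (integral {-pi..pi} ?f) \<le> norm (cnj (integral {0..pi} ?f)) + norm (integral {0..pi} ?f)"
      unfolding e by (rule norm_triangle_ineq)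
    also have "\<dots> \<le> 29 * real n powr (- 1 / 3) + 29 * real n powr (- 1 / 3)"
      unfolding complex_mod_cnj f using False by (intro add_mono moebius_phase_integral_bound) auto
    finally have 1: "norm (integral {-pi..pi} ?f) \<le> 58 * real n powr (- 1 / 3)" by simp
    have "norm (moebius_coeff (\<lambda>t. cis (of_int (int n) * t)) j) = norm (integral {-pi..pi} ?f) / (2 * pi)"
      by (simp add: moebius_coeff_def norm_divide)
    also have "\<dots> \<le> norm (integral {-pi..pi} ?f) / 6" using pi_gt3 by (intro divide_left_mono) auto
    also have "\<dots> \<le> 10 * real n powr (- 1 / 3)"
    proof -
      have "x / 6 \<le> 10 * y" if "x \<le> 58 * y" "0 \<le> y" for x y :: real using that by simp
      from this[OF 1] show ?thesis by simp
    qed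
    also have "\<dots> \<le> 10 * (2 * (1 + real n) powr (- 1 / 3))"
    proof (rule mult_left_mono)
      have "real n powr (- 1 / 3) \<le> ((1 + real n) / 2) powr (- 1 / 3)" using False by (intro powr_mono2') auto
      also have "\<dots> = (1 + real n) powr (- 1 / 3) / 2 powr (- 1 / 3)" by (simp add: powr_divide)
      also have "\<dots> = (1 + real n) powr (- 1 / 3) * 2 powr (1 / 3)" by (simp add: powr_minus_divide)
      also have "\<dots> \<le> (1 + real n) powr (- 1 / 3) * 2 powr 1" by (intro mult_left_mono powr_mono) auto
      finally show "real n powr (- 1 / 3) \<le> 2 * (1 + real n) powr (- 1 / 3)" by (simp add: mult.commute)
    qed simp
    finally show ?thesis by simp
  qed
  show ?thesis
  proof (cases "0 \<le> n")
    case True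
    then show ?thesis using *[of "nat n" j] by simp
  next
    case False
    have "norm (moebius_coeff (\<lambda>t. cis (of_int n * t)) j) = norm (moebius_coeff (\<lambda>t. cis (of_int (- n) * t)) (- j))"
      using moebius_coeff_cnj[of n j] by (metis complex_mod_cnj)
    then show ?thesis using *[of "nat (- n)" "- j"] False by simp
  qed
qed

lemma moebius_coeff_cis_le: "norm (moebius_coeff (\<lambda>t. cis (of_int n * t)) j) \<le> 20"
proof -
  have "(1 + \<bar>real_of_int n\<bar>) powr (- 1 / 3) \<le> (1 + \<bar>real_of_int n\<bar>) powr 0" by (intro powr_mono) auto
  also have "\<dots> = 1"
  proof -
    have "1 + \<bar>real_of_int n\<bar> \<noteq> 0" by linarith
    then show ?thesis by simp
  qed
  finally show ?thesis using moebius_coeff_decay[of n j] by simp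
qed

lemma moebius_coeff_cis_tendsto_0:
  "(\<lambda>k. moebius_coeff (\<lambda>t. cis (of_int n * t)) (int k)) \<longlonglongrightarrow> 0"
  "(\<lambda>k. moebius_coeff (\<lambda>t. cis (of_int n * t)) (- int k)) \<longlonglongrightarrow> 0"
proof -
  have pos: "(\<lambda>k. moebius_coeff (\<lambda>t. cis (of_int (int n) * t)) (int k)) \<longlonglongrightarrow> 0" for n :: nat
  proof (rule Lim_null_comparison)
    show "\<forall>\<^sub>F k in sequentially. norm (moebius_coeff (\<lambda>t. cis (of_int (int n) * t)) (int k)) \<le> 4 ^ n * (2 / 3) ^ k"
      using moebius_coeff_analytic(2)[of "int _" n] by (intro always_eventually allI) force
    show "(\<lambda>k. 4 ^ n * (2 / 3) ^ k) \<longlonglongrightarrow> (0::real)"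
      by (intro tendsto_mult_right_zero LIMSEQ_realpow_zero) auto
  qed
  have neg: "(\<lambda>k. moebius_coeff (\<lambda>t. cis (of_int (int n) * t)) (- int k)) \<longlonglongrightarrow> 0" for n :: nat
  proof (rule tendsto_eventually)
    show "\<forall>\<^sub>F k in sequentially. moebius_coeff (\<lambda>t. cis (of_int (int n) * t)) (- int k) = 0"
      using eventually_gt_at_top[of 0] by eventually_elim (rule moebius_coeff_analytic(1), simp)
  qed
  have "(\<lambda>k. moebius_coeff (\<lambda>t. cis (of_int n * t)) (int k)) \<longlonglongrightarrow> 0 \<and> (\<lambda>k. moebius_coeff (\<lambda>t. cis (of_int n * t)) (- int k)) \<longlonglongrightarrow> 0"
  proof (cases "0 \<le> n")
    case True
    then show ?thesis using pos[of "nat n"] neg[of "nat n"] by simp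
  next
    case False
    have e1: "moebius_coeff (\<lambda>t. cis (of_int n * t)) (int k) = cnj (moebius_coeff (\<lambda>t. cis (of_int (int (nat (- n))) * t)) (- int k))" for k
      using moebius_coeff_cnj[of "- n" "- int k"] False by simp
    have e2: "moebius_coeff (\<lambda>t. cis (of_int n * t)) (- int k) = cnj (moebius_coeff (\<lambda>t. cis (of_int (int (nat (- n))) * t)) (int k))" for k
      using moebius_coeff_cnj[of "- n" "int k"] False by simp
    show ?thesis unfolding e1 e2 using tendsto_cnj[OF pos[of "nat (- n)"]] tendsto_cnj[OF neg[of "nat (- n)"]] by simp
  qed
  then show "(\<lambda>k. moebius_coeff (\<lambda>t. cis (of_int n * t)) (int k)) \<longlonglongrightarrow> 0"
    "(\<lambda>k. moebius_coeff (\<lambda>t. cis (of_int n * t)) (- int k)) \<longlonglongrightarrow> 0" by auto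
qed

lemma moebius_coeff_has_sum:
  assumes a: "(\<lambda>m. norm (a m)) summable_on UNIV" and f: "\<And>t. ((\<lambda>m. a m * cis (of_int m * t)) has_sum f t) UNIV"
  shows "((\<lambda>n. a n * moebius_coeff (\<lambda>t. cis (of_int n * t)) j) has_sum moebius_coeff f j) UNIV"
    "(\<lambda>s. f (moebius_arg s) * cis (- (of_int j * s))) integrable_on {-pi..pi}"
    "continuous_on {-pi..pi} (\<lambda>s. f (moebius_arg s) * cis (- (of_int j * s)))"
proof -
  let ?G = "\<lambda>n s. a n * (cis (of_int n * moebius_arg s) * cis (- (of_int j * s)))"
  have hs: "((\<lambda>n. ?G n s) has_sum f (moebius_arg s) * cis (- (of_int j * s))) UNIV" for s
    using has_sum_cmult_left[OF f[of "moebius_arg s"], of "cis (- (of_int j * s))"] by (simp add: mult.assoc)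
  have n: "norm (?G n s) \<le> norm (a n)" for n s by (simp add: norm_mult)
  have c: "continuous_on {-pi..pi} (?G n)" for n unfolding cis_conv_exp by (intro continuous_intros)
  note h = has_sum_integral[OF a n hs c]
  have "((\<lambda>n. integral {-pi..pi} (?G n) * (1 / (2 * pi))) has_sum integral {-pi..pi} (\<lambda>s. f (moebius_arg s) * cis (- (of_int j * s))) * (1 / (2 * pi))) UNIV"
    using h(2) by (rule has_sum_cmult_left)
  then show "((\<lambda>n. a n * moebius_coeff (\<lambda>t. cis (of_int n * t)) j) has_sum moebius_coeff f j) UNIV"
    by (simp add: moebius_coeff_def)
  show "(\<lambda>s. f (moebius_arg s) * cis (- (of_int j * s))) integrable_on {-pi..pi}"
    using h(1) by (rule integrable_continuous_real)
  show "continuous_on {-pi..pi} (\<lambda>s. f (moebius_arg s) * cis (- (of_int j * s)))" by (rule h(1))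
qed

lemma moebius_coeff_norm_le:
  assumes f: "weighted_fourier w B f" and w: "\<And>n. 0 \<le> w n" "\<And>n. norm (moebius_coeff (\<lambda>t. cis (of_int n * t)) j) \<le> K * w n" "0 \<le> K"
  shows "norm (moebius_coeff f j) \<le> K * B"
proof -
  obtain a where a: "(\<lambda>n. norm (a n)) summable_on UNIV" "(\<lambda>n. norm (a n) * w n) summable_on UNIV"
    "(\<Sum>\<^sub>\<infinity>n. norm (a n) * w n) \<le> B" "\<And>t. ((\<lambda>n. a n * cis (of_int n * t)) has_sum f t) UNIV"
    using f unfolding weighted_fourier_def by blast
  have "norm (moebius_coeff f j) \<le> K * (\<Sum>\<^sub>\<infinity>n. norm (a n) * w n)"
  proof (rule norm_infsum_le[OF moebius_coeff_has_sum(1)[OF a(1,4)] has_sum_cmult_right[OF has_sum_infsum[OF a(2)]]])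
    fix n
    have "norm (a n) * norm (moebius_coeff (\<lambda>t. cis (of_int n * t)) j) \<le> norm (a n) * (K * w n)"
      by (intro mult_left_mono w(2)) simp
    then show "norm (a n * moebius_coeff (\<lambda>t. cis (of_int n * t)) j) \<le> K * (norm (a n) * w n)"
      by (simp add: norm_mult mult_ac)
  qed
  also have "\<dots> \<le> K * B" using a(3) w(3) by (rule mult_left_mono)
  finally show ?thesis .
qed

text \<open>Absolute summability reduces the claim to single exponentials, whose coefficients vanish
  on one side and decay geometrically on the other.\<close>

lemma moebius_coeff_tendsto_0:
  assumes f: "weighted_fourier w B f"
  shows "(\<lambda>k. moebius_coeff f (int k)) \<longlonglongrightarrow> 0" "(\<lambda>k. moebius_coeff f (- int k)) \<longlonglongrightarrow> 0"
proof -
  obtain a where a: "(\<lambda>n. norm (a n)) summable_on UNIV" "\<And>t. ((\<lambda>n. a n * cis (of_int n * t)) has_sum f t) UNIV"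
    using f unfolding weighted_fourier_def by blast
  have e: "moebius_coeff f j = (\<Sum>\<^sub>\<infinity>n. a n * moebius_coeff (\<lambda>t. cis (of_int n * t)) j)" for j
    using moebius_coeff_has_sum(1)[OF a, of j] by (simp add: has_sum_iff)
  have s: "(\<lambda>n. 20 * norm (a n)) summable_on UNIV" using a(1) by (rule summable_on_cmult_right)
  have le: "norm (a n * moebius_coeff (\<lambda>t. cis (of_int n * t)) j) \<le> 20 * norm (a n)" for n j
  proof -
    have "norm (a n) * norm (moebius_coeff (\<lambda>t. cis (of_int n * t)) j) \<le> norm (a n) * 20" by (intro mult_left_mono moebius_coeff_cis_le) simp
    then show ?thesis by (simp add: norm_mult)
  qed
  have "(\<lambda>k. \<Sum>\<^sub>\<infinity>n. a n * moebius_coeff (\<lambda>t. cis (of_int n * t)) (int k)) \<longlonglongrightarrow> (\<Sum>\<^sub>\<infinity>n. a n * 0)"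
    by (rule infsum_dominated_limit[OF s le]) (intro tendsto_mult tendsto_const moebius_coeff_cis_tendsto_0, simp)
  then show "(\<lambda>k. moebius_coeff f (int k)) \<longlonglongrightarrow> 0" unfolding e by simp
  have "(\<lambda>k. \<Sum>\<^sub>\<infinity>n. a n * moebius_coeff (\<lambda>t. cis (of_int n * t)) (- int k)) \<longlonglongrightarrow> (\<Sum>\<^sub>\<infinity>n. a n * 0)"
    by (rule infsum_dominated_limit[OF s le]) (intro tendsto_mult tendsto_const moebius_coeff_cis_tendsto_0, simp)
  then show "(\<lambda>k. moebius_coeff f (- int k)) \<longlonglongrightarrow> 0" unfolding e by simp
qed

context concave_ratio
begin

lemma weight_u_ge_1: "n < 0 \<Longrightarrow> 1 \<le> weight_u \<omega> n"
proof -
  have "0 < ln (10 * \<bar>real_of_int n\<bar> + 8)" by (auto intro!: ln_gt_zero)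
  then have "0 < \<omega> (ln (10 * \<bar>real_of_int n\<bar> + 8))" using pos by blast
  then show "n < 0 \<Longrightarrow> 1 \<le> weight_u \<omega> n" by (simp add: weight_u_def)
qed

lemma moebius_coeff_le_weight_u: "norm (moebius_coeff (\<lambda>t. cis (of_int n * t)) j) \<le> 20 * weight_u \<omega> n"
proof (cases "0 \<le> n")
  case True
  then show ?thesis using moebius_coeff_decay[of n j] by (simp add: weight_u_def)
next
  case False
  have "norm (moebius_coeff (\<lambda>t. cis (of_int n * t)) j) \<le> 20" by (rule moebius_coeff_cis_le)
  also have "\<dots> \<le> 20 * weight_u \<omega> n" using weight_u_ge_1[of n] False by simp
  finally show ?thesis .
qed

lemma moebius_coeff_bound:
  "weighted_fourier (weight_u \<omega>) B f \<Longrightarrow> norm (moebius_coeff f j) \<le> 20 * B"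
  by (erule moebius_coeff_norm_le[OF _ less_imp_le[OF weight_u_pos] moebius_coeff_le_weight_u]) simp

text \<open>The decrease of G(t)/t makes \<omega> at most quadratic for large t, and (ln k)^2 <= 16
  sqrt k; completing the square then bounds G(1) 16 sqrt k by k/4 + 256 G(1)^2.\<close>

lemma exp_quarter_le_\<omega>:
  fixes k :: real
  assumes k: "2 \<le> k"
  shows "exp (- k / 4) \<le> exp (G 1 + 256 * (G 1)\<^sup>2) * exp (- \<omega> (ln k))"
proof -
  define t where "t = ln k"
  have t: "0 < t" using k by (simp add: t_def)
  have G1: "1 \<le> G 1" by (rule G_ge_1) simp
  have "\<omega> t \<le> G 1 + G 1 * t\<^sup>2"
  proof (cases "t \<le> 1")
    case True
    have "\<omega> t \<le> \<omega> 1" using t True by (rule \<omega>_mono)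
    also have "\<dots> \<le> G 1" by (simp add: G_def)
    finally show ?thesis using G1 by (simp add: add_increasing2)
  next
    case False
    have "\<omega> t \<le> t * G t" using mult_G[OF t] t by simp
    also have "\<dots> \<le> t * (G 1 * t)" using G_ratio[of 1 t] False t by (intro mult_left_mono) auto
    finally show ?thesis using G1 by (simp add: power2_eq_square mult_ac)
  qed
  also have "t\<^sup>2 \<le> 16 * sqrt k"
  proof -
    define z where "z = sqrt (sqrt k)"
    have z: "1 \<le> z" "z\<^sup>2 = sqrt k" using k by (auto simp: z_def)
    have "t = 4 * ln z" using k by (simp add: t_def z_def ln_sqrt)
    also have "\<dots> \<le> 4 * (z - 1)" using z by (intro mult_left_mono ln_le_minus_one) auto
    finally have "t\<^sup>2 \<le> (4 * z)\<^sup>2" using t by (intro power_mono) auto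
    then show ?thesis using z(2) by (simp add: power_mult_distrib)
  qed
  then have "G 1 + G 1 * t\<^sup>2 \<le> G 1 + G 1 * (16 * sqrt k)" using G1 by simp
  also have "G 1 * (16 * sqrt k) \<le> k / 4 + 256 * (G 1)\<^sup>2"
  proof -
    have "0 \<le> (sqrt k / 2 - 16 * G 1)\<^sup>2" by simp
    also have "\<dots> = k / 4 + 256 * (G 1)\<^sup>2 - G 1 * (16 * sqrt k)"
      using k by (simp add: power2_diff power_divide power_mult_distrib)
    finally show ?thesis by simp
  qed
  finally have "\<omega> t \<le> G 1 + (k / 4 + 256 * (G 1)\<^sup>2)" by simp
  then have "- k / 4 \<le> (G 1 + 256 * (G 1)\<^sup>2) + - \<omega> t" by simp
  then show ?thesis unfolding t_def exp_add[symmetric] by simp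
qed

text \<open>Nonnegative frequencies stay analytic and contribute nothing. A frequency -m reaches -k
  with k <= 10 m at a cost covered by its weight, and beyond that with an exponentially small
  coefficient. The index -1 is left out because its logarithm is 0, outside the range where \<omega>
  is controlled.\<close>

lemma moebius_coeff_negative:
  assumes f: "weighted_fourier (weight_u \<omega>) B f" and j: "j < - 1"
  shows "norm (moebius_coeff f j) \<le> 20 * exp (G 1 + 256 * (G 1)\<^sup>2) * exp (- \<omega> (ln \<bar>of_int j\<bar>)) * B"
proof (rule moebius_coeff_norm_le[OF f])
  let ?E = "exp (- \<omega> (ln \<bar>real_of_int j\<bar>))"
  let ?C = "exp (G 1 + 256 * (G 1)\<^sup>2)"
  have G1: "1 \<le> G 1" by (rule G_ge_1) simp
  have C1: "1 \<le> ?C" using G1 by simp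
  fix n
  show "norm (moebius_coeff (\<lambda>t. cis (of_int n * t)) j) \<le> 20 * ?C * ?E * weight_u \<omega> n"
  proof (cases "0 \<le> n")
    case True
    then have "moebius_coeff (\<lambda>t. cis (of_int n * t)) j = 0" using moebius_coeff_analytic(1)[of j "nat n"] j by simp
    then show ?thesis using weight_u_pos[of n] by simp
  next
    case False
    define m where "m = nat (- n)"
    define k where "k = nat (- j)"
    have mk: "n = - int m" "j = - int k" "2 \<le> k" using False j by (auto simp: m_def k_def)
    have u1: "1 \<le> weight_u \<omega> n" using False by (intro weight_u_ge_1) simp
    show ?thesis
    proof (cases "k \<le> 10 * m")
      case True
      have "\<omega> (ln \<bar>real_of_int j\<bar>) \<le> \<omega> (ln (10 * \<bar>real_of_int n\<bar> + 8))"
      proof (rule \<omega>_mono)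
        show "0 < ln \<bar>real_of_int j\<bar>" using mk by simp
        have "real k \<le> 10 * real m" using True by linarith
        then show "ln \<bar>real_of_int j\<bar> \<le> ln (10 * \<bar>real_of_int n\<bar> + 8)" using mk by simp
      qed
      then have "1 \<le> ?E * weight_u \<omega> n" using False by (simp add: weight_u_def exp_add[symmetric])
      then have "20 * 1 * 1 \<le> 20 * ?C * (?E * weight_u \<omega> n)" using C1 by (intro mult_mono) auto
      then show ?thesis using moebius_coeff_cis_le[of n j] by (simp add: mult.assoc)
    next
      case F2: False
      \<comment> \<open>With 4 <= e^(3/2) and 2/3 <= e^(-2/5) the coefficient is at most e^(3m/2 -
        2k/5), and m < k/10 turns the exponent into at most -k/4.\<close>
      have "exp (4 / 10) \<le> (3 / 2 :: real)"
      proof (rule power_le_imp_le_base)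
        have "exp (4 / 10 :: real) ^ Suc 4 = exp 1 ^ 2" by (simp add: exp_of_nat_mult[symmetric])
        also have "\<dots> \<le> (272 / 100) ^ 2" using e_less_272 by (intro power_mono) auto
        also have "\<dots> \<le> (3 / 2 :: real) ^ Suc 4" by (simp add: power_divide)
        finally show "exp (4 / 10 :: real) ^ Suc 4 \<le> (3 / 2) ^ Suc 4" .
      qed simp
      then have e1: "2 / 3 \<le> exp (- (4 / 10) :: real)" by (simp add: exp_minus field_simps)
      have e2: "4 \<le> exp (3 / 2 :: real)"
      proof (rule power_le_imp_le_base)
        have "(4::real) ^ Suc 1 \<le> 2.7 ^ 3" by (simp add: power3_eq_cube)
        also have "\<dots> \<le> exp 1 ^ 3" using e_approx_32 by (intro power_mono) (auto simp: abs_if split: if_splits)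
        also have "\<dots> = exp (3 / 2 :: real) ^ Suc 1" by (simp add: exp_of_nat_mult[symmetric] exp_add[symmetric])
        finally show "(4::real) ^ Suc 1 \<le> exp (3 / 2) ^ Suc 1" .
      qed simp
      have "norm (moebius_coeff (\<lambda>t. cis (of_int n * t)) j) = norm (moebius_coeff (\<lambda>t. cis (of_int (int m) * t)) (int k))"
        using moebius_coeff_cnj[of "int m" "int k"] unfolding mk(1,2) by (metis complex_mod_cnj)
      also have "\<dots> \<le> 4 ^ m * (2 / 3) ^ k" using moebius_coeff_analytic(2)[of "int k" m] by simp
      also have "\<dots> \<le> exp (3 / 2) ^ m * exp (- (4 / 10)) ^ k" using e1 e2 by (intro mult_mono power_mono) auto
      also have "\<dots> = exp (3 / 2 * m - 4 / 10 * k)"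
        unfolding exp_of_nat_mult[symmetric] exp_add[symmetric] by (rule arg_cong[of _ _ exp]) simp
      also have "\<dots> \<le> exp (- real k / 4)"
      proof -
        have "10 * real m \<le> real k" using F2 by linarith
        then show ?thesis by (simp add: field_simps)
      qed
      also have "\<dots> \<le> ?C * ?E" using exp_quarter_le_\<omega>[of "real k"] mk by simp
      also have "\<dots> = ?C * ?E * 1" by simp
      also have "\<dots> \<le> ?C * ?E * (20 * weight_u \<omega> n)" using u1 by (intro mult_left_mono) auto
      also have "\<dots> = 20 * ?C * ?E * weight_u \<omega> n" by (simp only: mult_ac)
      finally show ?thesis .
    qed
  qed
qed (rule less_imp_le[OF weight_u_pos], simp)
end

section \<open>Lacunary null sets\<close>

text \<open>The set defined by the conditions from level j on has period 2 pi/D_j, so its density in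
  one period can be compared with that of the next level. Each level costs a factor of at most 1 -
  \<epsilon>_j/(2 pi), and the product of these factors is 0.\<close>

lemma lacunary_null:
  fixes D :: "nat \<Rightarrow> int" and \<epsilon> :: "nat \<Rightarrow> real"
  assumes D: "\<And>j. 2 \<le> D j" "\<And>j. D (Suc j) = D j * D j"
    and \<epsilon>: "\<And>j. 0 < \<epsilon> j" "\<And>j. \<epsilon> j \<le> 1" "\<And>j. 4 * pi \<le> \<epsilon> j * of_int (D j)" and div: "\<not> summable \<epsilon>"
  shows "negligible {t. \<forall>i l. \<epsilon> i \<le> \<bar>of_int (D i) * t + 2 * pi * of_int l\<bar>}"
proof -
  define K where "K j = {t. \<forall>i\<ge>j. \<forall>l::int. \<epsilon> i \<le> \<bar>of_int (D i) * t + 2 * pi * of_int l\<bar>}" for j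
  define p where "p j = 2 * pi / of_int (D j)" for j
  define m where "m j = measure lebesgue (K j \<inter> {0..p j})" for j
  have D0: "0 < real_of_int (D j)" for j using D(1)[of j] by simp
  have p0: "0 < p j" for j using D0[of j] by (simp add: p_def)
  have Dp: "of_int (D j) * p j = 2 * pi" for j using D0[of j] by (simp add: p_def)
  have clo: "closed (K j)" for j
  proof -
    have "K j = (\<Inter>i\<in>{j..}. \<Inter>l::int. {t. \<epsilon> i \<le> \<bar>of_int (D i) * t + 2 * pi * of_int l\<bar>})" by (auto simp: K_def)
    moreover have "closed {t. \<epsilon> i \<le> \<bar>of_int (D i) * t + 2 * pi * of_int l\<bar>}" for i and l :: int
      by (intro closed_Collect_le continuous_intros)
    ultimately show ?thesis by (auto intro!: closed_INT)
  qed
  have lm: "K j \<inter> {a..b} \<in> lmeasurable" for j a b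
    by (intro lmeasurable_compact closed_Int_compact clo) auto
  have dv: "D j dvd D i" if "j \<le> i" for i j
    using that by (induction i rule: dec_induct) (auto simp: D(2))
  have per: "t + of_int k * p j \<in> K j \<longleftrightarrow> t \<in> K j" for t j and k :: int
  proof -
    have *: "t + of_int k * p j \<in> K j" if t: "t \<in> K j" for t and k :: int
      unfolding K_def mem_Collect_eq
    proof (intro allI impI)
      fix i and l :: int assume "j \<le> i"
      from dv[OF this] obtain q where q: "D i = D j * q" by (rule dvdE)
      have "of_int (D i) * (t + of_int k * p j) + 2 * pi * of_int l = of_int (D i) * t + of_int (k * q) * (of_int (D j) * p j) + 2 * pi * of_int l"
        by (simp add: q algebra_simps)
      also have "\<dots> = of_int (D i) * t + 2 * pi * of_int (k * q + l)" unfolding Dp by (simp add: algebra_simps)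
      finally have e: "of_int (D i) * (t + of_int k * p j) + 2 * pi * of_int l = of_int (D i) * t + 2 * pi * of_int (k * q + l)" .
      show "\<epsilon> i \<le> \<bar>of_int (D i) * (t + of_int k * p j) + 2 * pi * of_int l\<bar>"
        unfolding e using t \<open>j \<le> i\<close> unfolding K_def mem_Collect_eq by blast
    qed
    show ?thesis using *[of t k] *[of "t + of_int k * p j" "- k"] by auto
  qed
  have cell: "measure lebesgue (K j \<inter> {of_int k * p j..of_int (k + 1) * p j}) = m j" for j and k :: int
  proof -
    have "(+) (of_int k * p j) ` (K j \<inter> {0..p j}) = K j \<inter> {of_int k * p j..of_int (k + 1) * p j}"
    proof (intro equalityI subsetI)
      fix x assume "x \<in> (+) (of_int k * p j) ` (K j \<inter> {0..p j})"
      then show "x \<in> K j \<inter> {of_int k * p j..of_int (k + 1) * p j}"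
        using per[of _ k j] by (auto simp: algebra_simps)
    next
      fix x assume x: "x \<in> K j \<inter> {of_int k * p j..of_int (k + 1) * p j}"
      then have "x - of_int k * p j \<in> K j \<inter> {0..p j}" using per[of "x - of_int k * p j" k j] by (auto simp: algebra_simps)
      then show "x \<in> (+) (of_int k * p j) ` (K j \<inter> {0..p j})" by (intro image_eqI[of _ _ "x - of_int k * p j"]) auto
    qed
    then show ?thesis unfolding m_def using measure_translation[of "of_int k * p j" "K j \<inter> {0..p j}"] by simp
  qed
  have step: "m j \<le> (1 - \<epsilon> j / (2 * pi)) * of_int (D j) * m (Suc j)" for j
  proof -
    \<comment> \<open>Inside one period the level-j condition removes a piece of length
      \<epsilon>_j/D_j at either end, leaving [a, b]. This interval is covered by cells of the next
      period \<open>q\<close>, each carrying the measure \<open>m (Suc j)\<close>.\<close>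
    define q where "q = p (Suc j)"
    define a where "a = \<epsilon> j / of_int (D j)"
    define b where "b = (2 * pi - \<epsilon> j) / of_int (D j)"
    define I where "I = {\<lfloor>a / q\<rfloor>..\<lfloor>b / q\<rfloor>}"
    have q0: "0 < q" unfolding q_def by (rule p0)
    have "K j \<inter> {0..p j} \<subseteq> (\<Union>k\<in>I. K (Suc j) \<inter> {of_int k * p (Suc j)..of_int (k + 1) * p (Suc j)})"
    proof
      fix t assume t: "t \<in> K j \<inter> {0..p j}"
      then have t': "t \<in> K (Suc j)" by (auto simp: K_def)
      have Dt: "0 \<le> of_int (D j) * t" "of_int (D j) * t \<le> 2 * pi"
        using t D0[of j] Dp[of j] mult_left_mono[of t "p j" "of_int (D j)"] by auto
      have "\<epsilon> j \<le> \<bar>of_int (D j) * t + 2 * pi * of_int 0\<bar>" "\<epsilon> j \<le> \<bar>of_int (D j) * t + 2 * pi * of_int (-1)\<bar>"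
        using t by (auto simp: K_def simp del: of_int_0 of_int_minus)
      then have "\<epsilon> j \<le> of_int (D j) * t" "of_int (D j) * t \<le> 2 * pi - \<epsilon> j" using Dt by auto
      then have ab: "a \<le> t" "t \<le> b" using D0[of j] by (auto simp: a_def b_def field_simps)
      define k where "k = \<lfloor>t / q\<rfloor>"
      have "k \<in> I" unfolding I_def k_def using ab q0 by (auto intro!: floor_mono divide_right_mono)
      moreover have kq: "of_int k * q \<le> t" "t \<le> of_int (k + 1) * q"
      proof -
        have "of_int k \<le> t / q" "t / q \<le> of_int (k + 1)" unfolding k_def by linarith+
        then show "of_int k * q \<le> t" "t \<le> of_int (k + 1) * q" using q0 by (auto simp: field_simps)
      qed
      ultimately show "t \<in> (\<Union>k\<in>I. K (Suc j) \<inter> {of_int k * p (Suc j)..of_int (k + 1) * p (Suc j)})"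
        using t' kq unfolding q_def by (intro UN_I[of k]) simp_all
    qed
    then have "m j \<le> measure lebesgue (\<Union>k\<in>I. K (Suc j) \<inter> {of_int k * p (Suc j)..of_int (k + 1) * p (Suc j)})"
      unfolding m_def
    proof (rule measure_mono_fmeasurable)
      show "K j \<inter> {0..p j} \<in> sets lebesgue" by (rule fmeasurableD[OF lm])
      show "(\<Union>k\<in>I. K (Suc j) \<inter> {of_int k * p (Suc j)..of_int (k + 1) * p (Suc j)}) \<in> lmeasurable"
        by (rule fmeasurable.finite_UN) (simp_all add: I_def lm)
    qed
    also have "\<dots> \<le> (\<Sum>k\<in>I. measure lebesgue (K (Suc j) \<inter> {of_int k * p (Suc j)..of_int (k + 1) * p (Suc j)}))"
      by (rule measure_UNION_le) (auto simp: I_def intro!: fmeasurableD lm)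
    also have "\<dots> = real (card I) * m (Suc j)" unfolding cell by simp
    also have "\<dots> \<le> ((b - a) / q + 2) * m (Suc j)"
    proof (rule mult_right_mono)
      have ab: "a \<le> b" using \<epsilon>(2)[of j] pi_gt3 D0[of j] unfolding a_def b_def by (intro divide_right_mono) auto
      have "\<lfloor>a / q\<rfloor> \<le> \<lfloor>b / q\<rfloor>" using ab q0 by (intro floor_mono divide_right_mono) auto
      then have "real (card I) = of_int (\<lfloor>b / q\<rfloor> - \<lfloor>a / q\<rfloor> + 1)" unfolding I_def by simp
      also have "\<dots> \<le> b / q - a / q + 2" by linarith
      finally show "real (card I) \<le> (b - a) / q + 2" by (simp add: diff_divide_distrib)
    qed (simp add: m_def)
    also have "\<dots> \<le> ((1 - \<epsilon> j / (2 * pi)) * of_int (D j)) * m (Suc j)"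
    proof (rule mult_right_mono)
      \<comment> \<open>The exact proportion would be 1 - \<epsilon>_j/pi. The two extra cells met
        at the ends of [a, b] use up half of the gain, which is at least 2 because 4 pi <=
        \<epsilon>_j D_j.\<close>
      define d where "d = real_of_int (D j)"
      have d: "0 < d" unfolding d_def by (rule D0)
      have q: "q = 2 * pi / (d * d)" by (simp add: q_def p_def D(2) d_def)
      have ba: "b - a = (2 * pi - 2 * \<epsilon> j) / d" by (simp add: a_def b_def d_def diff_divide_distrib)
      have e: "(b - a) / q = d - \<epsilon> j * d / pi" unfolding ba q using d by (simp add: field_simps)
      have "2 \<le> \<epsilon> j * d / (2 * pi)" using \<epsilon>(3)[of j] by (simp add: d_def field_simps)
      moreover have "\<epsilon> j * d / pi = \<epsilon> j * d / (2 * pi) + \<epsilon> j * d / (2 * pi)" by simp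
      moreover have "(1 - \<epsilon> j / (2 * pi)) * d = d - \<epsilon> j * d / (2 * pi)" by (simp add: algebra_simps)
      ultimately show "(b - a) / q + 2 \<le> (1 - \<epsilon> j / (2 * pi)) * of_int (D j)" unfolding e d_def[symmetric] by simp
    qed (simp add: m_def)
    finally show ?thesis .
  qed
  define \<delta> where "\<delta> j = m j / p j" for j
  have dstep: "\<delta> j \<le> (1 - \<epsilon> j / (2 * pi)) * \<delta> (Suc j)" for j
  proof -
    have "p j = of_int (D j) * p (Suc j)" using D0[of j] by (simp add: p_def D(2))
    moreover have "m j / p j \<le> (1 - \<epsilon> j / (2 * pi)) * of_int (D j) * m (Suc j) / p j"
      by (rule divide_right_mono[OF step]) (use p0[of j] in simp)
    ultimately show ?thesis unfolding \<delta>_def using D0[of j] by simp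
  qed
  have f01: "0 \<le> 1 - \<epsilon> j / (2 * pi)" for j using \<epsilon>(2)[of j] pi_gt3 by (simp add: field_simps)
  have dprod: "\<delta> 0 \<le> (\<Prod>j<n. 1 - \<epsilon> j / (2 * pi)) * \<delta> n" for n
  proof (induction n)
    case (Suc n)
    have "(\<Prod>j<n. 1 - \<epsilon> j / (2 * pi)) * \<delta> n \<le> (\<Prod>j<n. 1 - \<epsilon> j / (2 * pi)) * ((1 - \<epsilon> n / (2 * pi)) * \<delta> (Suc n))"
      by (intro mult_left_mono dstep prod_nonneg f01)
    with Suc show ?case by (simp add: mult.assoc)
  qed simp
  have d1: "\<delta> n \<le> 1" for n
  proof -
    have "m n \<le> measure lebesgue {0..p n}" unfolding m_def
      by (rule measure_mono_fmeasurable) (auto intro!: fmeasurableD lm)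
    then show ?thesis using p0[of n] by (simp add: \<delta>_def)
  qed
  have le: "\<delta> 0 \<le> exp (- (\<Sum>j<n. \<epsilon> j) / (2 * pi))" for n
  proof -
    have "\<delta> 0 \<le> (\<Prod>j<n. 1 - \<epsilon> j / (2 * pi)) * \<delta> n" by (rule dprod)
    also have "\<dots> \<le> (\<Prod>j<n. 1 - \<epsilon> j / (2 * pi)) * 1" by (intro mult_left_mono d1 prod_nonneg f01)
    also have "\<dots> \<le> (\<Prod>j<n. exp (- \<epsilon> j / (2 * pi)))"
      unfolding mult_1_right
    proof (rule prod_mono)
      fix j assume "j \<in> {..<n}"
      show "0 \<le> 1 - \<epsilon> j / (2 * pi) \<and> 1 - \<epsilon> j / (2 * pi) \<le> exp (- \<epsilon> j / (2 * pi))"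
        using f01[of j] exp_ge_add_one_self[of "- \<epsilon> j / (2 * pi)"] by simp
    qed
    also have "\<dots> = exp (- (\<Sum>j<n. \<epsilon> j) / (2 * pi))"
      by (simp add: exp_sum[symmetric] sum_negf sum_divide_distrib)
    finally show ?thesis .
  qed
  have "\<delta> 0 \<le> 0"
  proof (rule ccontr)
    assume "\<not> \<delta> 0 \<le> 0"
    then have d: "0 < \<delta> 0" by simp
    have "(\<Sum>j<n. \<epsilon> j) \<le> - (2 * pi) * ln (\<delta> 0)" for n
    proof -
      have "ln (\<delta> 0) \<le> - (\<Sum>j<n. \<epsilon> j) / (2 * pi)" using le[of n] d by (metis ln_exp ln_le_cancel_iff exp_gt_zero)
      then show ?thesis by (simp add: field_simps)
    qed
    then have "summable \<epsilon>" using \<epsilon>(1) by (intro summableI_nonneg_bounded[of _ "- (2 * pi) * ln (\<delta> 0)"]) (auto intro: less_imp_le)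
    with div show False by contradiction
  qed
  then have m0: "m 0 = 0" using p0[of 0] by (simp add: \<delta>_def m_def field_simps measure_le_0_iff)
  have "negligible (K 0 \<inter> {of_int k * p 0..of_int (k + 1) * p 0})" for k :: int
    using lm[of 0 "of_int k * p 0" "of_int (k + 1) * p 0"] cell[of 0 k] m0 by (simp add: negligible_iff_measure)
  then have "negligible (\<Union>k::int. K 0 \<inter> {of_int k * p 0..of_int (k + 1) * p 0})"
    by (intro negligible_countable_Union) auto
  moreover have "K 0 \<subseteq> (\<Union>k::int. K 0 \<inter> {of_int k * p 0..of_int (k + 1) * p 0})"
  proof
    fix t assume t: "t \<in> K 0"
    define k where "k = \<lfloor>t / p 0\<rfloor>"
    have "of_int k \<le> t / p 0" "t / p 0 \<le> of_int (k + 1)" unfolding k_def by linarith+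
    then have "of_int k * p 0 \<le> t" "t \<le> of_int (k + 1) * p 0" using p0[of 0] by (auto simp: field_simps)
    then show "t \<in> (\<Union>k::int. K 0 \<inter> {of_int k * p 0..of_int (k + 1) * p 0})" using t by auto
  qed
  ultimately have "negligible (K 0)" by (rule negligible_subset)
  moreover have "K 0 = {t. \<forall>i l. \<epsilon> i \<le> \<bar>of_int (D i) * t + 2 * pi * of_int l\<bar>}" by (simp add: K_def)
  ultimately show ?thesis by simp
qed

section \<open>Localization\<close>

text \<open>The fourth power of one sinc factor: even, hence nonnegative, with decay m^(-4), enough
  to sum against 1 + |m|. It is presented as a product with four equal half widths \<rho>/4 and
  zeros afterwards, so that the vanishing result for sinc products applies.\<close>

lemma nonneg_bump_exists:
  fixes \<rho> :: real
  assumes \<rho>: "0 < \<rho>"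
  shows "\<exists>\<beta> :: int \<Rightarrow> real. (\<forall>m. 0 \<le> \<beta> m) \<and> \<beta> 0 = 1 \<and> (\<lambda>m. (1 + \<bar>of_int m\<bar>) * \<beta> m) summable_on UNIV \<and>
    (\<forall>t. \<rho> < t \<longrightarrow> t < 2 * pi - \<rho> \<longrightarrow> (\<Sum>\<^sub>\<infinity>m. of_real (\<beta> m) * cis (of_int m * t)) = 0)"
proof -
  define \<alpha> where "\<alpha> = \<rho> / 4"
  define a where "a j = (if j < 4 then \<alpha> else 0)" for j :: nat
  define \<beta> where "\<beta> m = sinc (\<alpha> * of_int m) ^ 4" for m :: int
  have \<alpha>: "0 < \<alpha>" using \<rho> by (simp add: \<alpha>_def)
  have a0: "0 \<le> a j" for j using \<alpha> by (simp add: a_def)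
  have aS: "(\<Sum>j<J. a j) \<le> \<rho>" for J
  proof -
    have "(\<Sum>j<J. a j) \<le> (\<Sum>j<J + 4. a j)" using a0 by (intro sum_mono2) auto
    also have "\<dots> = (\<Sum>j<4. a j)" by (intro sum.mono_neutral_right) (auto simp: a_def)
    also have "\<dots> = \<rho>" by (simp add: a_def \<alpha>_def)
    finally show ?thesis .
  qed
  have lim: "(\<lambda>J. \<Prod>j<J. sinc (a j * of_int m)) \<longlonglongrightarrow> \<beta> m" for m
  proof (rule tendsto_eventually)
    show "\<forall>\<^sub>F J in sequentially. (\<Prod>j<J. sinc (a j * of_int m)) = \<beta> m"
      using eventually_ge_at_top[of 4]
    proof eventually_elim
      case (elim J)
      have "(\<Prod>j<J. sinc (a j * of_int m)) = (\<Prod>j<4. sinc (a j * of_int m))"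
        using elim by (intro prod.mono_neutral_right) (auto simp: a_def)
      then show ?case by (simp add: \<beta>_def a_def)
    qed
  qed
  have nn: "0 \<le> \<beta> m" for m by (simp add: \<beta>_def)
  have le: "(1 + \<bar>of_int m\<bar>) * \<beta> m \<le> (1 + 8 / \<alpha> ^ 4) * (1 / (1 + 1 * real (nat \<bar>m\<bar>))\<^sup>2)" for m
  proof -
    define x where "x = \<bar>real_of_int m\<bar>"
    have "(1 + x) ^ 3 * \<beta> m \<le> 1 + 8 / \<alpha> ^ 4"
    proof (cases "m = 0")
      case True
      then show ?thesis using \<alpha> by (simp add: x_def \<beta>_def)
    next
      case False
      then have x: "1 \<le> x" by (simp add: x_def)
      have "(\<bar>sinc (\<alpha> * of_int m)\<bar> * \<bar>\<alpha> * of_int m\<bar>) ^ 4 \<le> 1 ^ 4"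
        by (intro power_mono abs_sinc_le_inverse) auto
      then have "\<beta> m * (\<alpha> * x) ^ 4 \<le> 1" using \<alpha> by (simp add: power_mult_distrib \<beta>_def x_def abs_mult)
      then have "\<beta> m * x ^ 4 \<le> 1 / \<alpha> ^ 4" using \<alpha> by (simp add: power_mult_distrib field_simps)
      then have 1: "8 * (x ^ 4 * \<beta> m) \<le> 8 / \<alpha> ^ 4" by (simp add: mult.commute)
      have "(1 + x) ^ 3 * \<beta> m \<le> (2 * x) ^ 3 * \<beta> m" using x nn by (intro mult_right_mono power_mono) auto
      also have "\<dots> = 8 * (x ^ 3 * \<beta> m)" by (simp add: power_mult_distrib)
      also have "\<dots> \<le> 8 * (x ^ 4 * \<beta> m)" using x nn by (intro mult_left_mono mult_right_mono power_increasing) auto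
      also have "\<dots> \<le> 1 + 8 / \<alpha> ^ 4" using 1 by simp
      finally show ?thesis .
    qed
    moreover have "0 < (1 + x)\<^sup>2" by (simp add: x_def add_pos_nonneg)
    moreover have "(1 + x) ^ 3 * \<beta> m = ((1 + x) * \<beta> m) * (1 + x)\<^sup>2" by (simp add: power2_eq_square power3_eq_cube)
    ultimately have "(1 + x) * \<beta> m \<le> (1 + 8 / \<alpha> ^ 4) / (1 + x)\<^sup>2" by (simp add: pos_le_divide_eq)
    moreover have "x = real (nat \<bar>m\<bar>)" by (simp add: x_def)
    ultimately show ?thesis unfolding x_def[symmetric] by (simp del: of_nat_nat)
  qed
  have si: "(\<lambda>m::int. 1 / (1 + 1 * real (nat \<bar>m\<bar>))\<^sup>2) summable_on UNIV"
    using sum_inverse_square_arith_le[of 1] by (intro summable_on_int_symmetric(1)[of "\<lambda>k. 1 / (1 + 1 * real k)\<^sup>2" "2 / 1"]) auto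
  have s: "(\<lambda>m. (1 + \<bar>of_int m\<bar>) * \<beta> m) summable_on UNIV"
    by (rule summable_on_comparison_test[OF summable_on_cmult_right[OF si, of "1 + 8 / \<alpha> ^ 4"]]) (use le nn in auto)
  have s1: "(\<lambda>m. \<bar>\<beta> m\<bar>) summable_on UNIV"
  proof (rule summable_on_comparison_test[OF s])
    fix m
    have "1 * \<beta> m \<le> (1 + \<bar>of_int m\<bar>) * \<beta> m" using nn[of m] by (intro mult_right_mono) auto
    then show "\<bar>\<beta> m\<bar> \<le> (1 + \<bar>of_int m\<bar>) * \<beta> m" using nn[of m] by simp
  qed simp
  have z: "(\<Sum>\<^sub>\<infinity>m. of_real (\<beta> m) * cis (of_int m * t)) = 0" if "\<rho> < t" "t < 2 * pi - \<rho>" for t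
    by (rule sinc_product_vanishes[OF a0 aS lim s1 that])
  show ?thesis
  proof (intro exI[of _ \<beta>] conjI allI impI)
    show "\<beta> 0 = 1" by (simp add: \<beta>_def)
  qed (use nn s z in simp_all)
qed

text \<open>Moving the window by one step exchanges two boundary coefficients, which tend to 0 and
  have norm at most B; |m| steps lead to the claim.\<close>

lemma window_shift_tendsto:
  fixes e :: "int \<Rightarrow> complex"
  assumes e0: "(\<lambda>k. e (int k)) \<longlonglongrightarrow> 0" "(\<lambda>k. e (- int k)) \<longlonglongrightarrow> 0" and B: "\<And>i. norm (e i) \<le> B"
  defines "W \<equiv> \<lambda>N m. \<Sum>i = - int N - m..int N - m. e i"
  shows "(\<lambda>N. W N 0 - W N m) \<longlonglongrightarrow> 0" "norm (W N 0 - W N m) \<le> 2 * B * \<bar>of_int m\<bar>"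
proof -
  have \<delta>: "W N m - W N (m + 1) = e (int N - m) - e (- int N - m - 1)" for N m
  proof -
    have 1: "{- int N - m - 1..int N - m} = insert (- int N - m - 1) {- int N - m..int N - m}" by auto
    have 2: "{- int N - m - 1..int N - m} = insert (int N - m) {- int N - (m + 1)..int N - (m + 1)}" by auto
    have "e (- int N - m - 1) + W N m = e (int N - m) + W N (m + 1)"
      unfolding W_def using arg_cong[OF 1, of "sum e"] arg_cong[OF 2, of "sum e"] by simp
    then show ?thesis by (simp add: algebra_simps)
  qed
  have l1: "(\<lambda>N. e (int N - m)) \<longlonglongrightarrow> 0" for m
  proof -
    have f: "filterlim (\<lambda>N. nat (int N - m)) at_top sequentially"
      unfolding filterlim_at_top
    proof
      fix Z
      show "\<forall>\<^sub>F N in sequentially. Z \<le> nat (int N - m)"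
        using eventually_ge_at_top[of "nat (int Z + \<bar>m\<bar>)"] by eventually_elim linarith
    qed
    have "(\<lambda>N. e (int (nat (int N - m)))) \<longlonglongrightarrow> 0" by (rule filterlim_compose[OF e0(1) f])
    then show ?thesis
    proof (rule Lim_transform_eventually)
      show "\<forall>\<^sub>F N in sequentially. e (int (nat (int N - m))) = e (int N - m)"
        using eventually_ge_at_top[of "nat \<bar>m\<bar>"]
      proof eventually_elim
        case (elim N)
        then have "int (nat (int N - m)) = int N - m" by linarith
        then show ?case by (simp only:)
      qed
    qed
  qed
  have l2: "(\<lambda>N. e (- int N - m)) \<longlonglongrightarrow> 0" for m
  proof -
    have f: "filterlim (\<lambda>N. nat (int N + m)) at_top sequentially"
      unfolding filterlim_at_top
    proof
      fix Z
      show "\<forall>\<^sub>F N in sequentially. Z \<le> nat (int N + m)"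
        using eventually_ge_at_top[of "nat (int Z + \<bar>m\<bar>)"] by eventually_elim linarith
    qed
    have "(\<lambda>N. e (- int (nat (int N + m)))) \<longlonglongrightarrow> 0" by (rule filterlim_compose[OF e0(2) f])
    then show ?thesis
    proof (rule Lim_transform_eventually)
      show "\<forall>\<^sub>F N in sequentially. e (- int (nat (int N + m))) = e (- int N - m)"
        using eventually_ge_at_top[of "nat \<bar>m\<bar>"]
      proof eventually_elim
        case (elim N)
        then have "- int (nat (int N + m)) = - int N - m" by linarith
        then show ?case by (simp only:)
      qed
    qed
  qed
  have dl: "(\<lambda>N. W N m - W N (m + 1)) \<longlonglongrightarrow> 0" for m
    unfolding \<delta> using tendsto_diff[OF l1[of m] l2[of "m + 1"]] by (simp add: algebra_simps)
  have db: "norm (W N m - W N (m + 1)) \<le> 2 * B" for N m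
    unfolding \<delta> using norm_triangle_ineq4[of "e (int N - m)" "e (- int N - m - 1)"] B[of "int N - m"] B[of "- int N - m - 1"] by linarith
  have "(\<lambda>N. W N 0 - W N m) \<longlonglongrightarrow> 0 \<and> (\<forall>N. norm (W N 0 - W N m) \<le> 2 * B * \<bar>of_int m\<bar>)"
  proof (induction m rule: int_induct[of _ 0])
    case base
    show ?case by simp
  next
    case (step1 i)
    have e: "W N 0 - W N (i + 1) = (W N 0 - W N i) + (W N i - W N (i + 1))" for N by simp
    have "norm (W N 0 - W N (i + 1)) \<le> 2 * B * \<bar>of_int i\<bar> + 2 * B" for N
      unfolding e by (rule norm_triangle_le, rule add_mono) (use step1 db in auto)
    moreover have "2 * B * \<bar>of_int i\<bar> + 2 * B = 2 * B * \<bar>of_int (i + 1)\<bar>" using step1 by (simp add: algebra_simps)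
    moreover have "(\<lambda>N. W N 0 - W N (i + 1)) \<longlonglongrightarrow> 0 + 0" unfolding e by (intro tendsto_add dl) (use step1 in simp)
    ultimately show ?case by simp
  next
    case (step2 i)
    have e: "W N 0 - W N (i - 1) = (W N 0 - W N i) - (W N (i - 1) - W N (i - 1 + 1))" for N by simp
    have "norm (W N 0 - W N (i - 1)) \<le> 2 * B * \<bar>of_int i\<bar> + 2 * B" for N
      unfolding e by (rule order_trans[OF norm_triangle_ineq4 add_mono[OF _ db]]) (use step2 in blast)
    moreover have "2 * B * \<bar>of_int i\<bar> + 2 * B = 2 * B * \<bar>of_int (i - 1)\<bar>" using step2 by (simp add: algebra_simps)
    moreover have "(\<lambda>N. W N 0 - W N (i - 1)) \<longlonglongrightarrow> 0 - 0" unfolding e by (intro tendsto_diff dl) (use step2 in simp)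
    ultimately show ?case by simp
  qed
  then show "(\<lambda>N. W N 0 - W N m) \<longlonglongrightarrow> 0" "norm (W N 0 - W N m) \<le> 2 * B * \<bar>of_int m\<bar>" by auto
qed

text \<open>
  Multiplying by a bump at \<open>t\<close> gives a vanishing convolution \<open>\<beta> * c\<close>; thus the partial sum at \<open>t\<close> is, up to a factor, a
  \<open>\<beta>\<close>-average of differences of partial sums over shifted windows, which involve only coefficients near \<open>\<plusminus>N\<close>.
\<close>

lemma localization:
  fixes c :: "int \<Rightarrow> complex" and P :: "nat \<Rightarrow> real \<Rightarrow> complex"
  assumes cont: "\<And>k. continuous_on {-pi..pi} (P k)" and bdd: "\<And>k. \<exists>M. \<forall>s. norm (P k s) \<le> M"
    and d: "\<And>k j. d k j = integral {-pi..pi} (\<lambda>s. P k s * cis (- (of_int j * s))) / (2 * pi)"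
    and lim: "\<And>j. (\<lambda>k. d k j) \<longlonglongrightarrow> c j" and B: "\<And>k j. norm (d k j) \<le> B"
    and c0: "(\<lambda>k. c (int k)) \<longlonglongrightarrow> 0" "(\<lambda>k. c (- int k)) \<longlonglongrightarrow> 0"
    and \<rho>: "0 < \<rho>" and zero: "\<And>k s l. k1 \<le> k \<Longrightarrow> \<bar>s - t + 2 * pi * of_int l\<bar> < \<rho> \<Longrightarrow> P k s = 0"
  shows "(\<lambda>N. \<Sum>n = - int N..int N. c n * cis (of_int n * t)) \<longlonglongrightarrow> 0"
proof -
  obtain \<beta> :: "int \<Rightarrow> real" where \<beta>: "\<And>m. 0 \<le> \<beta> m" "\<beta> 0 = 1" "(\<lambda>m. (1 + \<bar>of_int m\<bar>) * \<beta> m) summable_on UNIV"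
    and \<beta>z: "\<And>s. \<rho> / 2 < s \<Longrightarrow> s < 2 * pi - \<rho> / 2 \<Longrightarrow> (\<Sum>\<^sub>\<infinity>m. of_real (\<beta> m) * cis (of_int m * s)) = 0"
    using nonneg_bump_exists[of "\<rho> / 2"] \<rho> by auto
  have sb: "\<beta> summable_on UNIV"
  proof (rule summable_on_comparison_test[OF \<beta>(3)])
    show "\<beta> m \<le> (1 + \<bar>of_int m\<bar>) * \<beta> m" for m using mult_right_mono[of 1 "1 + \<bar>of_int m\<bar>" "\<beta> m"] \<beta>(1)[of m] by simp
  qed (use \<beta> in simp)
  have sm: "(\<lambda>m. \<bar>of_int m\<bar> * \<beta> m) summable_on UNIV"
  proof (rule summable_on_comparison_test[OF \<beta>(3)])
    show "\<bar>of_int m\<bar> * \<beta> m \<le> (1 + \<bar>of_int m\<bar>) * \<beta> m" for m using \<beta>(1)[of m] by (intro mult_right_mono) auto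
  qed (use \<beta> in simp)
  have cB: "norm (c j) \<le> B" for j by (rule Lim_norm_ubound[OF _ lim]) (use B in auto)
  define X where "X s = (\<Sum>\<^sub>\<infinity>m. of_real (\<beta> m) * cis (of_int m * s))" for s
  have sX: "((\<lambda>m. of_real (\<beta> m) * cis (of_int m * s)) has_sum X s) UNIV" for s
    unfolding X_def by (rule has_sum_infsum, rule abs_summable_summable) (use sb \<beta>(1) in \<open>simp add: norm_mult\<close>)
  \<comment> \<open>Reduce s - t modulo 2 pi to y in [0, 2 pi). Near either end \<open>P k\<close>
    vanishes and in the middle the bump does; the radii \<rho> and \<rho>/2 overlap.\<close>
  have PX: "P k s * X (s - t) = 0" if "k1 \<le> k" for k s
  proof -
    define z where "z = (s - t) / (2 * pi)"
    define l where "l = - \<lfloor>z\<rfloor>"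
    define y where "y = s - t + 2 * pi * of_int l"
    have "s - t = 2 * pi * z" by (simp add: z_def)
    then have yz: "y = 2 * pi * (z - of_int \<lfloor>z\<rfloor>)" by (simp add: y_def l_def algebra_simps)
    have fl: "0 \<le> z - of_int \<lfloor>z\<rfloor>" "z - of_int \<lfloor>z\<rfloor> < 1" by linarith+
    have "2 * pi * (z - of_int \<lfloor>z\<rfloor>) < 2 * pi * 1" by (rule mult_strict_left_mono[OF fl(2)]) simp
    then have y: "0 \<le> y" "y < 2 * pi" unfolding yz using fl(1) by simp_all
    have Xy: "X (s - t) = X y" unfolding X_def y_def cis_periodic_int ..
    consider "y < \<rho>" | "2 * pi - \<rho> < y" | "\<rho> / 2 < y" "y < 2 * pi - \<rho> / 2" using \<rho> by fastforce
    then show ?thesis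
    proof cases
      case 1
      then have "P k s = 0" using y by (intro zero[OF that, of s l]) (simp add: y_def)
      then show ?thesis by simp
    next
      case 2
      have "\<bar>y - 2 * pi\<bar> < \<rho>" using 2 y by simp
      then have "P k s = 0" by (intro zero[OF that, of s "l - 1"]) (simp add: y_def algebra_simps)
      then show ?thesis by simp
    next
      case 3
      then show ?thesis unfolding Xy using \<beta>z[of y] by (simp add: X_def)
    qed
  qed
  \<comment> \<open>The sum is, up to a factor, the j-th Fourier coefficient of the product of
    \<open>P k\<close> with the bump translated to \<open>t\<close>. The identity is proved for the
    functions \<open>P k\<close> and passed to the limit by domination, as \<open>c\<close> itself
    need not be the coefficients of a function.\<close>
  have conv0: "(\<Sum>\<^sub>\<infinity>m. of_real (\<beta> m) * cis (- (of_int m * t)) * d k (j - m)) = 0" if "k1 \<le> k" for k j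
  proof -
    obtain M where M: "\<And>s. norm (P k s) \<le> M" using bdd[of k] by blast
    let ?F = "\<lambda>m s. of_real (\<beta> m) * cis (- (of_int m * t)) * (P k s * cis (- (of_int (j - m) * s)))"
    have hs: "((\<lambda>m. ?F m s) has_sum 0) UNIV" for s
    proof -
      have "((\<lambda>m. (P k s * cis (- (of_int j * s))) * (of_real (\<beta> m) * cis (of_int m * (s - t)))) has_sum (P k s * cis (- (of_int j * s))) * X (s - t)) UNIV"
        by (rule has_sum_cmult_right[OF sX])
      moreover have "(P k s * cis (- (of_int j * s))) * X (s - t) = 0" using PX[OF that, of s] by simp
      moreover have "(P k s * cis (- (of_int j * s))) * (of_real (\<beta> m) * cis (of_int m * (s - t))) = ?F m s" for m
      proof -
        have "cis (- (of_int j * s)) * cis (of_int m * (s - t)) = cis (- (of_int m * t)) * cis (- (of_int (j - m) * s))"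
          by (simp add: cis_mult algebra_simps)
        then have "P k s * of_real (\<beta> m) * (cis (- (of_int j * s)) * cis (of_int m * (s - t))) =
            P k s * of_real (\<beta> m) * (cis (- (of_int m * t)) * cis (- (of_int (j - m) * s)))" by (simp only:)
        then show ?thesis by (simp only: mult_ac)
      qed
      ultimately show ?thesis by (simp only:)
    qed
    have n: "norm (?F m s) \<le> \<beta> m * M" for m s
      using mult_left_mono[OF M[of s] \<beta>(1)[of m]] \<beta>(1)[of m] by (simp add: norm_mult)
    have cF: "continuous_on {-pi..pi} (?F m)" for m
      unfolding cis_conv_exp by (intro continuous_intros cont)
    have sM: "(\<lambda>m. \<beta> m * M) summable_on UNIV" using sb by (rule summable_on_cmult_left)
    have "((\<lambda>m. integral {-pi..pi} (?F m)) has_sum integral {-pi..pi} (\<lambda>s. 0)) UNIV"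
      by (rule has_sum_integral(2)[OF sM n hs cF])
    then have "((\<lambda>m. integral {-pi..pi} (?F m)) has_sum 0) UNIV" by simp
    from has_sum_cmult_left[OF this, of "1 / (2 * pi)"]
    have "((\<lambda>m. integral {-pi..pi} (?F m) * (1 / (2 * pi))) has_sum 0) UNIV" by simp
    moreover have "integral {-pi..pi} (?F m) * (1 / (2 * pi)) = of_real (\<beta> m) * cis (- (of_int m * t)) * d k (j - m)" for m
      by (simp add: d)
    ultimately have "((\<lambda>m. of_real (\<beta> m) * cis (- (of_int m * t)) * d k (j - m)) has_sum 0) UNIV" by (simp only:)
    then show ?thesis by (rule infsumI)
  qed
  have sB: "(\<lambda>m. \<beta> m * B) summable_on UNIV" using sb by (rule summable_on_cmult_left)
  have conv: "(\<Sum>\<^sub>\<infinity>m. of_real (\<beta> m) * cis (- (of_int m * t)) * c (j - m)) = 0" for j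
  proof -
    have "(\<lambda>k. \<Sum>\<^sub>\<infinity>m. of_real (\<beta> m) * cis (- (of_int m * t)) * d k (j - m)) \<longlonglongrightarrow> (\<Sum>\<^sub>\<infinity>m. of_real (\<beta> m) * cis (- (of_int m * t)) * c (j - m))"
    proof (rule infsum_dominated_limit[OF sB])
      show "norm (of_real (\<beta> m) * cis (- (of_int m * t)) * d k (j - m)) \<le> \<beta> m * B" for k m
        using mult_left_mono[OF B[of k "j - m"] \<beta>(1)[of m]] \<beta>(1)[of m] by (simp add: norm_mult)
      show "(\<lambda>k. of_real (\<beta> m) * cis (- (of_int m * t)) * d k (j - m)) \<longlonglongrightarrow> of_real (\<beta> m) * cis (- (of_int m * t)) * c (j - m)" for m
        by (intro tendsto_mult tendsto_const lim)
    qed simp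
    moreover have "(\<lambda>k. \<Sum>\<^sub>\<infinity>m. of_real (\<beta> m) * cis (- (of_int m * t)) * d k (j - m)) \<longlonglongrightarrow> 0"
      by (rule tendsto_eventually, rule eventually_mono[OF eventually_ge_at_top[of k1]]) (rule conv0)
    ultimately show ?thesis by (rule LIMSEQ_unique)
  qed
  define e where "e i = c i * cis (of_int i * t)" for i
  have ne: "norm (e i) = norm (c i)" for i by (simp add: e_def norm_mult)
  have e0: "(\<lambda>k. e (int k)) \<longlonglongrightarrow> 0" "(\<lambda>k. e (- int k)) \<longlonglongrightarrow> 0"
    using tendsto_norm_zero[OF c0(1)] tendsto_norm_zero[OF c0(2)] unfolding ne[symmetric] by (auto intro: tendsto_norm_zero_cancel)
  have eB: "norm (e i) \<le> B" for i unfolding ne by (rule cB)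
  define W where "W N m = (\<Sum>i = - int N - m..int N - m. e i)" for N m
  note Wl = window_shift_tendsto[OF e0 eB, folded W_def]
  have We: "((\<lambda>m. of_real (\<beta> m) * W N m) has_sum 0) UNIV" for N
  proof -
    have row: "((\<lambda>m. of_real (\<beta> m) * e (j - m)) has_sum 0) UNIV" for j
    proof -
      have s: "(\<lambda>m. of_real (\<beta> m) * cis (- (of_int m * t)) * c (j - m)) summable_on UNIV"
      proof (rule abs_summable_summable, rule summable_on_comparison_test[OF sB])
        show "norm (of_real (\<beta> m) * cis (- (of_int m * t)) * c (j - m)) \<le> \<beta> m * B" for m
          using mult_left_mono[OF cB[of "j - m"] \<beta>(1)[of m]] \<beta>(1)[of m] by (simp add: norm_mult)
      qed simp
      have "((\<lambda>m. cis (of_int j * t) * (of_real (\<beta> m) * cis (- (of_int m * t)) * c (j - m))) has_sum cis (of_int j * t) * 0) UNIV"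
        using has_sum_cmult_right[OF has_sum_infsum[OF s], of "cis (of_int j * t)"] unfolding conv .
      moreover have "cis (of_int j * t) * (of_real (\<beta> m) * cis (- (of_int m * t)) * c (j - m)) = of_real (\<beta> m) * e (j - m)" for m
      proof -
        have "cis (of_int j * t) * cis (- (of_int m * t)) = cis (of_int (j - m) * t)" by (simp add: cis_mult algebra_simps)
        then show ?thesis unfolding e_def by (metis mult.assoc mult.commute)
      qed
      ultimately show ?thesis by (simp only: mult_zero_right)
    qed
    have fin: "((\<lambda>m. \<Sum>j\<in>J. of_real (\<beta> m) * e (j - m)) has_sum 0) UNIV" if "finite J" for J
      using that
    proof (induction J rule: finite_induct)
      case (insert j J)
      show ?case using has_sum_add[OF row[of j] insert.IH] insert.hyps by simp
    qed simp
    have "((\<lambda>m. \<Sum>j = - int N..int N. of_real (\<beta> m) * e (j - m)) has_sum 0) UNIV" by (rule fin) simp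
    moreover have "(\<Sum>j = - int N..int N. of_real (\<beta> m) * e (j - m)) = of_real (\<beta> m) * W N m" for m
      unfolding W_def sum_distrib_left[symmetric]
      by (intro arg_cong[where f = "\<lambda>x. of_real (\<beta> m) * x"] sum.reindex_bij_witness[of _ "\<lambda>i. i + m" "\<lambda>j. j - m"]) auto
    ultimately show ?thesis by simp
  qed
  \<comment> \<open>\<open>\<sigma>\<close> is the value of the bump at its centre; nonnegativity
    and \<open>\<beta> 0 = 1\<close> make it at least 1, so it can be divided out.\<close>
  define \<sigma> where "\<sigma> = (\<Sum>\<^sub>\<infinity>m. \<beta> m)"
  have "sum \<beta> {0} \<le> \<sigma>" unfolding \<sigma>_def using sb \<beta>(1) by (intro finite_sum_le_infsum) auto
  then have \<sigma>: "1 \<le> \<sigma>" using \<beta>(2) by simp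
  have \<sigma>W: "of_real \<sigma> * W N 0 = (\<Sum>\<^sub>\<infinity>m. of_real (\<beta> m) * (W N 0 - W N m))" for N
  proof -
    have "((\<lambda>m. complex_of_real (\<beta> m)) has_sum of_real \<sigma>) UNIV"
      unfolding \<sigma>_def using has_sum_infsum[OF sb] by (rule has_sum_of_real)
    from has_sum_add[OF has_sum_cmult_left[OF this, of "W N 0"] has_sum_uminusI[OF We[of N]]]
    have "((\<lambda>m. of_real (\<beta> m) * (W N 0 - W N m)) has_sum of_real \<sigma> * W N 0) UNIV" by (simp add: right_diff_distrib)
    then show ?thesis by (simp add: has_sum_iff)
  qed
  have s2: "(\<lambda>m. 2 * B * (\<bar>of_int m\<bar> * \<beta> m)) summable_on UNIV" using sm by (rule summable_on_cmult_right)
  have "(\<lambda>N. \<Sum>\<^sub>\<infinity>m. of_real (\<beta> m) * (W N 0 - W N m)) \<longlonglongrightarrow> (\<Sum>\<^sub>\<infinity>m. of_real (\<beta> m) * 0)"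
  proof (rule infsum_dominated_limit[OF s2])
    show "norm (of_real (\<beta> m) * (W N 0 - W N m)) \<le> 2 * B * (\<bar>of_int m\<bar> * \<beta> m)" for N m
      using mult_left_mono[OF Wl(2)[of N m] \<beta>(1)[of m]] \<beta>(1)[of m] by (simp add: norm_mult mult_ac)
    show "(\<lambda>N. of_real (\<beta> m) * (W N 0 - W N m)) \<longlonglongrightarrow> of_real (\<beta> m) * 0" for m
      by (intro tendsto_mult tendsto_const Wl(1))
  qed simp
  then have "(\<lambda>N. of_real \<sigma> * W N 0) \<longlonglongrightarrow> 0" unfolding \<sigma>W by simp
  from tendsto_mult_left[OF this, of "1 / of_real \<sigma>"] have "(\<lambda>N. W N 0) \<longlonglongrightarrow> 0" using \<sigma> by simp
  then show ?thesis by (simp add: W_def e_def)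
qed

section \<open>The null series\<close>

lemma weighted_fourier_bounded: "weighted_fourier w B f \<Longrightarrow> \<exists>M. \<forall>s. norm (f s) \<le> M"
proof -
  assume "weighted_fourier w B f"
  then obtain a where a: "(\<lambda>n. norm (a n)) summable_on UNIV" "\<And>t. ((\<lambda>n. a n * cis (of_int n * t)) has_sum f t) UNIV"
    unfolding weighted_fourier_def by blast
  have "norm (f s) \<le> (\<Sum>\<^sub>\<infinity>n. norm (a n))" for s
    by (rule norm_infsum_le[OF a(2) has_sum_infsum[OF a(1)]]) (simp add: norm_mult)
  then show ?thesis by blast
qed

lemma moebius_coeff_diff:
  assumes "weighted_fourier w B f" "weighted_fourier w' B' g"
  shows "moebius_coeff (\<lambda>t. f t - g t) j = moebius_coeff f j - moebius_coeff g j"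
proof -
  obtain a where a: "(\<lambda>n. norm (a n)) summable_on UNIV" "\<And>t. ((\<lambda>n. a n * cis (of_int n * t)) has_sum f t) UNIV"
    using assms(1) unfolding weighted_fourier_def by blast
  obtain b where b: "(\<lambda>n. norm (b n)) summable_on UNIV" "\<And>t. ((\<lambda>n. b n * cis (of_int n * t)) has_sum g t) UNIV"
    using assms(2) unfolding weighted_fourier_def by blast
  show ?thesis
    unfolding moebius_coeff_def left_diff_distrib
      Henstock_Kurzweil_Integration.integral_diff[OF moebius_coeff_has_sum(2)[OF a] moebius_coeff_has_sum(2)[OF b]]
    by (rule diff_divide_distrib)
qed

lemma moebius_arg_shift_int: "moebius_arg (s + 2 * pi * of_int l) = moebius_arg s + 2 * pi * of_int l"
proof -
  have c: "cis (s + 2 * pi * of_int l) = cis s" using cis_periodic_int[of 1 s l] by simp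
  have "cos (s + 2 * pi * of_int l) = cos s" "sin (s + 2 * pi * of_int l) = sin s"
    using arg_cong[OF c, of Re] arg_cong[OF c, of Im] by simp_all
  then show ?thesis by (simp add: moebius_arg_def)
qed

lemma moebius_arg_expansion:
  assumes "a \<le> b"
  shows "b - a \<le> 3 * (moebius_arg b - moebius_arg a)"
proof -
  have "3 * moebius_arg a - a \<le> 3 * moebius_arg b - b"
  proof (rule DERIV_nonneg_imp_nondecreasing[OF assms])
    fix s
    have "((\<lambda>s. 3 * moebius_arg s - s) has_real_derivative 3 * (3 / (5 - 4 * cos s)) - 1) (at s)"
      by (intro derivative_intros DERIV_cmult moebius_arg_deriv)
    moreover have "1 \<le> 9 / (5 - 4 * cos s)"
      by (subst le_divide_eq_1_pos) (use five_minus_cos_pos[of s] in linarith)+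
    then have "0 \<le> 3 * (3 / (5 - 4 * cos s)) - 1" by simp
    ultimately show "\<exists>D. ((\<lambda>s. 3 * moebius_arg s - s) has_real_derivative D) (at s) \<and> 0 \<le> D" by blast
  qed
  then show ?thesis by simp
qed

text \<open>The derivative of the lift is at least 1/3, so its inverse is Lipschitz with constant 3
  and maps null sets to null sets.\<close>

lemma negligible_moebius_preimage:
  assumes "negligible A"
  shows "negligible {t. moebius_arg t \<in> A}"
proof -
  have lip: "\<bar>b - a\<bar> \<le> 3 * \<bar>moebius_arg b - moebius_arg a\<bar>" for a b
    using moebius_arg_expansion[of a b] moebius_arg_expansion[of b a] by (cases "a \<le> b") auto
  have inj: "inj moebius_arg"
  proof (rule injI)
    fix a b assume "moebius_arg a = moebius_arg b"
    then show "a = b" using lip[of b a] by simp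
  qed
  let ?K = "{t. moebius_arg t \<in> A}"
  have "negligible (moebius_arg ` ?K)" using assms by (rule negligible_subset) auto
  then have "negligible (inv moebius_arg ` (moebius_arg ` ?K))"
  proof (rule negligible_locally_Lipschitz_image[rotated])
    fix x assume "x \<in> moebius_arg ` ?K"
    then obtain a where a: "x = moebius_arg a" by blast
    have "norm (inv moebius_arg y - inv moebius_arg x) \<le> 3 * norm (y - x)" if "y \<in> moebius_arg ` ?K" for y
    proof -
      from that obtain b where b: "y = moebius_arg b" by blast
      show ?thesis unfolding a b inv_f_f[OF inj] real_norm_def by (rule lip)
    qed
    then show "\<exists>T B. open T \<and> x \<in> T \<and> (\<forall>y\<in>moebius_arg ` ?K \<inter> T. norm (inv moebius_arg y - inv moebius_arg x) \<le> B * norm (y - x))"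
      by (intro exI[of _ UNIV] exI[of _ 3]) auto
  qed simp
  then show ?thesis using inj by (simp add: image_image)
qed

context concave_ratio
begin

text \<open>Cauchy condensation, for 1/\<omega> decreases: the terms 2^n/\<omega>(2^n) are the
  reciprocals of g(2^n), where g(t) = \<omega>(t)/t. Since ln 2 <= 1, \<open>G\<close> at the
  logarithm of the level is at most G(2^n), and g(2^n) >= g(1) = \<omega>(1) absorbs the summand 1
  in \<open>G\<close>.\<close>

lemma not_summable_inverse_G:
  assumes div: "\<not> summable (\<lambda>n::nat. 1 / \<omega> (real (Suc n)))" and c: "0 < c"
  shows "\<not> summable (\<lambda>i. c / G (ln (2 ^ 2 ^ (k0 + i))))"
proof
  assume "summable (\<lambda>i. c / G (ln (2 ^ 2 ^ (k0 + i))))"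
  then have "summable (\<lambda>i. c / G (ln (2 ^ 2 ^ (i + k0))))" by (simp add: add.commute)
  then have s: "summable (\<lambda>i. c / G (ln (2 ^ 2 ^ i)))" by (rule summable_iff_shift[THEN iffD1])
  define f where "f n = (if n = 0 then 0 else 1 / \<omega> (real n))" for n :: nat
  have \<omega>1: "0 < \<omega> 1" using pos by simp
  have f0: "0 \<le> f n" for n using pos by (auto simp: f_def intro: less_imp_le)
  have fm: "f (Suc m) \<le> f m" if "0 < m" for m
  proof -
    have "\<omega> (real m) \<le> \<omega> (real (Suc m))" using that by (intro \<omega>_mono) auto
    moreover have "0 < \<omega> (real m)" using pos that by simp
    ultimately show ?thesis using that by (simp add: f_def frac_le)
  qed
  have fS: "(\<lambda>n. 1 / \<omega> (real (Suc n))) = (\<lambda>n. f (Suc n))" by (rule ext) (simp add: f_def)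
  have "\<not> summable (\<lambda>n. f (Suc n))" using div unfolding fS .
  then have "\<not> summable f" by (simp only: summable_Suc_iff simp_thms)
  then have "\<not> summable (\<lambda>n. 2 ^ n * f (2 ^ n))" using condensation_test[of f] fm f0 by blast
  moreover have "summable (\<lambda>n. 2 ^ n * f (2 ^ n))"
  proof (rule summable_comparison_test'[OF summable_mult[OF s, of "(1 + 1 / \<omega> 1) / c"]])
    fix n :: nat
    define t where "t = (2::real) ^ n"
    define L where "L = ln ((2::real) ^ 2 ^ n)"
    have t: "1 \<le> t" by (simp add: t_def)
    have "ln 2 \<le> (1::real)" using ln_le_minus_one[of 2] by simp
    then have L: "0 < L" "L \<le> t" unfolding L_def t_def by (simp_all add: ln_realpow)
    have g: "0 < \<omega> t / t" "\<omega> 1 \<le> \<omega> t / t"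
      using pos t concave_pos_mono[OF conc, of 1 t] by auto
    have "G L \<le> G t" using L by (rule G_mono)
    also have "\<dots> = \<omega> t / t + 1" by (simp add: G_def)
    also have "\<dots> \<le> \<omega> t / t + \<omega> t / t / \<omega> 1"
      by (rule add_left_mono) (use g(2) \<omega>1 in \<open>simp only: le_divide_eq_1_pos\<close>)
    also have "\<dots> = (\<omega> t / t) * (1 + 1 / \<omega> 1)" by (simp add: distrib_left)
    finally have "G L \<le> (\<omega> t / t) * (1 + 1 / \<omega> 1)" .
    moreover have "1 / y \<le> q / p" if "p \<le> y * q" "0 < y" "1 \<le> p" for y q p :: real
      using that by (simp add: field_simps)
    ultimately have "1 / (\<omega> t / t) \<le> (1 + 1 / \<omega> 1) / G L" using g(1) G_ge_1[OF L(1)] by blast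
    moreover have "2 ^ n * f (2 ^ n) = 1 / (\<omega> t / t)" by (simp add: f_def t_def)
    moreover have "(1 + 1 / \<omega> 1) / c * (c / G L) = (1 + 1 / \<omega> 1) / G L" using c by simp
    moreover have "norm (2 ^ n * f (2 ^ n)) = 2 ^ n * f (2 ^ n)" using f0[of "2 ^ n"] by simp
    ultimately show "norm (2 ^ n * f (2 ^ n)) \<le> (1 + 1 / \<omega> 1) / c * (c / G (ln (2 ^ 2 ^ n)))"
      unfolding L_def by (simp only:)
  qed
  ultimately show False by contradiction
qed

end

theorem theorem3:
  fixes \<omega> :: "real \<Rightarrow> real"
  assumes pos: "\<forall>t>0. \<omega> t > 0"
    and conc: "concave_on {0<..} (\<lambda>t. \<omega> t / t)"
    and div: "\<not> summable (\<lambda>n::nat. 1 / \<omega> (real (Suc n)))"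
  shows "\<exists>K :: real set. closed K \<and> (\<forall>t. t \<in> K \<longleftrightarrow> t + 2 * pi \<in> K) \<and>
           K \<in> null_sets lborel \<and>
           (\<exists>c :: int \<Rightarrow> complex. (\<exists>n. c n \<noteq> 0) \<and>
              (\<forall>t. t \<notin> K \<longrightarrow>
                 (\<lambda>N::nat. \<Sum>n = - int N..int N. c n * exp (\<i> * of_int n * of_real t))
                   \<longlonglongrightarrow> 0) \<and>
              (\<exists>C. \<forall>n::int. n < -1 \<longrightarrow>
                 norm (c n) \<le> C * exp (- \<omega> (ln (real_of_int \<bar>n\<bar>)))))"
proof -
  interpret concave_ratio \<omega> by unfold_locales (fact pos conc)+
  obtain c :: real and D0 :: int where c: "0 < c" "c \<le> 1" "3 \<le> D0"
    and level: "\<And>D. D0 \<le> D \<Longrightarrow> \<exists>S. (\<forall>t l. \<bar>of_int D * t + 2 * pi * of_int l\<bar> \<le> c / G (ln D) \<longrightarrow> S t = 0) \<and>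
        weighted_fourier (weight_v \<omega>) (of_int D powr (1/8)) S \<and>
        weighted_fourier (\<lambda>m. if D \<le> m then 1 else weight_v \<omega> m / (of_int D / 2) powr (- 1 / 3)) (2 * of_int D powr (1/12)) (\<lambda>t. S t - 1)"
    by (rule level_block) blast
  have G1: "1 \<le> G 1" by (rule G_ge_1) simp
  \<comment> \<open>Three demands on the first level: the single-level construction applies, the
    increments are at most 20 * 4/320 = 1/4 after the Moebius map, and the arcs are long compared
    with the next period.\<close>
  have "eventually (\<lambda>x::real. of_int D0 \<le> x) at_top" by (rule eventually_ge_at_top)
  moreover have "eventually (\<lambda>x::real. x powr (- 1 / 8) \<le> 1 / 320) at_top" by real_asymp
  moreover have "eventually (\<lambda>x. 4 * pi * G 1 * ln x \<le> c * x) at_top"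
  proof -
    have "eventually (\<lambda>x. A * ln x \<le> B * x) at_top" if "0 < A" "0 < B" for A B :: real using that by real_asymp
    from this[of "4 * pi * G 1" c] show ?thesis using G1 c by simp
  qed
  ultimately have "eventually (\<lambda>x. of_int D0 \<le> x \<and> x powr (- 1 / 8) \<le> 1 / 320 \<and> 4 * pi * G 1 * ln x \<le> c * x) at_top"
    by (intro eventually_conj)
  then obtain x0 :: real where x0: "\<And>x. x0 \<le> x \<Longrightarrow> of_int D0 \<le> x \<and> x powr (- 1 / 8) \<le> 1 / 320 \<and> 4 * pi * G 1 * ln x \<le> c * x"
    unfolding eventually_at_top_linorder by blast
  define k0 where "k0 = nat \<lceil>x0\<rceil>"
  define D where "D i = (2::int) ^ 2 ^ (k0 + i)" for i
  define x where "x i = real_of_int (D i)" for i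
  define \<epsilon> where "\<epsilon> i = c / G (ln (x i))" for i
  define r where "r i = x i powr (- 1 / 8)" for i
  have DS: "D (Suc i) = D i * D i" for i by (simp add: D_def power_add[symmetric] mult_2)
  have xS: "x (Suc i) = x i * x i" for i by (simp add: x_def DS)
  have xge: "x0 \<le> x i" for i
  proof -
    have "x0 \<le> real k0" unfolding k0_def by linarith
    also have "\<dots> \<le> real (k0 + i)" by simp
    also have "\<dots> \<le> 2 ^ (k0 + i)" using of_nat_less_two_power[of "k0 + i", where 'a = real] by simp
    also have "(2::real) ^ (k0 + i) \<le> 2 ^ 2 ^ (k0 + i)" by (intro power_increasing less_imp_le[OF less_exp]) auto
    finally show ?thesis by (simp add: x_def D_def)
  qed
  note big = x0[OF xge]
  have D0: "D0 \<le> D i" for i using big[of i] by (simp add: x_def)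
  have D3: "3 \<le> D i" for i using D0[of i] c by simp
  have x3: "3 \<le> x i" for i using D3[of i] by (simp add: x_def)
  have L1: "1 \<le> ln (x i)" for i
  proof -
    have "exp 1 \<le> x i" using exp_le x3[of i] by linarith
    then show ?thesis using x3[of i] by (subst ln_ge_iff) auto
  qed
  have GL: "1 \<le> G (ln (x i))" "G (ln (x i)) \<le> G 1 * ln (x i)" for i
  proof -
    show "1 \<le> G (ln (x i))" using L1[of i] by (intro G_ge_1) simp
    show "G (ln (x i)) \<le> G 1 * ln (x i)" using G_ratio[of 1 "ln (x i)"] L1[of i] by simp
  qed
  have \<epsilon>: "0 < \<epsilon> i" "\<epsilon> i \<le> 1" "4 * pi \<le> \<epsilon> i * of_int (D i)" for i
  proof -
    show "0 < \<epsilon> i" using c GL(1)[of i] by (simp add: \<epsilon>_def)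
    show "\<epsilon> i \<le> 1" using c GL(1)[of i] by (simp add: \<epsilon>_def field_simps)
    have "4 * pi * G (ln (x i)) \<le> 4 * pi * (G 1 * ln (x i))" using GL(2) by (intro mult_left_mono) auto
    also have "\<dots> \<le> c * x i" using big[of i] by (simp add: mult.assoc)
    finally show "4 * pi \<le> \<epsilon> i * of_int (D i)" using GL(1)[of i] unfolding x_def[symmetric] \<epsilon>_def by (simp add: field_simps)
  qed
  have "\<exists>S. \<forall>i. (\<forall>t l. \<bar>of_int (D i) * t + 2 * pi * of_int l\<bar> \<le> \<epsilon> i \<longrightarrow> S i t = 0) \<and>
        weighted_fourier (weight_v \<omega>) (x i powr (1/8)) (S i) \<and>
        weighted_fourier (\<lambda>m. if D i \<le> m then 1 else weight_v \<omega> m / (x i / 2) powr (- 1 / 3)) (2 * x i powr (1/12)) (\<lambda>t. S i t - 1)"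
    unfolding x_def \<epsilon>_def by (rule choice) (use level[OF D0] in blast)
  then obtain S where S0: "\<And>i t l. \<bar>of_int (D i) * t + 2 * pi * of_int l\<bar> \<le> \<epsilon> i \<Longrightarrow> S i t = 0"
    and Sv: "\<And>i. weighted_fourier (weight_v \<omega>) (x i powr (1/8)) (S i)"
    and Sw: "\<And>i. weighted_fourier (\<lambda>m. if D i \<le> m then 1 else weight_v \<omega> m / (x i / 2) powr (- 1 / 3)) (2 * x i powr (1/12)) (\<lambda>t. S i t - 1)"
    by blast
  define R where "R n t = (\<Prod>i<n. S i t)" for n t
  define d where "d k j = moebius_coeff (R k) j" for k j
  have v0: "0 \<le> weight_v \<omega> n" for n using weight_v_ge_1[of n] by linarith
  have RS: "R (Suc n) = (\<lambda>t. R n t * S n t)" for n by (rule ext) (simp add: R_def)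
  \<comment> \<open>Squaring matches the induction: the norm D_n^(1/8) of the product times the norm
    D_n^(1/8) of the next factor is D_(n+1)^(1/8).\<close>
  have Rv: "weighted_fourier (weight_v \<omega>) (x n powr (1/8)) (R n)" for n
  proof (induction n)
    case 0
    have w1: "weighted_fourier (weight_v \<omega>) 1 (R 0)" using weighted_fourier_monomial[of "weight_v \<omega>" 1 0] by (simp add: R_def[abs_def] weight_v_def)
    have "1 \<le> x 0 powr (1/8)" using x3[of 0] by (intro ge_one_powr_ge_zero) auto
    then show ?case using v0 by (intro weighted_fourier_mono[OF w1, where K = 1]) simp_all
  next
    case (Suc n)
    have "weighted_fourier (weight_v \<omega>) (1 * (x n powr (1/8) * x n powr (1/8))) (\<lambda>t. R n t * S n t)"
      by (rule weighted_fourier_mult[OF Suc Sv v0 v0 v0]) (use weight_v_submult in auto)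
    moreover have "x n powr (1/8) * x n powr (1/8) = x (Suc n) powr (1/8)" using x3[of n] by (simp add: xS powr_mult)
    ultimately show ?case by (simp only: RS mult_1_left)
  qed
  have diff: "weighted_fourier (weight_u \<omega>) (4 * r n) (\<lambda>t. R (Suc n) t - R n t)" for n
  proof -
    define \<kappa> where "\<kappa> = (x n / 2) powr (- 1 / 3)"
    have \<kappa>0: "0 < \<kappa>" using x3[of n] by (simp add: \<kappa>_def)
    have "weighted_fourier (weight_u \<omega>) (\<kappa> * (x n powr (1/8) * (2 * x n powr (1/12)))) (\<lambda>t. R n t * (S n t - 1))"
    proof (rule weighted_fourier_mult[OF Rv Sw])
      show "weight_u \<omega> (i + m) \<le> \<kappa> * (weight_v \<omega> i * (if D n \<le> m then 1 else weight_v \<omega> m / (x n / 2) powr (- 1 / 3)))" for i m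
        unfolding \<kappa>_def x_def by (rule weight_u_shift_le) (use D3[of n] in simp)
      show "0 \<le> weight_v \<omega> i" for i by (rule v0)
      show "0 \<le> (if D n \<le> m then 1 else weight_v \<omega> m / (x n / 2) powr (- 1 / 3))" for m using v0[of m] by simp
      show "0 \<le> weight_u \<omega> i" for i by (rule less_imp_le[OF weight_u_pos])
      show "0 \<le> \<kappa>" using \<kappa>0 by simp
    qed
    moreover have "(\<lambda>t. R n t * (S n t - 1)) = (\<lambda>t. R (Suc n) t - R n t)" by (simp add: RS algebra_simps)
    \<comment> \<open>The exponent is -1/3 + 1/8 + 1/12 = -1/8; the 4 consists of the 2 in the norm
      of \<open>S n - 1\<close> and a bound 2 for 2^(1/3).\<close>
    moreover have "\<kappa> * (x n powr (1/8) * (2 * x n powr (1/12))) \<le> 4 * r n"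
    proof -
      have "\<kappa> = x n powr (- 1 / 3) * 2 powr (1 / 3)" using x3[of n] by (simp add: \<kappa>_def powr_divide powr_minus_divide)
      also have "\<dots> \<le> x n powr (- 1 / 3) * 2 powr 1" by (intro mult_left_mono powr_mono) auto
      finally have "\<kappa> * (2 * (x n powr (1/8) * x n powr (1/12))) \<le> x n powr (- 1 / 3) * 2 powr 1 * (2 * (x n powr (1/8) * x n powr (1/12)))"
        by (intro mult_right_mono) auto
      also have "\<dots> = 4 * (x n powr (- 1 / 3) * (x n powr (1/8) * x n powr (1/12)))" by simp
      also have "x n powr (- 1 / 3) * (x n powr (1/8) * x n powr (1/12)) = x n powr (- 1 / 3 + (1/8 + 1/12))" by (simp only: powr_add)
      also have "\<dots> = r n" by (simp add: r_def)
      finally show ?thesis by (simp only: mult_ac)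
    qed
    ultimately show ?thesis
      using less_imp_le[OF weight_u_pos] weighted_fourier_mono[where K = 1 and w = "weight_u \<omega>" and w' = "weight_u \<omega>"] by simp
  qed
  have r: "0 \<le> r i" "r i \<le> 1 / 320 * (1 / 2) ^ i" for i
  proof -
    show "0 \<le> r i" by (simp add: r_def)
    have rS: "r (Suc i) = r i * r i" for i using x3[of i] by (simp add: r_def xS powr_mult)
    show "r i \<le> 1 / 320 * (1 / 2) ^ i"
    proof (induction i)
      case 0
      then show ?case using big[of 0] by (simp add: r_def)
    next
      case (Suc i)
      have "r i \<le> 1 / 320" using big[of i] by (simp add: r_def)
      then have "r i * r i \<le> (1 / 2) * r i" by (intro mult_right_mono) (auto simp: r_def)
      also have "\<dots> \<le> (1 / 2) * (1 / 320 * (1 / 2) ^ i)" using Suc by (intro mult_left_mono) auto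
      finally show ?case by (simp add: rS)
    qed
  qed
  have gs: "(\<lambda>i. (1 / 2 :: real) ^ i) sums 2" using geometric_sums[of "1 / 2 :: real"] by simp
  have dd: "d (Suc k) j - d k j = moebius_coeff (\<lambda>t. R (Suc k) t - R k t) j" for k j
    unfolding d_def by (rule moebius_coeff_diff[OF Rv Rv, symmetric])
  have step: "norm (d (Suc k) j - d k j) \<le> 1 / 4 * (1 / 2) ^ k" for k j
    unfolding dd using moebius_coeff_bound[OF diff[of k], of j] r(2)[of k] by simp
  \<comment> \<open>Stated for an arbitrary \<open>q\<close> because it is used twice: with 1/4
    uniformly in j, and with a multiple of the required decay for each negative j.\<close>
  have conv: "\<exists>l. (\<lambda>k. d k j) \<longlonglongrightarrow> l \<and> (\<forall>n. norm (l - d n j) \<le> q * (2 * (1 / 2) ^ n))"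
    if q: "\<And>k. norm (d (Suc k) j - d k j) \<le> q * (1 / 2) ^ k" for j q
  proof -
    have sq: "summable (\<lambda>k. q * (1 / 2 :: real) ^ k)" using sums_summable[OF gs] by (rule summable_mult)
    have "summable (\<lambda>k. d (Suc k) j - d k j)" by (rule summable_comparison_test'[OF sq]) (use q in auto)
    then have "convergent (\<lambda>n. \<Sum>k<n. d (Suc k) j - d k j)" by (simp add: summable_iff_convergent)
    then have "convergent (\<lambda>n. d n j - d 0 j)" by (simp only: sum_lessThan_telescope[of "\<lambda>k. d k j"])
    then have "convergent (\<lambda>n. d n j)" using convergent_diff_const_right_iff by blast
    then obtain l where l: "(\<lambda>k. d k j) \<longlonglongrightarrow> l" by (auto simp: convergent_def)
    have "norm (d (n + k) j - d n j) \<le> q * (2 * (1 / 2) ^ n) - q * (2 * (1 / 2) ^ (n + k))" for n k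
    proof (induction k)
      case (Suc k)
      have "norm (d (n + Suc k) j - d n j) \<le> norm (d (Suc (n + k)) j - d (n + k) j) + norm (d (n + k) j - d n j)"
        using norm_triangle_ineq[of "d (Suc (n + k)) j - d (n + k) j" "d (n + k) j - d n j"] by simp
      also have "\<dots> \<le> q * (1 / 2) ^ (n + k) + (q * (2 * (1 / 2) ^ n) - q * (2 * (1 / 2) ^ (n + k)))"
        by (rule add_mono[OF q Suc])
      also have "\<dots> = q * (2 * (1 / 2) ^ n) - q * (2 * (1 / 2) ^ (n + Suc k))" by simp
      finally show ?case .
    qed simp
    moreover have "0 \<le> q" using order_trans[OF norm_ge_zero q[of 0]] by simp
    ultimately have le: "norm (d (n + k) j - d n j) \<le> q * (2 * (1 / 2) ^ n)" for n k
      by (smt (verit) mult_nonneg_nonneg zero_le_power zero_le_divide_1_iff)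
    have "norm (l - d n j) \<le> q * (2 * (1 / 2) ^ n)" for n
    proof (rule Lim_norm_ubound[OF _ tendsto_diff[OF LIMSEQ_ignore_initial_segment[OF l, of n] tendsto_const]])
      show "\<forall>\<^sub>F k in sequentially. norm (d (k + n) j - d n j) \<le> q * (2 * (1 / 2) ^ n)"
        by (intro always_eventually allI) (subst add.commute, rule le)
    qed simp
    with l show ?thesis by blast
  qed
  have "\<exists>l. \<forall>j. (\<lambda>k. d k j) \<longlonglongrightarrow> l j \<and> (\<forall>n. norm (l j - d n j) \<le> 1 / 4 * (2 * (1 / 2) ^ n))"
    by (rule choice) (use conv[OF step] in blast)
  then obtain a where a: "\<And>j. (\<lambda>k. d k j) \<longlonglongrightarrow> a j" "\<And>j n. norm (a j - d n j) \<le> 1 / 4 * (2 * (1 / 2) ^ n)" by blast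
  have R0: "R 0 = (\<lambda>t. cis (of_int (int 0) * t))" by (rule ext) (simp add: R_def)
  have d00: "d 0 0 = 1"
    by (simp add: d_def R0 moebius_coeff_def scaleR_conv_of_real)
  \<comment> \<open>The total change of the coefficient of index 0 is at most 1/2, while it starts
    at 1.\<close>
  have a0: "a 0 \<noteq> 0"
  proof
    assume "a 0 = 0"
    then have "norm (d 0 0) \<le> 1 / 2" using a(2)[of 0 0] by simp
    then show False by (simp add: d00)
  qed
  have neg: "norm (a j) \<le> exp (G 1 + 256 * (G 1)\<^sup>2) * exp (- \<omega> (ln \<bar>of_int j\<bar>))" if j: "j < - 1" for j
  proof -
    define E where "E = exp (G 1 + 256 * (G 1)\<^sup>2) * exp (- \<omega> (ln \<bar>real_of_int j\<bar>))"
    have E0: "0 \<le> E" by (simp add: E_def)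
    have "norm (d (Suc k) j - d k j) \<le> E / 4 * (1 / 2) ^ k" for k
    proof -
      have "norm (d (Suc k) j - d k j) \<le> 20 * E * (4 * r k)"
        unfolding dd E_def using moebius_coeff_negative[OF diff[of k] j] by (simp only: mult.assoc)
      also have "\<dots> \<le> 20 * E * (4 * (1 / 320 * (1 / 2) ^ k))" using E0 r(2) by (intro mult_left_mono) auto
      finally show ?thesis by simp
    qed
    from conv[OF this] obtain l where l: "(\<lambda>k. d k j) \<longlonglongrightarrow> l" "\<And>n. norm (l - d n j) \<le> E / 4 * (2 * (1 / 2) ^ n)" by blast
    have "l = a j" using LIMSEQ_unique[OF l(1) a(1)] .
    moreover have "d 0 j = 0" unfolding d_def R0 using moebius_coeff_analytic(1)[of j 0] j by simp
    ultimately show ?thesis using l(2)[of 0] E0 unfolding E_def[symmetric] by simp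
  qed
  \<comment> \<open>The limit is uniform in j and each approximant is an absolutely convergent
    series composed with the Moebius map, whose coefficients tend to 0.\<close>
  have alim: "(\<lambda>k. a (s * int k)) \<longlonglongrightarrow> 0" if s: "s = 1 \<or> s = - 1" for s
  proof (rule LIMSEQ_I)
    fix e :: real assume e: "0 < e"
    have "(\<lambda>n. 1 / 4 * (2 * (1 / 2 :: real) ^ n)) \<longlonglongrightarrow> 1 / 4 * (2 * 0)"
      by (intro tendsto_mult tendsto_const LIMSEQ_realpow_zero) auto
    then have "\<forall>\<^sub>F n in sequentially. 1 / 4 * (2 * (1 / 2 :: real) ^ n) < e / 2" by (rule order_tendstoD(2)) (use e in simp)
    then obtain n where n: "1 / 4 * (2 * (1 / 2 :: real) ^ n) < e / 2" by (auto dest: eventually_happens)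
    have "(\<lambda>k. d n (s * int k)) \<longlonglongrightarrow> 0"
      unfolding d_def using s moebius_coeff_tendsto_0[OF Rv[of n]] by auto
    then obtain k1 where k1: "\<And>k. k1 \<le> k \<Longrightarrow> norm (d n (s * int k) - 0) < e / 2" using LIMSEQ_D[of _ 0 "e / 2"] e by (metis half_gt_zero)
    have "norm (a (s * int k) - 0) < e" if "k1 \<le> k" for k
    proof -
      have "norm (a (s * int k)) \<le> norm (a (s * int k) - d n (s * int k)) + norm (d n (s * int k))"
        using norm_triangle_ineq[of "a (s * int k) - d n (s * int k)" "d n (s * int k)"] by simp
      also have "\<dots> < e / 2 + e / 2"
        by (rule add_strict_mono[OF order_le_less_trans[OF a(2) n]]) (use k1[OF that] in simp)
      finally show ?thesis by simp
    qed
    then show "\<exists>k1. \<forall>k\<ge>k1. norm (a (s * int k) - 0) < e" by blast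
  qed
  have alim1: "(\<lambda>k. a (int k)) \<longlonglongrightarrow> 0" "(\<lambda>k. a (- int k)) \<longlonglongrightarrow> 0" using alim[of 1] alim[of "- 1"] by simp_all
  have dB: "norm (d k j) \<le> 22" for k j
  proof -
    have "norm (d 0 j) \<le> 20" unfolding d_def R0 by (rule moebius_coeff_cis_le)
    moreover have "norm (a j - d k j) \<le> 1 / 4 * (2 * 1)"
      by (rule order_trans[OF a(2)]) (simp add: power_le_one)
    moreover have "norm (a j - d 0 j) \<le> 1 / 2" using a(2)[of j 0] by simp
    moreover have "norm (d k j) \<le> norm (d 0 j) + norm (a j - d 0 j) + norm (a j - d k j)"
    proof -
      have "d k j = (d 0 j + (a j - d 0 j)) - (a j - d k j)" by simp
      then show ?thesis by (metis (no_types, lifting) add_right_mono norm_triangle_ineq norm_triangle_ineq4 order_trans)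
    qed
    ultimately show ?thesis by simp
  qed
  define K0 where "K0 = {t. \<forall>i l. \<epsilon> i \<le> \<bar>of_int (D i) * t + 2 * pi * of_int l\<bar>}"
  define K where "K = {t. moebius_arg t \<in> K0}"
  have "\<not> summable \<epsilon>"
    using not_summable_inverse_G[OF div c(1), of k0] by (simp add: \<epsilon>_def[abs_def] x_def D_def)
  then have "negligible K0" unfolding K0_def
    by (intro lacunary_null DS \<epsilon>) (use D3 in \<open>auto intro: order_trans[of 2 3]\<close>)
  then have negK: "negligible K" unfolding K_def by (rule negligible_moebius_preimage)
  have cloK: "closed K"
  proof -
    have "K = (\<Inter>i. \<Inter>l::int. {t. \<epsilon> i \<le> \<bar>of_int (D i) * moebius_arg t + 2 * pi * of_int l\<bar>})" by (auto simp: K_def K0_def)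
    moreover have "closed {t. \<epsilon> i \<le> \<bar>of_int (D i) * moebius_arg t + 2 * pi * of_int l\<bar>}" for i and l :: int
      by (intro closed_Collect_le continuous_intros)
    ultimately show ?thesis by (auto intro!: closed_INT)
  qed
  have perK: "t \<in> K \<longleftrightarrow> t + 2 * pi \<in> K" for t
  proof -
    have "of_int (D i) * moebius_arg (t + 2 * pi) + 2 * pi * of_int l = of_int (D i) * moebius_arg t + 2 * pi * of_int (D i + l)" for i l
      unfolding moebius_arg_shift by (simp add: algebra_simps)
    then have *: "t + 2 * pi \<in> K \<longleftrightarrow> (\<forall>i l. \<epsilon> i \<le> \<bar>of_int (D i) * moebius_arg t + 2 * pi * of_int (D i + l)\<bar>)"
      by (simp only: K_def K0_def mem_Collect_eq)
    show ?thesis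
    proof
      assume "t \<in> K"
      then show "t + 2 * pi \<in> K" unfolding * unfolding K_def K0_def mem_Collect_eq by blast
    next
      assume A: "t + 2 * pi \<in> K"
      have "\<epsilon> i \<le> \<bar>of_int (D i) * moebius_arg t + 2 * pi * of_int l\<bar>" for i l
      proof -
        have "\<epsilon> i \<le> \<bar>of_int (D i) * moebius_arg t + 2 * pi * of_int (D i + (l - D i))\<bar>" using A unfolding * by blast
        then show ?thesis by simp
      qed
      then show "t \<in> K" unfolding K_def K0_def mem_Collect_eq by blast
    qed
  qed
  have null: "K \<in> null_sets lborel"
  proof -
    have "K \<in> null_sets lebesgue" using negK by (simp add: negligible_iff_null_sets)
    moreover have "K \<in> sets lborel" using cloK by (simp add: borel_closed)
    ultimately show ?thesis by (simp add: null_sets_def emeasure_completion)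
  qed
  have van: "(\<lambda>N::nat. \<Sum>n = - int N..int N. a n * exp (\<i> * of_int n * of_real t)) \<longlonglongrightarrow> 0" if t: "t \<notin> K" for t
  proof -
    obtain i l where il: "\<bar>of_int (D i) * moebius_arg t + 2 * pi * of_int l\<bar> < \<epsilon> i"
      using t unfolding K_def K0_def by (auto simp: not_le)
    have "continuous_on UNIV (\<lambda>s. \<bar>of_int (D i) * moebius_arg s + 2 * pi * of_int l\<bar>)" by (intro continuous_intros)
    then have "open {s. \<bar>of_int (D i) * moebius_arg s + 2 * pi * of_int l\<bar> < \<epsilon> i}"
      by (intro open_Collect_less continuous_on_const)
    then obtain \<rho> where \<rho>: "0 < \<rho>" "\<And>s. dist s t < \<rho> \<Longrightarrow> \<bar>of_int (D i) * moebius_arg s + 2 * pi * of_int l\<bar> < \<epsilon> i"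
      using il unfolding open_dist by blast
    have "(\<lambda>N. \<Sum>n = - int N..int N. a n * cis (of_int n * t)) \<longlonglongrightarrow> 0"
    \<comment> \<open>From \<open>Suc i\<close> on, the product contains the factor of index i,
      which vanishes near \<open>t\<close> after the Moebius substitution.\<close>
    proof (rule localization[where P = "\<lambda>k s. R k (moebius_arg s)" and d = d and B = 22 and \<rho> = \<rho> and ?k1.0 = "Suc i"])
      fix k
      obtain b where b: "(\<lambda>n. norm (b n)) summable_on UNIV" "\<And>t. ((\<lambda>n. b n * cis (of_int n * t)) has_sum R k t) UNIV"
        using Rv[of k] unfolding weighted_fourier_def by blast
      show "continuous_on {-pi..pi} (\<lambda>s. R k (moebius_arg s))"
        using moebius_coeff_has_sum(3)[OF b, of 0] by simp
      show "\<exists>M. \<forall>s. norm (R k (moebius_arg s)) \<le> M" using weighted_fourier_bounded[OF Rv[of k]] by blast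
      show "d k j = integral {-pi..pi} (\<lambda>s. R k (moebius_arg s) * cis (- (of_int j * s))) / (2 * pi)" for j
        by (simp add: d_def moebius_coeff_def)
      show "norm (d k j) \<le> 22" for j by (rule dB)
    next
      fix k s and l' :: int assume k: "Suc i \<le> k" and s: "\<bar>s - t + 2 * pi * of_int l'\<bar> < \<rho>"
      have "dist (s + 2 * pi * of_int l') t < \<rho>" using s by (simp add: dist_real_def algebra_simps)
      then have "S i (moebius_arg (s + 2 * pi * of_int l')) = 0" using \<rho>(2) by (intro S0[of i _ l]) (simp add: less_imp_le)
      then have "R k (moebius_arg (s + 2 * pi * of_int l')) = 0" unfolding R_def using k by (intro prod_zero) auto
      then show "R k (moebius_arg s) = 0" unfolding moebius_arg_shift_int weighted_fourier_periodic[OF Rv[of k]] .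
    qed (use a(1) alim1 \<rho> in simp_all)
    then show ?thesis by (simp add: cis_conv_exp mult_ac)
  qed
  show ?thesis
  proof (intro exI[of _ K] conjI allI exI[of _ a] impI)
    show "\<exists>n. a n \<noteq> 0" using a0 by blast
    show "\<exists>C. \<forall>n::int. n < -1 \<longrightarrow> norm (a n) \<le> C * exp (- \<omega> (ln (real_of_int \<bar>n\<bar>)))"
      by (rule exI[of _ "exp (G 1 + 256 * (G 1)\<^sup>2)"]) (use neg in simp)
  qed (use cloK perK null van in auto)
qed

end
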